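(* Let $\gamma^\dagger \in H^1_+(S^1)$ and $u = F(\gamma^\dagger)$, and assume that $\gamma^\dagger \in W^{s,q}(S^1)$ with $1 < s \le 2$ and $2 \le q \le \infty$. Let $q_*$ be the conjugate exponent of $q$, i.e. $\frac1q+\frac1{q_*}=1$ (so $q_*=1$ if $q=\infty$). For $\alpha>0$ and $\delta>0$ let $\gamma_\alpha^\delta$ denote any minimizer over $H^1_+(S^1)$ of $\mathcal{T}_\alpha(\cdot;u^\delta)$ for any $u^\delta \in L^2(S^1\times\mathbb{R}_{\ge 0})$ with $\|u^\delta-u\|_{L^2}\le\delta$. (1) If $q < \infty$ or $s < 2$, then for a parameter choice $\alpha = \alpha(\delta) \sim \delta^{2\frac{q_*-s+1}{q_*}}$ one has the convergence rate $$\|\gamma_\alpha^\delta - \gamma^\dagger\|_{H^1_0} = O\bigl(\delta^{\frac{s-1}{q_*}}\bigr) \quad\text{as } \delta \to 0.$$ (2) If $q = \infty$ and $s = 2$, let $c_1,c_2>0$ be constants such that $$c_1 \|\gamma-\gamma^\dagger\|_{H^1_0}^2 \le \|\gamma\|_{H^1_0}^2 - \|\gamma^\dagger\|_{H^1_0}^2 + c_2 \|F(\gamma)-F(\gamma^\dagger)\|_{L^2}^{2}\quad\text{for every } \gamma\in H^1_+(S^1)$$ (such constants exist). Then for a constant parameter choice $0<\alpha \le 1/(2c_2)$ one has the convergence rate $$\|\gamma_\alpha^\delta - \gamma^\dagger\|_{H^1_0} = O(\delta)\quad\text{as } \delta \to 0.$$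
   Context: $S^1$ is the circle of length $2\pi$. $H^1(S^1)$ is the usual first order real-valued $L^2$-Sobolev space, whose elements are identified with their continuous representatives, and $H^1_+(S^1) := \{\gamma \in H^1(S^1) : \gamma(t) \ge 0 \text{ for every } t \in S^1\}$. The homogeneous first order Sobolev (semi)norm is $\|\gamma\|_{H^1_0} := \|\dot\gamma\|_{L^2(S^1)}$. For $\gamma \in H^1_+(S^1)$ the hypograph is $\operatorname{hyp}(\gamma) := \{(t,x) \in S^1\times\mathbb{R}_{\ge 0} : 0 \le x \le \gamma(t)\}$, and $F\colon H^1_+(S^1) \to L^2(S^1\times\mathbb{R}_{\ge 0})$ is the map $F(\gamma) := \chi_{\operatorname{hyp}(\gamma)}$, where $\chi_{\operatorname{hyp}(\gamma)}(t,x) = 1$ if $0\le x \le \gamma(t)$ and $=0$ if $x > \gamma(t)$. The Tikhonov functional is, for $\alpha>0$ and $v\in L^2(S^1\times\mathbb{R}_{\ge 0})$, $\mathcal{T}_\alpha(\gamma;v) := \|F(\gamma)-v\|_{L^2}^2 + \alpha\|\dot\gamma\|_{L^2}^2$, $\gamma\in H^1_+(S^1)$. $W^{s,q}(S^1)$ denotes the (fractional order) Sobolev space in the sense of Bergh and Löfström, i.e. the space of distributions $f$ on $S^1$ such that the distribution with Fourier series $\sum_{k\in\mathbb{Z}} (1+k^2)^{s/2}\hat f(k) e^{ikt}$ belongs to $L^q(S^1)$. The notation $\alpha(\delta)\sim\delta^{r}$ means that there are constants $0<a\le b$ with $a\delta^r\le\alpha(\delta)\le b\delta^r$ for all sufficiently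 small $\delta>0$. The $O(\cdot)$ estimates are uniform over all admissible data $u^\delta$ and all minimizers $\gamma_\alpha^\delta$ (the implied constants may depend on $\gamma^\dagger$, $s$, $q$, and the parameter choice). *)

theory Defs
  imports "HOL-Analysis.Analysis"
begin

text \<open>
  Functions on the circle of length \<open>2\<pi>\<close> are represented by functions on \<open>\<real>\<close>.  Pointwise defined
  ones (continuous representatives, test functions) are required to be \<open>2\<pi>\<close>-periodic; elements of
  Lebesgue spaces are only ever evaluated on the fundamental domain.  No quotient by almost
  everywhere equality is formed: all notions below are invariant under it in their Lebesgue arguments.
\<close>

definition circle_measure :: "real measure" where
  "circle_measure = restrict_space lborel {0..<2 * pi}"

definition cylinder_measure :: "(real \<times> real) measure" where
  "cylinder_measure = circle_measure \<Otimes>\<^sub>M restrict_space lborel {0..}"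

definition periodic_2pi :: "(real \<Rightarrow> 'a) \<Rightarrow> bool" where
  "periodic_2pi f \<longleftrightarrow> (\<forall>t. f (t + 2 * pi) = f t)"

definition Lp :: "ennreal \<Rightarrow> 'a measure \<Rightarrow> ('a \<Rightarrow> 'b::real_normed_vector) set" where
  "Lp p M = {f \<in> borel_measurable M.
     if p = \<infinity> then \<exists>C. AE x in M. norm (f x) \<le> C
     else integrable M (\<lambda>x. norm (f x) powr enn2real p)}"

definition L2_norm :: "'a measure \<Rightarrow> ('a \<Rightarrow> real) \<Rightarrow> real" where
  "L2_norm M f = sqrt (LINT x|M. (f x)\<^sup>2)"


definition nth_derivative :: "nat \<Rightarrow> (real \<Rightarrow> 'a::real_normed_vector) \<Rightarrow> real \<Rightarrow> 'a" where
  "nth_derivative n = (\<lambda>f t. vector_derivative f (at t)) ^^ n"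

definition test_functions :: "(real \<Rightarrow> 'a::real_normed_vector) set" where
  "test_functions =
     {\<phi>. periodic_2pi \<phi> \<and> (\<forall>n t. nth_derivative n \<phi> differentiable (at t))}"

definition is_weak_deriv :: "(real \<Rightarrow> real) \<Rightarrow> (real \<Rightarrow> real) \<Rightarrow> bool" where
  "is_weak_deriv f g \<longleftrightarrow> (\<forall>\<phi>\<in>test_functions.
     (LINT t|circle_measure. f t * nth_derivative 1 \<phi> t) = - (LINT t|circle_measure. g t * \<phi> t))"

text \<open>The elements of \<open>H\<^sup>1\<close> are the continuous representatives, whence the pointwise conditions.\<close>

definition H1 :: "(real \<Rightarrow> real) set" where
  "H1 = {f. periodic_2pi f \<and> continuous_on UNIV f \<and> (\<exists>g\<in>Lp 2 circle_measure. is_weak_deriv f g)}"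

definition H1_plus :: "(real \<Rightarrow> real) set" where
  "H1_plus = {f \<in> H1. \<forall>t. f t \<ge> 0}"

definition weak_deriv :: "(real \<Rightarrow> real) \<Rightarrow> real \<Rightarrow> real" where
  "weak_deriv f = (SOME g. g \<in> Lp 2 circle_measure \<and> is_weak_deriv f g)"

definition H1_seminorm :: "(real \<Rightarrow> real) \<Rightarrow> real" where
  "H1_seminorm f = L2_norm circle_measure (weak_deriv f)"


text \<open>A distribution is a complex linear functional on the complex test functions, continuous
  with respect to the seminorms \<open>sup |\<phi>\<^sup>(\<^sup>j\<^sup>)|\<close>; its values off the test functions are irrelevant.\<close>

definition distribution :: "((real \<Rightarrow> complex) \<Rightarrow> complex) \<Rightarrow> bool" where
  "distribution T \<longleftrightarrow>
     (\<forall>\<phi>\<in>test_functions. \<forall>\<psi>\<in>test_functions. \<forall>a b.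
        T (\<lambda>t. a * \<phi> t + b * \<psi> t) = a * T \<phi> + b * T \<psi>) \<and>
     (\<exists>C N. \<forall>\<phi>\<in>test_functions.
        norm (T \<phi>) \<le> C * (\<Sum>j\<le>N. SUP t. norm (nth_derivative j \<phi> t)))"

definition distribution_of :: "(real \<Rightarrow> complex) \<Rightarrow> (real \<Rightarrow> complex) \<Rightarrow> complex" where
  "distribution_of f = (\<lambda>\<phi>. LINT t|circle_measure. f t * \<phi> t)"

definition fourier_coeff :: "((real \<Rightarrow> complex) \<Rightarrow> complex) \<Rightarrow> int \<Rightarrow> complex" where
  "fourier_coeff T k = T (\<lambda>t. cis (- (real_of_int k * t))) / (2 * pi)"

text \<open>A distribution on the circle is determined by its Fourier coefficients, so the distribution
  with a prescribed Fourier series lies in \<open>L\<^sup>q\<close> iff some \<open>g \<in> L\<^sup>q\<close> has that Fourier series.\<close>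

definition fractional_sobolev :: "real \<Rightarrow> ennreal \<Rightarrow> ((real \<Rightarrow> complex) \<Rightarrow> complex) set" where
  "fractional_sobolev s q = {T. distribution T \<and>
     (\<exists>g\<in>Lp q circle_measure. \<forall>k. fourier_coeff (distribution_of g) k =
        complex_of_real ((1 + (real_of_int k)\<^sup>2) powr (s / 2)) * fourier_coeff T k)}"


definition hyp :: "(real \<Rightarrow> real) \<Rightarrow> (real \<times> real) set" where
  "hyp \<gamma> = {(t, x). 0 \<le> x \<and> x \<le> \<gamma> t}"

definition F :: "(real \<Rightarrow> real) \<Rightarrow> real \<times> real \<Rightarrow> real" where
  "F \<gamma> = indicator (hyp \<gamma>)"

definition tikhonov :: "real \<Rightarrow> (real \<times> real \<Rightarrow> real) \<Rightarrow> (real \<Rightarrow> real) \<Rightarrow> real" where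
  "tikhonov \<alpha> v \<gamma> =
     (L2_norm cylinder_measure (\<lambda>z. F \<gamma> z - v z))\<^sup>2 + \<alpha> * (H1_seminorm \<gamma>)\<^sup>2"

definition tikhonov_minimizer :: "real \<Rightarrow> (real \<times> real \<Rightarrow> real) \<Rightarrow> (real \<Rightarrow> real) \<Rightarrow> bool" where
  "tikhonov_minimizer \<alpha> v \<gamma> \<longleftrightarrow> is_arg_min (tikhonov \<alpha> v) (\<lambda>\<eta>. \<eta> \<in> H1_plus) \<gamma>"

end

theory Submission
  imports Defs
begin

text \<open>
  Put \<open>h = \<gamma> - \<gamma>\<^sub>0\<close> and \<open>\<kappa> = (s - 1) / q\<^sub>*\<close>.  Since \<open>\<parallel>F \<gamma> - F \<gamma>\<^sub>0\<parallel>\<^sup>2\<close> is the \<open>L\<^sup>1\<close> norm of \<open>h\<close>, everything rests on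
  \<open>|\<langle>\<gamma>\<^sub>0', h'\<rangle>| \<le> C (\<delta>\<^sup>\<kappa> \<parallel>h'\<parallel>\<^sub>2 + \<delta>\<^sup>\<kappa>\<^sup>-\<^sup>1 \<parallel>h\<parallel>\<^sub>1)\<close> for \<open>0 < \<delta> \<le> 1\<close>: comparing a minimizer with \<open>\<gamma>\<^sub>0\<close> then
  gives the rates by absorption, and \<open>\<delta> \<rightarrow> 0\<close> gives the source condition when \<open>\<kappa> = 1\<close>.

  It suffices to treat trigonometric polynomials \<open>h\<close>.  If \<open>g \<in> L\<^sup>q\<close> has the Fourier coefficients
  \<open>(1 + k\<^sup>2)\<^sup>s\<^sup>/\<^sup>2\<close> times those of \<open>\<gamma>\<^sub>0\<close>, the formula \<open>c A\<^sup>-\<^sup>s\<^sup>/\<^sup>2 = \<integral>\<^sub>0\<^sup>\<infinity> \<mu>\<^sup>-\<^sup>s\<^sup>/\<^sup>2 / (\<mu> + A) d\<mu>\<close> with \<open>A = 1 + k\<^sup>2\<close>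
  writes the pairing as an integral over \<open>\<mu>\<close> of \<open>\<langle>g, z\<^sub>\<mu>\<rangle>\<close>, where \<open>z\<^sub>\<mu>\<close> is \<open>h\<close> minus its resolvent average.  That
  average contracts the supremum and \<open>L\<^sup>1\<close> norms, which bounds \<open>\<langle>g, z\<^sub>\<mu>\<rangle>\<close> for small \<open>\<mu>\<close>, while
  \<open>\<parallel>z\<^sub>\<mu>\<parallel>\<^sub>2 \<le> \<mu>\<^sup>-\<^sup>1\<^sup>/\<^sup>2 \<parallel>h'\<parallel>\<^sub>2\<close> takes care of large \<open>\<mu>\<close>; the two regimes are separated at \<open>\<mu> = \<delta>\<^sup>-\<^sup>2\<^sup>/\<^sup>q\<^sup>*\<close>.
\<close>

section \<open>Square integrable functions\<close>

text \<open>Fractional smoothness of \<open>\<gamma>\<^sub>0\<close> supplies only the Fourier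
  coefficients of some g in L^q, so the estimate must come from Fourier multipliers acting on h,
  which is measured in L^1 and, through its derivative, in L^2. At the endpoint q = \<infinity>
  sharp frequency cut-offs are not uniformly bounded in L^1 or in the supremum norm. Resolvents are:
  those of second order factor into two of first order, each averaging translates against a positive
  kernel of mass one. The cut M balances the ranges: small \<mu> cost \<delta>^(1/q') M^(1 - s/2),
  large \<mu> cost M^((1 - s)/2), and both become \<delta>^\<kappa>. For s = 2 the integral formula
  diverges, but there the negative power is itself the resolvent at \<mu> = 0. For the rates, the
  L^1 term, of size \<alpha> \<delta>^(\<kappa> - 1) times the misfit, must be absorbed by half of
  the misfit. If \<kappa> < 1 its factor tends to 0; if \<kappa> = 1 it does not decay, and the
  bound on \<alpha> takes over.\<close>

lemma Lp_2_iff: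
  "f \<in> Lp 2 M \<longleftrightarrow> f \<in> borel_measurable M \<and> integrable M (\<lambda>x. (norm (f x))\<^sup>2)"
proof -
  have "(2::ennreal) \<noteq> \<infinity>" "enn2real 2 = 2"
    by (simp_all add: enn2real_eq_posreal_iff)
  moreover have "norm (f x) powr 2 = (norm (f x))\<^sup>2" for x
    by (cases "f x = 0") (simp_all flip: powr_numeral)
  ultimately show ?thesis
    by (simp add: Lp_def)
qed

lemma L2_norm_nonneg [simp]: "0 \<le> L2_norm M f"
  by (simp add: L2_norm_def)

lemma L2_norm_power2: "(L2_norm M f)\<^sup>2 = (LINT x|M. (f x)\<^sup>2)"
  by (simp add: L2_norm_def)

lemma L2_norm_abs [simp]: "L2_norm M (\<lambda>x. \<bar>f x\<bar>) = L2_norm M f"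
  by (simp add: L2_norm_def)

lemma L2_norm_minus_commute:
  "L2_norm M (\<lambda>x. norm (f x - g x)) = L2_norm M (\<lambda>x. norm (g x - f x))"
  by (simp add: norm_minus_commute)

lemma Lp_2_norm:
  assumes "f \<in> Lp 2 M"
  shows "(\<lambda>x. norm (f x)) \<in> Lp 2 M"
  using assms by (auto simp: Lp_2_iff)

lemma Lp_2_scaleR:
  fixes f :: "'a \<Rightarrow> 'b::{real_normed_vector, second_countable_topology}"
  assumes "f \<in> Lp 2 M"
  shows "(\<lambda>x. c *\<^sub>R f x) \<in> Lp 2 M"
  using assms by (auto simp: Lp_2_iff power_mult_distrib)

lemma Lp_2_mult_left:
  fixes f :: "'a \<Rightarrow> 'b::{real_normed_div_algebra, second_countable_topology}"
  assumes "f \<in> Lp 2 M"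
  shows "(\<lambda>x. c * f x) \<in> Lp 2 M"
  using assms by (auto simp: Lp_2_iff power_mult_distrib norm_mult)

lemma Lp_2_add:
  fixes f g :: "'a \<Rightarrow> 'b::{real_normed_vector, second_countable_topology}"
  assumes "f \<in> Lp 2 M" "g \<in> Lp 2 M"
  shows "(\<lambda>x. f x + g x) \<in> Lp 2 M"
proof -
  note [measurable] = assms[unfolded Lp_2_iff, THEN conjunct1]
  have "integrable M (\<lambda>x. (norm (f x + g x))\<^sup>2)"
  proof (rule Bochner_Integration.integrable_bound)
    show "integrable M (\<lambda>x. 2 * (norm (f x))\<^sup>2 + 2 * (norm (g x))\<^sup>2)"
      using assms by (auto simp: Lp_2_iff)
    have "(norm (a + b))\<^sup>2 \<le> 2 * (norm a)\<^sup>2 + 2 * (norm b)\<^sup>2" for a b :: 'b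
    proof -
      have "(norm (a + b))\<^sup>2 \<le> (norm a + norm b)\<^sup>2"
        by (intro power_mono norm_triangle_ineq) auto
      also have "\<dots> \<le> 2 * (norm a)\<^sup>2 + 2 * (norm b)\<^sup>2"
        using sum_squares_bound[of "norm a" "norm b"] by (simp add: power2_sum)
      finally show ?thesis .
    qed
    then show "AE x in M. norm ((norm (f x + g x))\<^sup>2)
        \<le> norm (2 * (norm (f x))\<^sup>2 + 2 * (norm (g x))\<^sup>2)"
      by simp
  qed simp
  then show ?thesis
    by (simp add: Lp_2_iff)
qed

lemma Lp_2_diff:
  fixes f g :: "'a \<Rightarrow> 'b::{real_normed_vector, second_countable_topology}"
  assumes "f \<in> Lp 2 M" "g \<in> Lp 2 M"
  shows "(\<lambda>x. f x - g x) \<in> Lp 2 M"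
  using Lp_2_add[OF assms(1) Lp_2_scaleR[OF assms(2), of "-1"]] by simp

lemma (in finite_measure) Lp_2_bounded:
  assumes "f \<in> borel_measurable M" "\<And>x. x \<in> space M \<Longrightarrow> norm (f x) \<le> B"
  shows "f \<in> Lp 2 M"
proof -
  note [measurable] = assms(1)
  have "integrable M (\<lambda>x. (norm (f x))\<^sup>2)"
    by (rule integrable_const_bound[of _ "B\<^sup>2"]) (auto intro!: AE_I2 power_mono assms)
  then show ?thesis by (simp add: Lp_2_iff)
qed

lemma integrable_mult_Lp_2:
  fixes f g :: "'a \<Rightarrow> 'b::{real_normed_div_algebra, banach, second_countable_topology}"
  assumes "f \<in> Lp 2 M" "g \<in> Lp 2 M"
  shows "integrable M (\<lambda>x. f x * g x)"
proof (rule Bochner_Integration.integrable_bound)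
  note [measurable] = assms[unfolded Lp_2_iff, THEN conjunct1]
  show "(\<lambda>x. f x * g x) \<in> borel_measurable M" by simp
  show "integrable M (\<lambda>x. (norm (f x))\<^sup>2 + (norm (g x))\<^sup>2)"
    using assms by (simp add: Lp_2_iff)
  have "norm a * norm b \<le> (norm a)\<^sup>2 + (norm b)\<^sup>2" for a b :: 'b
    using sum_squares_bound[of "norm a" "norm b"] mult_nonneg_nonneg[OF norm_ge_zero[of a] norm_ge_zero[of b]]
    by linarith
  then show "AE x in M. norm (f x * g x) \<le> norm ((norm (f x))\<^sup>2 + (norm (g x))\<^sup>2)"
    by (simp add: norm_mult)
qed

text \<open>Integrating (s|f| - t|g|)^2 \<ge> 0 gives a bound with free weights; s = b and t = a
  make it sharp, and a vanishing norm is handled by letting its weight grow.\<close>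

lemma Cauchy_Schwarz_LINT:
  fixes f g :: "'a \<Rightarrow> 'b::{real_normed_div_algebra, banach, second_countable_topology}"
  assumes "f \<in> Lp 2 M" "g \<in> Lp 2 M"
  shows "(LINT x|M. norm (f x) * norm (g x))
    \<le> L2_norm M (\<lambda>x. norm (f x)) * L2_norm M (\<lambda>x. norm (g x))"
proof -
  define a b I where "a = L2_norm M (\<lambda>x. norm (f x))" and "b = L2_norm M (\<lambda>x. norm (g x))"
    and "I = (LINT x|M. norm (f x) * norm (g x))"
  have fg: "integrable M (\<lambda>x. norm (f x) * norm (g x))"
    using integrable_mult_Lp_2[OF assms(1)[THEN Lp_2_norm] assms(2)[THEN Lp_2_norm]] .
  have "0 \<le> a" "0 \<le> b" by (simp_all add: a_def b_def)
  have *: "2 * s * t * I \<le> s\<^sup>2 * a\<^sup>2 + t\<^sup>2 * b\<^sup>2" for s t :: real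
  proof -
    have "2 * s * t * I = (LINT x|M. 2 * s * t * (norm (f x) * norm (g x)))"
      by (simp add: I_def)
    also have "\<dots> \<le> (LINT x|M. s\<^sup>2 * (norm (f x))\<^sup>2 + t\<^sup>2 * (norm (g x))\<^sup>2)"
    proof (rule integral_mono)
      show "integrable M (\<lambda>x. s\<^sup>2 * (norm (f x))\<^sup>2 + t\<^sup>2 * (norm (g x))\<^sup>2)"
        using assms by (simp add: Lp_2_iff)
      show "2 * s * t * (norm (f x) * norm (g x)) \<le> s\<^sup>2 * (norm (f x))\<^sup>2 + t\<^sup>2 * (norm (g x))\<^sup>2" for x
        using sum_squares_bound[of "s * norm (f x)" "t * norm (g x)"]
        by (simp add: power_mult_distrib mult_ac)
    qed (use fg in simp)
    also have "\<dots> = s\<^sup>2 * a\<^sup>2 + t\<^sup>2 * b\<^sup>2"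
      using assms by (simp add: Lp_2_iff a_def b_def L2_norm_power2)
    finally show ?thesis .
  qed
  have "I \<le> a * b"
  proof (cases "a = 0 \<or> b = 0")
    case False
    with \<open>0 \<le> a\<close> \<open>0 \<le> b\<close> have "0 < a" "0 < b" by auto
    have "2 * (b * a) * I \<le> 2 * (b * a) * (a * b)"
      using *[of b a] by (simp add: power2_eq_square algebra_simps)
    then show ?thesis
      using \<open>0 < a\<close> \<open>0 < b\<close> by (subst (asm) mult_le_cancel_left_pos) simp_all
  next
    case True
    have "I \<le> e" if "e > 0" for e
    proof (cases "a = 0")
      case True
      \<comment> \<open>The weight on the factor of norm 0 is of order 1/e; the summand 1 keeps it
        positive when both norms vanish.\<close>
      have "2 * ((b\<^sup>2 + 1) / e) * I \<le> b\<^sup>2"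
        using *[of "(b\<^sup>2 + 1) / e" 1] True by simp
      then have "2 * (b\<^sup>2 + 1) * I \<le> b\<^sup>2 * e"
        using that by (simp add: field_simps)
      also have "\<dots> \<le> 2 * (b\<^sup>2 + 1) * e"
        using that by (simp add: algebra_simps)
      finally show ?thesis
        by (subst (asm) mult_le_cancel_left_pos) (simp_all add: add_nonneg_pos)
    next
      case False
      with \<open>a = 0 \<or> b = 0\<close> have "b = 0" by simp
      have "2 * ((a\<^sup>2 + 1) / e) * I \<le> a\<^sup>2"
        using *[of 1 "(a\<^sup>2 + 1) / e"] \<open>b = 0\<close> by simp
      then have "2 * (a\<^sup>2 + 1) * I \<le> a\<^sup>2 * e"
        using that by (simp add: field_simps)
      also have "\<dots> \<le> 2 * (a\<^sup>2 + 1) * e"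
        using that by (simp add: algebra_simps)
      finally show ?thesis
        by (subst (asm) mult_le_cancel_left_pos) (simp_all add: add_nonneg_pos)
    qed
    then have "I \<le> 0" by (rule field_le_epsilon) (simp add: algebra_simps)
    then show ?thesis using True by auto
  qed
  then show ?thesis by (simp add: a_def b_def I_def)
qed

lemma norm_LINT_mult_le_L2_norm:
  fixes f g :: "'a \<Rightarrow> 'b::{real_normed_div_algebra, banach, second_countable_topology}"
  assumes "f \<in> Lp 2 M" "g \<in> Lp 2 M"
  shows "norm (LINT x|M. f x * g x) \<le> L2_norm M (\<lambda>x. norm (f x)) * L2_norm M (\<lambda>x. norm (g x))"
  using integral_norm_bound[of M "\<lambda>x. f x * g x"] Cauchy_Schwarz_LINT[OF assms]
  by (simp add: norm_mult)

lemma L2_norm_triangle: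
  fixes f g :: "'a \<Rightarrow> 'b::{real_normed_div_algebra, banach, second_countable_topology}"
  assumes "f \<in> Lp 2 M" "g \<in> Lp 2 M"
  shows "L2_norm M (\<lambda>x. norm (f x + g x)) \<le> L2_norm M (\<lambda>x. norm (f x)) + L2_norm M (\<lambda>x. norm (g x))"
proof (rule power2_le_imp_le)
  have fg: "integrable M (\<lambda>x. norm (f x) * norm (g x))"
    using integrable_mult_Lp_2[OF assms(1)[THEN Lp_2_norm] assms(2)[THEN Lp_2_norm]] .
  have "(LINT x|M. (norm (f x + g x))\<^sup>2)
      \<le> (LINT x|M. (norm (f x))\<^sup>2 + (norm (g x))\<^sup>2 + 2 * (norm (f x) * norm (g x)))"
  proof (rule integral_mono)
    show "integrable M (\<lambda>x. (norm (f x + g x))\<^sup>2)"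
      using Lp_2_add[OF assms] by (simp add: Lp_2_iff)
    show "integrable M (\<lambda>x. (norm (f x))\<^sup>2 + (norm (g x))\<^sup>2 + 2 * (norm (f x) * norm (g x)))"
      using assms fg by (simp add: Lp_2_iff)
    show "(norm (f x + g x))\<^sup>2 \<le> (norm (f x))\<^sup>2 + (norm (g x))\<^sup>2 + 2 * (norm (f x) * norm (g x))" for x
      using power_mono[OF norm_triangle_ineq[of "f x" "g x"], of 2] by (simp add: power2_sum)
  qed
  also have "\<dots> = (LINT x|M. (norm (f x))\<^sup>2) + (LINT x|M. (norm (g x))\<^sup>2)
      + 2 * (LINT x|M. norm (f x) * norm (g x))"
    using assms fg by (simp add: Lp_2_iff)
  also have "\<dots> \<le> (L2_norm M (\<lambda>x. norm (f x)) + L2_norm M (\<lambda>x. norm (g x)))\<^sup>2"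
    using Cauchy_Schwarz_LINT[OF assms] by (simp add: power2_sum L2_norm_power2)
  finally show "(L2_norm M (\<lambda>x. norm (f x + g x)))\<^sup>2
      \<le> (L2_norm M (\<lambda>x. norm (f x)) + L2_norm M (\<lambda>x. norm (g x)))\<^sup>2"
    by (simp add: L2_norm_power2)
qed simp

lemma L2_norm_triangle_diff:
  fixes f g h :: "'a \<Rightarrow> 'b::{real_normed_div_algebra, banach, second_countable_topology}"
  assumes "f \<in> Lp 2 M" "g \<in> Lp 2 M" "h \<in> Lp 2 M"
  shows "L2_norm M (\<lambda>x. norm (f x - h x))
    \<le> L2_norm M (\<lambda>x. norm (f x - g x)) + L2_norm M (\<lambda>x. norm (g x - h x))"
  using L2_norm_triangle[OF Lp_2_diff[OF assms(1,2)] Lp_2_diff[OF assms(2,3)]] by simp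

lemma L2_norm_mult_left:
  fixes f :: "'a \<Rightarrow> 'b::real_normed_div_algebra"
  shows "L2_norm M (\<lambda>x. norm (c * f x)) = norm c * L2_norm M (\<lambda>x. norm (f x))"
  by (simp add: L2_norm_def norm_mult power_mult_distrib real_sqrt_mult)

lemma (in finite_measure) L2_norm_le_bound:
  assumes "\<And>x. x \<in> space M \<Longrightarrow> \<bar>f x\<bar> \<le> B" "0 \<le> B"
  shows "L2_norm M f \<le> B * sqrt (measure M (space M))"
proof -
  have "(LINT x|M. (f x)\<^sup>2) \<le> (LINT x|M. B\<^sup>2)"
    using power_mono[OF assms(1), of _ 2] by (intro integral_mono') auto
  also have "\<dots> = B\<^sup>2 * measure M (space M)" by simp
  finally have "L2_norm M f \<le> sqrt (B\<^sup>2 * measure M (space M))"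
    unfolding L2_norm_def by simp
  then show ?thesis
    using assms(2) by (simp add: real_sqrt_mult)
qed

lemma L2_norm_tendsto_0_dominated:
  fixes f :: "nat \<Rightarrow> 'a \<Rightarrow> 'b::{real_normed_vector, second_countable_topology}"
  assumes "\<And>n. f n \<in> borel_measurable M" "w \<in> Lp 2 M"
    and "\<And>n x. x \<in> space M \<Longrightarrow> norm (f n x) \<le> norm (w x)"
    and "\<And>x. x \<in> space M \<Longrightarrow> (\<lambda>n. f n x) \<longlonglongrightarrow> 0"
  shows "(\<lambda>n. L2_norm M (\<lambda>x. norm (f n x))) \<longlonglongrightarrow> 0"
proof -
  note [measurable] = assms(1)
  have "(\<lambda>n. LINT x|M. (norm (f n x))\<^sup>2) \<longlonglongrightarrow> (LINT x|M. 0)"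
  proof (rule integral_dominated_convergence)
    show "integrable M (\<lambda>x. (norm (w x))\<^sup>2)" using assms(2) by (simp add: Lp_2_iff)
    show "AE x in M. (\<lambda>n. (norm (f n x))\<^sup>2) \<longlonglongrightarrow> 0"
    proof (rule AE_I2)
      fix x assume "x \<in> space M"
      from tendsto_power[OF tendsto_norm[OF assms(4)[OF this]], of 2]
      show "(\<lambda>n. (norm (f n x))\<^sup>2) \<longlonglongrightarrow> 0" by simp
    qed
    show "AE x in M. norm ((norm (f n x))\<^sup>2) \<le> (norm (w x))\<^sup>2" for n
      using assms(3) by (auto intro!: AE_I2 power_mono)
  qed simp_all
  then show ?thesis
    unfolding L2_norm_def using tendsto_real_sqrt by fastforce
qed

section \<open>Trigonometric polynomials on the circle\<close>

lemma space_circle_measure [simp]: "space circle_measure = {0..<2 * pi}"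
  by (simp add: circle_measure_def space_restrict_space)

lemma sets_circle_measure: "sets circle_measure = sets (restrict_space borel {0..<2 * pi})"
  unfolding circle_measure_def by (rule sets_restrict_space_cong) simp

lemma measure_circle_measure [simp]: "measure circle_measure {0..<2 * pi} = 2 * pi"
  by (simp add: circle_measure_def measure_restrict_space)

interpretation circle: finite_measure circle_measure
proof
  show "emeasure circle_measure (space circle_measure) \<noteq> \<infinity>"
    by (simp add: circle_measure_def emeasure_restrict_space)
qed

lemma borel_measurable_circle:
  "f \<in> borel_measurable borel \<Longrightarrow> f \<in> borel_measurable circle_measure"
  unfolding circle_measure_def by (rule measurable_restrict_space1) simp

text \<open>Adding the null endpoint 2 pi gives the closed interval on which the fundamental theorem
  of calculus is stated.\<close>

lemma LINT_circle:
  fixes f :: "real \<Rightarrow> 'a::{banach, second_countable_topology}"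
  assumes [measurable]: "f \<in> borel_measurable borel"
  shows "(LINT t|circle_measure. f t) = (LINT t|lborel. indicator {0..2 * pi} t *\<^sub>R f t)"
proof -
  have "(LINT t|circle_measure. f t) = (LINT t|lborel. indicator {0..<2 * pi} t *\<^sub>R f t)"
    unfolding circle_measure_def by (rule integral_restrict_space) simp
  also have "\<dots> = (LINT t|lborel. indicator {0..2 * pi} t *\<^sub>R f t)"
  proof (rule integral_cong_AE)
    show "AE t in lborel. indicator {0..<2 * pi} t *\<^sub>R f t = indicator {0..2 * pi} t *\<^sub>R f t"
      using AE_lborel_singleton[of "2 * pi"] by eventually_elim (auto simp: indicator_def)
  qed measurable
  finally show ?thesis .
qed

lemma bounded_continuous_circle:
  fixes f :: "real \<Rightarrow> 'a::real_normed_vector"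
  assumes "continuous_on UNIV f"
  obtains B where "0 \<le> B" "\<And>t. t \<in> {0..2 * pi} \<Longrightarrow> norm (f t) \<le> B"
proof -
  have "compact (f ` {0..2 * pi})"
    by (rule compact_continuous_image[OF continuous_on_subset[OF assms]]) auto
  from compact_imp_bounded[OF this] obtain B where B: "\<And>t. t \<in> {0..2 * pi} \<Longrightarrow> norm (f t) \<le> B"
    by (metis bounded_iff imageI)
  with that[of B] order_trans[OF norm_ge_zero B[of 0]] show thesis by auto
qed

lemma Lp_2_continuous:
  fixes f :: "real \<Rightarrow> 'a::{real_normed_vector, second_countable_topology}"
  assumes "continuous_on UNIV f"
  shows "f \<in> Lp 2 circle_measure"
proof -
  from bounded_continuous_circle[OF assms] obtain B
    where "\<And>t. t \<in> {0..2 * pi} \<Longrightarrow> norm (f t) \<le> B" by blast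
  then show ?thesis
    by (intro circle.Lp_2_bounded[of _ B] borel_measurable_circle borel_measurable_continuous_onI assms)
      auto
qed

lemma integrable_circle_continuous:
  fixes f :: "real \<Rightarrow> 'a::{banach, second_countable_topology}"
  assumes "continuous_on UNIV f"
  shows "integrable circle_measure f"
proof -
  from bounded_continuous_circle[OF assms] obtain B
    where "\<And>t. t \<in> {0..2 * pi} \<Longrightarrow> norm (f t) \<le> B" by blast
  then show ?thesis
    by (intro circle.integrable_const_bound[of _ B] borel_measurable_circle
        borel_measurable_continuous_onI assms AE_I2) auto
qed

lemma integrable_circle_Lp_2:
  fixes f :: "real \<Rightarrow> 'a::{real_normed_div_algebra, banach, second_countable_topology}"
  assumes "f \<in> Lp 2 circle_measure"
  shows "integrable circle_measure f"
  using integrable_mult_Lp_2[OF assms Lp_2_continuous[of "\<lambda>_. 1"]] by simp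

lemma LINT_circle_le_L2_norm:
  fixes f :: "real \<Rightarrow> 'a::{real_normed_div_algebra, banach, second_countable_topology}"
  assumes "f \<in> Lp 2 circle_measure"
  shows "(LINT t|circle_measure. norm (f t)) \<le> sqrt (2 * pi) * L2_norm circle_measure (\<lambda>t. norm (f t))"
  using Cauchy_Schwarz_LINT[OF Lp_2_continuous[of "\<lambda>_. 1::'a"] assms]
  by (simp add: L2_norm_def)

section \<open>Characters and Parseval's identity\<close>

abbreviation fchar :: "int \<Rightarrow> real \<Rightarrow> complex" where
  "fchar k t \<equiv> cis (real_of_int k * t)"

lemma LINT_fchar: "(LINT t|circle_measure. fchar k t) = (if k = 0 then 2 * pi else 0)"
proof (cases "k = 0")
  case False
  have "(LINT t|lborel. indicator {0..2 * pi} t *\<^sub>R fchar k t)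
      = (\<lambda>t. fchar k t / (\<i> * of_int k)) (2 * pi) - (\<lambda>t. fchar k t / (\<i> * of_int k)) 0"
  proof (rule integral_FTC_atLeastAtMost)
    show "((\<lambda>t. fchar k t / (\<i> * of_int k)) has_vector_derivative fchar k x) (at x within {0..2 * pi})" for x
      unfolding has_vector_derivative_def
      by (rule derivative_eq_intros refl)+ (use False in \<open>auto simp: fun_eq_iff scaleR_conv_of_real field_simps\<close>)
  qed (auto intro!: continuous_intros)
  also have "\<dots> = 0"
    using cis_multiple_2pi[of "real_of_int k"] by (simp add: mult_ac)
  finally show ?thesis
    using False by (subst LINT_circle) (auto intro!: borel_measurable_continuous_onI continuous_intros)
qed (simp add: scaleR_conv_of_real)

definition trig_poly :: "int set \<Rightarrow> (int \<Rightarrow> complex) \<Rightarrow> real \<Rightarrow> complex" where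
  "trig_poly K c t = (\<Sum>k\<in>K. c k * fchar k t)"

lemma continuous_on_trig_poly [continuous_intros]: "continuous_on A (trig_poly K c)"
  unfolding trig_poly_def[abs_def] by (intro continuous_intros)

lemma Lp_2_trig_poly: "trig_poly K c \<in> Lp 2 circle_measure"
  by (intro Lp_2_continuous continuous_intros)

lemma LINT_mult_trig_poly:
  assumes "g \<in> Lp 2 circle_measure"
  shows "(LINT t|circle_measure. g t * trig_poly K c t)
    = (\<Sum>k\<in>K. c k * (LINT t|circle_measure. g t * fchar k t))"
proof -
  have "(LINT t|circle_measure. g t * trig_poly K c t)
      = (LINT t|circle_measure. (\<Sum>k\<in>K. c k * (g t * fchar k t)))"
    by (simp add: trig_poly_def sum_distrib_left mult_ac)
  also have "\<dots> = (\<Sum>k\<in>K. LINT t|circle_measure. c k * (g t * fchar k t))"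
    by (intro Bochner_Integration.integral_sum integrable_mult_right integrable_mult_Lp_2 assms
        Lp_2_continuous continuous_intros)
  finally show ?thesis by simp
qed

text \<open>Parseval for finite sums: |T|^2 is a double sum over characters of index k - l, and only
  the diagonal survives integration.\<close>

lemma L2_norm_trig_poly:
  assumes "finite K"
  shows "(L2_norm circle_measure (\<lambda>t. norm (trig_poly K c t)))\<^sup>2 = 2 * pi * (\<Sum>k\<in>K. (norm (c k))\<^sup>2)"
proof -
  have "complex_of_real (LINT t|circle_measure. (norm (trig_poly K c t))\<^sup>2)
      = (LINT t|circle_measure. complex_of_real ((norm (trig_poly K c t))\<^sup>2))"
    using Lp_2_trig_poly[of K c] by (intro integral_of_real[symmetric]) (simp add: Lp_2_iff)
  also have "\<dots> = (LINT t|circle_measure. (\<Sum>k\<in>K. \<Sum>l\<in>K. c k * cnj (c l) * fchar (k - l) t))"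
  proof (rule Bochner_Integration.integral_cong[OF refl])
    fix t
    have *: "fchar k t * cnj (fchar l t) = fchar (k - l) t" for k l
      by (simp add: cis_cnj cis_mult left_diff_distrib)
    show "complex_of_real ((norm (trig_poly K c t))\<^sup>2)
        = (\<Sum>k\<in>K. \<Sum>l\<in>K. c k * cnj (c l) * fchar (k - l) t)"
      unfolding trig_poly_def complex_norm_square cnj_sum sum_product complex_cnj_mult *[symmetric]
      by (intro sum.cong refl) (simp only: mult_ac)
  qed
  also have "\<dots> = (\<Sum>k\<in>K. \<Sum>l\<in>K. c k * cnj (c l) * (LINT t|circle_measure. fchar (k - l) t))"
  proof -
    have "integrable circle_measure (\<lambda>t. c k * cnj (c l) * fchar (k - l) t)" for k l
      by (intro integrable_circle_continuous continuous_intros)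
    then show ?thesis by (simp add: Bochner_Integration.integral_sum)
  qed
  also have "\<dots> = (\<Sum>k\<in>K. \<Sum>l\<in>K. if k = l then 2 * pi * (c k * cnj (c l)) else 0)"
    unfolding LINT_fchar by (intro sum.cong) auto
  also have "\<dots> = complex_of_real (2 * pi * (\<Sum>k\<in>K. (norm (c k))\<^sup>2))"
    using assms by (simp add: sum.delta sum_distrib_left flip: complex_norm_square)
  finally show ?thesis
    unfolding L2_norm_power2 by (simp only: of_real_eq_iff)
qed

section \<open>The algebra of trigonometric polynomials and its L^2 closure\<close>

inductive trig_fun :: "(real \<Rightarrow> complex) \<Rightarrow> bool" where
  mono: "trig_fun (\<lambda>t. c * fchar k t)"
| add: "trig_fun f \<Longrightarrow> trig_fun g \<Longrightarrow> trig_fun (\<lambda>t. f t + g t)"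

lemma trig_fun_const: "trig_fun (\<lambda>t. c)"
  using trig_fun.mono[of c 0] by simp

text \<open>Stone-Weierstrass needs an algebra. The inductive description makes products a double
  induction, where index sets and coefficients would call for a convolution.\<close>

lemma trig_fun_mult:
  assumes "trig_fun f" "trig_fun g"
  shows "trig_fun (\<lambda>t. f t * g t)"
  using assms(1)
proof induction
  case (mono c k)
  from assms(2) show ?case
  proof induction
    case (mono d l)
    have "(\<lambda>t. c * fchar k t * (d * fchar l t)) = (\<lambda>t. (c * d) * fchar (k + l) t)"
      by (simp add: fun_eq_iff ring_distribs mult_ac flip: cis_mult)
    then show ?case using trig_fun.mono by metis
  qed (simp add: ring_distribs trig_fun.add)
qed (simp add: ring_distribs trig_fun.add)

text \<open>Polynomials with different index sets are merged by extending both coefficient families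
  by zero to the union.\<close>

lemma trig_fun_imp_trig_poly:
  assumes "trig_fun f"
  obtains K c where "finite K" "f = trig_poly K c"
  using assms
proof (induction arbitrary: thesis)
  case (mono c k)
  show ?case
    by (rule mono[of "{k}" "\<lambda>_. c"]) (auto simp: trig_poly_def)
next
  case (add f g)
  from add.IH obtain K c L d where *: "finite K" "f = trig_poly K c" "finite L" "g = trig_poly L d"
    by metis
  have "trig_poly (K \<union> L) (\<lambda>k. (if k \<in> K then c k else 0) + (if k \<in> L then d k else 0)) t
      = trig_poly K c t + trig_poly L d t" for t
  proof -
    have "(\<Sum>k\<in>K \<union> L. (if k \<in> K then c k else 0) * fchar k t) = (\<Sum>k\<in>K. c k * fchar k t)"
      using *(1,3) by (intro sum.mono_neutral_cong_right) auto
    moreover have "(\<Sum>k\<in>K \<union> L. (if k \<in> L then d k else 0) * fchar k t) = (\<Sum>k\<in>L. d k * fchar k t)"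
      using *(1,3) by (intro sum.mono_neutral_cong_right) auto
    ultimately show ?thesis
      by (simp add: trig_poly_def ring_distribs sum.distrib)
  qed
  with * show ?case
    by (intro add.prems[of "K \<union> L" "\<lambda>k. (if k \<in> K then c k else 0) + (if k \<in> L then d k else 0)"]) auto
qed

lemma continuous_on_trig_fun:
  assumes "trig_fun f"
  shows "continuous_on A f"
  using assms by induction (auto intro!: continuous_intros)

text \<open>The closure of the trigonometric polynomials in L^2. It is stable under sums, multiples
  and limits, so density can climb from continuous functions to indicators, simple functions and all
  of L^2.\<close>

definition trig_approx :: "(real \<Rightarrow> complex) \<Rightarrow> bool" where
  "trig_approx f \<longleftrightarrow> f \<in> Lp 2 circle_measure \<and>
     (\<forall>\<epsilon>>0. \<exists>T. trig_fun T \<and> L2_norm circle_measure (\<lambda>t. norm (f t - T t)) < \<epsilon>)"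

lemma Lp_2_trig_fun: "trig_fun T \<Longrightarrow> T \<in> Lp 2 circle_measure"
  by (intro Lp_2_continuous continuous_on_trig_fun)

lemma trig_approx_trig_fun: "trig_fun T \<Longrightarrow> trig_approx T"
  unfolding trig_approx_def by (auto intro!: Lp_2_trig_fun exI[of _ T] simp: L2_norm_def)

lemma trig_approx_add:
  assumes "trig_approx f" "trig_approx g"
  shows "trig_approx (\<lambda>t. f t + g t)"
  unfolding trig_approx_def
proof safe
  show "(\<lambda>t. f t + g t) \<in> Lp 2 circle_measure"
    using assms by (auto simp: trig_approx_def intro: Lp_2_add)
  fix \<epsilon> :: real assume "\<epsilon> > 0"
  then have "\<epsilon> / 2 > 0" by simp
  with assms obtain S T where ST: "trig_fun S" "trig_fun T"
    "L2_norm circle_measure (\<lambda>t. norm (f t - S t)) < \<epsilon> / 2"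
    "L2_norm circle_measure (\<lambda>t. norm (g t - T t)) < \<epsilon> / 2"
    unfolding trig_approx_def by metis
  have "L2_norm circle_measure (\<lambda>t. norm ((f t - S t) + (g t - T t))) < \<epsilon>"
  proof -
    have "(\<lambda>t. f t - S t) \<in> Lp 2 circle_measure" "(\<lambda>t. g t - T t) \<in> Lp 2 circle_measure"
      using ST(1,2) assms by (auto simp: trig_approx_def intro: Lp_2_diff Lp_2_trig_fun)
    from L2_norm_triangle[OF this] ST(3,4) show ?thesis by linarith
  qed
  then show "\<exists>T. trig_fun T \<and> L2_norm circle_measure (\<lambda>t. norm (f t + g t - T t)) < \<epsilon>"
    by (intro exI[of _ "\<lambda>t. S t + T t"]) (auto intro: trig_fun.add ST simp: algebra_simps)
qed

lemma trig_approx_mult_left: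
  assumes "trig_approx f"
  shows "trig_approx (\<lambda>t. c * f t)"
proof (cases "c = 0")
  case False
  show ?thesis unfolding trig_approx_def
  proof safe
    show "(\<lambda>t. c * f t) \<in> Lp 2 circle_measure"
      using assms by (auto simp: trig_approx_def intro: Lp_2_mult_left)
    fix \<epsilon> :: real assume "\<epsilon> > 0"
    with False have "\<epsilon> / norm c > 0" by simp
    with assms obtain T where T: "trig_fun T"
      "L2_norm circle_measure (\<lambda>t. norm (f t - T t)) < \<epsilon> / norm c"
      unfolding trig_approx_def by metis
    have "L2_norm circle_measure (\<lambda>t. norm (c * (f t - T t))) < \<epsilon>"
      using T(2) False unfolding L2_norm_mult_left by (simp add: field_simps)
    then show "\<exists>T. trig_fun T \<and> L2_norm circle_measure (\<lambda>t. norm (c * f t - T t)) < \<epsilon>"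
      by (intro exI[of _ "\<lambda>t. c * T t"])
        (auto intro: trig_fun_mult trig_fun_const T simp: algebra_simps)
  qed
qed (use trig_approx_trig_fun[OF trig_fun_const[of 0]] in simp)

lemma trig_approx_sum:
  assumes "finite I" "\<And>i. i \<in> I \<Longrightarrow> trig_approx (f i)"
  shows "trig_approx (\<lambda>t. \<Sum>i\<in>I. f i t)"
  using assms
proof (induction I rule: finite_induct)
  case empty
  then show ?case using trig_approx_trig_fun[OF trig_fun_const[of 0]] by simp
next
  case (insert i I)
  then show ?case using trig_approx_add[of "f i" "\<lambda>t. \<Sum>i\<in>I. f i t"] by simp
qed

lemma trig_approx_limit:
  assumes "f \<in> Lp 2 circle_measure" "\<And>n. trig_approx (g n)"
    and "(\<lambda>n. L2_norm circle_measure (\<lambda>t. norm (f t - g n t))) \<longlonglongrightarrow> 0"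
  shows "trig_approx f"
  unfolding trig_approx_def
proof safe
  fix \<epsilon> :: real assume "\<epsilon> > 0"
  then have "\<epsilon> / 2 > 0" by simp
  from order_tendstoD(2)[OF assms(3) this] obtain n
    where n: "L2_norm circle_measure (\<lambda>t. norm (f t - g n t)) < \<epsilon> / 2"
    by (auto simp: eventually_sequentially)
  from assms(2)[of n] \<open>\<epsilon> / 2 > 0\<close> obtain T where T: "trig_fun T"
      "L2_norm circle_measure (\<lambda>t. norm (g n t - T t)) < \<epsilon> / 2"
    unfolding trig_approx_def by metis
  have "L2_norm circle_measure (\<lambda>t. norm (f t - T t)) < \<epsilon>"
    using L2_norm_triangle_diff[OF assms(1) _ Lp_2_trig_fun[OF T(1)], of "g n"] n T(2) assms(2)[of n]
    by (auto simp: trig_approx_def)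
  with T(1) show "\<exists>T. trig_fun T \<and> L2_norm circle_measure (\<lambda>t. norm (f t - T t)) < \<epsilon>" by blast
qed (fact assms(1))

section \<open>Density of trigonometric polynomials\<close>

text \<open>Uniform approximation on the unit circle implies L^2 approximation because the total
  mass is finite. The Stone-Weierstrass theorem applied is the real one, so the algebra consists of
  real functions on the plane, with Re and Im separating points.\<close>

lemma trig_approx_continuous_cis:
  fixes \<phi> :: "complex \<Rightarrow> real"
  assumes "continuous_on UNIV \<phi>"
  shows "trig_approx (\<lambda>t. complex_of_real (\<phi> (cis t)))"
  unfolding trig_approx_def
proof safe
  have cont: "continuous_on UNIV (\<lambda>t. complex_of_real (\<phi> (cis t)))"
    by (intro continuous_intros continuous_on_compose2[OF assms]) auto
  then show L2: "(\<lambda>t. complex_of_real (\<phi> (cis t))) \<in> Lp 2 circle_measure"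
    by (rule Lp_2_continuous)
  fix \<epsilon> :: real assume "\<epsilon> > 0"
  define P where "P = (\<lambda>f :: complex \<Rightarrow> real. continuous_on UNIV f \<and> trig_fun (\<lambda>t. complex_of_real (f (cis t))))"
  have cos: "trig_fun (\<lambda>t. complex_of_real (Re (cis t)))"
  proof -
    have "(\<lambda>t. complex_of_real (Re (cis t))) = (\<lambda>t. (1/2) * fchar 1 t + (1/2) * fchar (-1) t)"
      by (auto simp: fun_eq_iff complex_eq_iff)
    then show ?thesis using trig_fun.add trig_fun.mono by metis
  qed
  have sin: "trig_fun (\<lambda>t. complex_of_real (Im (cis t)))"
  proof -
    have "(\<lambda>t. complex_of_real (Im (cis t))) = (\<lambda>t. (-\<i>/2) * fchar 1 t + (\<i>/2) * fchar (-1) t)"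
      by (auto simp: fun_eq_iff complex_eq_iff)
    then show ?thesis using trig_fun.add trig_fun.mono by metis
  qed
  \<comment> \<open>A uniform error e costs \<open>e * sqrt (2 * pi)\<close> in L^2, here half of
    \<epsilon>.\<close>
  define e where "e = \<epsilon> / (2 * sqrt (2 * pi))"
  have "e > 0" using \<open>\<epsilon> > 0\<close> by (simp add: e_def)
  have "\<exists>g. P g \<and> (\<forall>z\<in>sphere 0 1. \<bar>\<phi> z - g z\<bar> < e)"
  proof (rule Stone_Weierstrass_HOL)
    show "continuous_on (sphere 0 1) \<phi>" using assms by (rule continuous_on_subset) simp
    show "P (\<lambda>z. f z + g z)" "P (\<lambda>z. f z * g z)" if "P f \<and> P g" for f g
      using that trig_fun.add[of "\<lambda>t. complex_of_real (f (cis t))" "\<lambda>t. complex_of_real (g (cis t))"]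
        trig_fun_mult[of "\<lambda>t. complex_of_real (f (cis t))" "\<lambda>t. complex_of_real (g (cis t))"]
      by (auto simp: P_def intro!: continuous_intros)
    show "\<exists>f. P f \<and> f x \<noteq> f y" if "x \<in> sphere 0 1 \<and> y \<in> sphere 0 1 \<and> x \<noteq> y" for x y
    proof -
      have "P Re" "P Im" using cos sin by (auto simp: P_def intro: continuous_intros)
      with that show ?thesis by (metis complex_eqI)
    qed
  qed (use \<open>e > 0\<close> in \<open>auto simp: P_def trig_fun_const intro: continuous_on_subset\<close>)
  then obtain g where g: "P g" "\<And>z. norm z = 1 \<Longrightarrow> \<bar>\<phi> z - g z\<bar> < e"
    by (auto simp: dist_norm)
  have "L2_norm circle_measure (\<lambda>t. norm (complex_of_real (\<phi> (cis t)) - complex_of_real (g (cis t))))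
      \<le> e * sqrt (measure circle_measure (space circle_measure))"
    using g(2) \<open>e > 0\<close>
    by (intro circle.L2_norm_le_bound) (auto simp flip: of_real_diff intro!: less_imp_le)
  also have "\<dots> < \<epsilon>"
    using \<open>\<epsilon> > 0\<close> by (simp add: e_def)
  finally show "\<exists>T. trig_fun T \<and> L2_norm circle_measure (\<lambda>t. norm (complex_of_real (\<phi> (cis t)) - T t)) < \<epsilon>"
    using g(1) by (auto simp: P_def)
qed

lemma borel_measurable_cis_circle [measurable]: "cis \<in> circle_measure \<rightarrow>\<^sub>M borel"
  by (intro borel_measurable_circle borel_measurable_continuous_onI continuous_intros)

lemma Lp_2_indicator_cis:
  assumes [measurable]: "A \<in> sets borel"
  shows "(\<lambda>t. indicator A (cis t) :: complex) \<in> Lp 2 circle_measure"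
  by (rule circle.Lp_2_bounded[of _ 1]) (auto simp: indicator_def)

text \<open>Dynkin induction over Borel sets: closed sets form an intersection-stable generator, and
  approximability passes to complements and countable disjoint unions.\<close>

lemma trig_approx_indicator_cis:
  assumes "A \<in> sets (borel :: complex measure)"
  shows "trig_approx (\<lambda>t. indicator A (cis t))"
proof -
  have borel: "sets (borel :: complex measure) = sigma_sets UNIV (Collect closed)"
    unfolding borel_eq_closed by simp
  have "Int_stable (Collect closed :: complex set set)" by (auto simp: Int_stable_def)
  moreover have "(Collect closed :: complex set set) \<subseteq> Pow UNIV" by simp
  moreover have "A \<in> sigma_sets UNIV (Collect closed)" using assms borel by simp
  ultimately show ?thesis
  proof (induction rule: sigma_sets_induct_disjoint)
    case (basic A)
    then have "closed A" by simp
    then have [measurable]: "A \<in> sets borel" by simp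
    show ?case
    proof (cases "A = {}")
      case False
      \<comment> \<open>Continuous tents around A; they tend to the indicator pointwise because a
        point outside the closed set A has positive distance to it.\<close>
      define g where "g = (\<lambda>(n::nat) z. max 0 (1 - real n * infdist z A))"
      show ?thesis
      proof (rule trig_approx_limit[of _ "\<lambda>n t. complex_of_real (g n (cis t))"])
        show "(\<lambda>t. indicator A (cis t) :: complex) \<in> Lp 2 circle_measure"
          by (rule Lp_2_indicator_cis) measurable
        have cont: "continuous_on UNIV (g n)" for n
          unfolding g_def by (intro continuous_intros)
        then show "trig_approx (\<lambda>t. complex_of_real (g n (cis t)))" for n
          by (rule trig_approx_continuous_cis)
        have [measurable]: "g n \<in> borel_measurable borel" for n
          by (intro borel_measurable_continuous_onI cont)
        show "(\<lambda>n. L2_norm circle_measure (\<lambda>t. norm (indicator A (cis t) - complex_of_real (g n (cis t))))) \<longlonglongrightarrow> 0"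
        proof (rule L2_norm_tendsto_0_dominated)
          show "(\<lambda>t. 1 :: complex) \<in> Lp 2 circle_measure" by (intro Lp_2_continuous continuous_intros)
          show "norm (indicator A (cis t) - complex_of_real (g n (cis t))) \<le> norm (1 :: complex)" for n t
          proof (cases "cis t \<in> A")
            case True
            then show ?thesis by (simp add: g_def)
          next
            case False
            have "0 \<le> g n (cis t)" "g n (cis t) \<le> 1" by (auto simp: g_def infdist_nonneg)
            with False show ?thesis by simp
          qed
          show "(\<lambda>n. indicator A (cis t) - complex_of_real (g n (cis t))) \<longlonglongrightarrow> 0" for t
          proof (cases "cis t \<in> A")
            case True
            then show ?thesis by (simp add: g_def)
          next
            case False
            then have d: "infdist (cis t) A > 0"
              using \<open>closed A\<close> \<open>A \<noteq> {}\<close> by (metis in_closed_iff_infdist_zero infdist_nonneg order_le_less)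
            then obtain N :: nat where "1 < real N * infdist (cis t) A"
              using reals_Archimedean3 by blast
            then have "1 \<le> real n * infdist (cis t) A" if "N \<le> n" for n
            proof -
              have "real N * infdist (cis t) A \<le> real n * infdist (cis t) A"
                using that d by (intro mult_right_mono) auto
              with \<open>1 < real N * infdist (cis t) A\<close> show ?thesis by linarith
            qed
            then have "\<forall>\<^sub>F n in sequentially. indicator A (cis t) - complex_of_real (g n (cis t)) = 0"
              using False by (intro eventually_sequentiallyI[of N]) (simp add: g_def)
            then show ?thesis by (rule tendsto_eventually)
          qed
        qed measurable
      qed
    qed (use trig_approx_trig_fun[OF trig_fun_const[of 0]] in simp)
  next
    case empty
    then show ?case using trig_approx_trig_fun[OF trig_fun_const[of 0]] by simp
  next
    case (compl A)
    have "indicator (UNIV - A) z = 1 + (-1) * (indicator A z :: complex)" for z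
      by (simp add: indicator_def)
    then show ?case
      using trig_approx_add[OF trig_approx_trig_fun[OF trig_fun_const[of 1]] trig_approx_mult_left[OF compl.IH, of "-1"]]
      by simp
  next
    case (union A)
    have [measurable]: "A i \<in> sets borel" for i using union.hyps(2) borel by auto
    have [measurable]: "(\<Union>i. A i) \<in> sets borel" "(\<Union>i<n. A i) \<in> sets borel" for n :: nat
      by (auto intro!: sets.countable_UN sets.finite_UN)
    show ?case
    proof (rule trig_approx_limit[of _ "\<lambda>n t. \<Sum>i<n. indicator (A i) (cis t)"])
      show "(\<lambda>t. indicator (\<Union>i. A i) (cis t) :: complex) \<in> Lp 2 circle_measure"
        by (rule Lp_2_indicator_cis) measurable
      show "trig_approx (\<lambda>t. \<Sum>i<n. indicator (A i) (cis t))" for n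
        by (intro trig_approx_sum union.IH) auto
      \<comment> \<open>Disjointness turns the partial sums into indicators, so the constant 1
        dominates the differences.\<close>
      have sum: "(\<Sum>i<n. indicator (A i) z) = (indicator (\<Union>i<n. A i) z :: complex)" for n z
        using union.hyps(1) by (subst indicator_UN_disjoint) (auto intro: disjoint_family_on_mono)
      show "(\<lambda>n. L2_norm circle_measure (\<lambda>t. norm (indicator (\<Union>i. A i) (cis t) - (\<Sum>i<n. indicator (A i) (cis t)) :: complex))) \<longlonglongrightarrow> 0"
        unfolding sum
      proof (rule L2_norm_tendsto_0_dominated)
        show "(\<lambda>t. 1 :: complex) \<in> Lp 2 circle_measure" by (intro Lp_2_continuous continuous_intros)
        show "norm (indicator (\<Union>i. A i) (cis t) - indicator (\<Union>i<n. A i) (cis t) :: complex) \<le> norm (1 :: complex)" for n t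
          by (auto simp: indicator_def)
        show "(\<lambda>n. indicator (\<Union>i. A i) (cis t) - indicator (\<Union>i<n. A i) (cis t) :: complex) \<longlonglongrightarrow> 0" for t
          using tendsto_diff[OF tendsto_const LIMSEQ_indicator_UN,
              of "indicator (\<Union>i. A i) (cis t) :: complex" A "cis t"] by simp
      qed measurable
    qed
  qed
qed

section \<open>From the unit circle back to the fundamental domain\<close>

lemma Arg2pi_cis_eq:
  assumes "t \<in> {0..<2 * pi}"
  shows "Arg2pi (cis t) = t"
  using assms by (intro Arg2pi_unique[of 1]) (auto simp: cis_conv_exp)

text \<open>\<open>Arg2pi\<close> jumps across the nonnegative reals, but that set is closed, and
  \<open>Arg2pi\<close> vanishes on it and is continuous elsewhere.\<close>

lemma borel_measurable_Arg2pi [measurable]: "Arg2pi \<in> borel_measurable borel"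
proof -
  have "(\<lambda>z. if z \<in> \<real>\<^sub>\<ge>\<^sub>0 then 0 else Arg2pi z) \<in> borel_measurable borel"
    by (intro borel_measurable_continuous_on_if borel_closed closed_nonneg_Reals_complex
        continuous_intros continuous_at_imp_continuous_on ballI continuous_at_Arg2pi) auto
  also have "(\<lambda>z. if z \<in> \<real>\<^sub>\<ge>\<^sub>0 then 0 else Arg2pi z) = Arg2pi"
    by (auto simp: fun_eq_iff Arg2pi_eq_0 nonneg_Reals_def complex_nonneg_Reals_iff complex_is_Real_iff)
  finally show ?thesis .
qed

text \<open>A Borel set of angles is the trace of a Borel set in the plane, because
  \<open>Arg2pi\<close> inverts \<open>cis\<close> on the fundamental domain.\<close>

lemma trig_approx_indicator:
  assumes "B \<in> sets circle_measure"
  shows "trig_approx (indicator B)"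
proof -
  have B: "B \<in> sets borel" "B \<subseteq> {0..<2 * pi}"
    using assms by (auto simp: sets_circle_measure sets_restrict_space)
  then have "trig_approx (\<lambda>t. indicator (Arg2pi -` B) (cis t))"
    using measurable_sets[OF borel_measurable_Arg2pi B(1)]
    by (intro trig_approx_indicator_cis) (simp add: space_borel)
  moreover have "L2_norm circle_measure (\<lambda>t. norm (indicator B t - T t))
     = L2_norm circle_measure (\<lambda>t. norm (indicator (Arg2pi -` B) (cis t) - T t :: complex))" for T
    unfolding L2_norm_def
    by (intro arg_cong[of _ _ sqrt] Bochner_Integration.integral_cong refl)
       (simp add: Arg2pi_cis_eq indicator_def)
  moreover have "(indicator B :: real \<Rightarrow> complex) \<in> Lp 2 circle_measure"
    using assms by (intro circle.Lp_2_bounded[of _ 1]) (auto simp: indicator_def)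
  ultimately show ?thesis
    by (auto simp: trig_approx_def)
qed

lemma trig_approx_Lp_2:
  assumes "f \<in> Lp 2 circle_measure"
  shows "trig_approx f"
proof -
  have f[measurable]: "f \<in> borel_measurable circle_measure" using assms by (simp add: Lp_2_iff)
  obtain s
    where s: "\<And>i. simple_function circle_measure (s i)"
      "\<And>x. x \<in> space circle_measure \<Longrightarrow> (\<lambda>i. s i x) \<longlonglongrightarrow> f x"
      "\<And>i x. x \<in> space circle_measure \<Longrightarrow> norm (s i x) \<le> 2 * norm (f x)"
    using borel_measurable_implies_sequence_metric[OF f, of 0] unfolding dist_norm diff_zero by blast
  have [measurable]: "s i \<in> borel_measurable circle_measure" for i
    using s(1) by (rule borel_measurable_simple_function)
  define S where "S = space circle_measure"
  \<comment> \<open>The simple function as an explicit combination of indicators; agreement is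
    claimed on the space only, which is all that the norms see.\<close>
  define g where "g i t = (\<Sum>y\<in>s i ` S. y * indicator (s i -` {y} \<inter> S) t)" for i t
  have g_eq: "g i t = s i t" if "t \<in> S" for i t
  proof -
    have "g i t = (\<Sum>y\<in>s i ` S. if y = s i t then y else 0)"
      unfolding g_def using that by (intro sum.cong) (auto simp: indicator_def)
    also have "\<dots> = s i t"
      using that simple_functionD(1)[OF s(1)[of i]] by (simp add: S_def)
    finally show ?thesis .
  qed
  show ?thesis
  proof (rule trig_approx_limit[of _ g])
    show "trig_approx (g i)" for i
      unfolding g_def using simple_functionD[OF s(1)[of i]]
      by (intro trig_approx_sum trig_approx_mult_left trig_approx_indicator) (auto simp: S_def)
    have "(\<lambda>n. L2_norm circle_measure (\<lambda>t. norm (f t - s n t))) \<longlonglongrightarrow> 0"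
    proof (rule L2_norm_tendsto_0_dominated)
      \<comment> \<open>The factor 3 is 1 + 2, the 2 being the bound on the approximating simple
        functions.\<close>
      show "(\<lambda>t. 3 * f t) \<in> Lp 2 circle_measure" by (rule Lp_2_mult_left[OF assms])
      show "norm (f t - s n t) \<le> norm (3 * f t)" if "t \<in> space circle_measure" for n t
        using norm_triangle_ineq4[of "f t" "s n t"] s(3)[OF that, of n] by (simp add: norm_mult)
      show "(\<lambda>n. f t - s n t) \<longlonglongrightarrow> 0" if "t \<in> space circle_measure" for t
        using tendsto_diff[OF tendsto_const s(2)[OF that], of "f t"] by simp
    qed measurable
    also have "(\<lambda>n. L2_norm circle_measure (\<lambda>t. norm (f t - s n t)))
        = (\<lambda>n. L2_norm circle_measure (\<lambda>t. norm (f t - g n t)))"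
      unfolding L2_norm_def using g_eq
      by (intro ext arg_cong[of _ _ sqrt] Bochner_Integration.integral_cong refl) (simp add: S_def)
    finally show "(\<lambda>n. L2_norm circle_measure (\<lambda>t. norm (f t - g n t))) \<longlonglongrightarrow> 0" .
  qed (fact assms)
qed

lemma trig_poly_dense:
  assumes "f \<in> Lp 2 circle_measure" "\<epsilon> > 0"
  obtains K c where "finite K" "L2_norm circle_measure (\<lambda>t. norm (f t - trig_poly K c t)) < \<epsilon>"
  using trig_approx_Lp_2[OF assms(1)] assms(2) trig_fun_imp_trig_poly unfolding trig_approx_def by metis

section \<open>Wirtinger's inequality and resolvents on the circle\<close>

text \<open>L^2 duality restricted to trigonometric polynomials: testing f against a polynomial
  close to its conjugate gives N^2 \<le> B N up to an arbitrarily small error.\<close>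

lemma L2_norm_circle_dual_bound:
  assumes "f \<in> Lp 2 circle_measure" "0 \<le> B"
    and "\<And>K c. finite K \<Longrightarrow> norm (LINT t|circle_measure. f t * trig_poly K c t)
        \<le> B * L2_norm circle_measure (\<lambda>t. norm (trig_poly K c t))"
  shows "L2_norm circle_measure (\<lambda>t. norm (f t)) \<le> B"
proof -
  define N where "N = L2_norm circle_measure (\<lambda>t. norm (f t))"
  have "0 \<le> N" by (simp add: N_def)
  have cnj: "(\<lambda>t. cnj (f t)) \<in> Lp 2 circle_measure"
    using assms(1) unfolding Lp_2_iff
    by (auto intro: borel_measurable_continuous_on[OF continuous_on_cnj[OF continuous_on_id]])
  have "N\<^sup>2 \<le> B * N + e" if "e > 0" for e
  proof -
    define \<epsilon> where "\<epsilon> = e / (N + B + 1)"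
    have "\<epsilon> > 0" using that \<open>0 \<le> N\<close> \<open>0 \<le> B\<close> by (simp add: \<epsilon>_def)
    from trig_poly_dense[OF cnj this] obtain K c where Kc: "finite K"
      and less: "L2_norm circle_measure (\<lambda>t. norm (cnj (f t) - trig_poly K c t)) < \<epsilon>" by blast
    define T where "T = trig_poly K c"
    have T: "T \<in> Lp 2 circle_measure" by (simp add: T_def Lp_2_trig_poly)
    have d: "(\<lambda>t. cnj (f t) - T t) \<in> Lp 2 circle_measure"
      using cnj T by (rule Lp_2_diff)
    have "complex_of_real (N\<^sup>2) = (LINT t|circle_measure. complex_of_real ((norm (f t))\<^sup>2))"
      using assms(1) unfolding N_def L2_norm_power2
      by (intro integral_of_real[symmetric]) (simp add: Lp_2_iff)
    also have "\<dots> = (LINT t|circle_measure. f t * (cnj (f t) - T t) + f t * T t)"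
      unfolding complex_norm_square by (simp add: algebra_simps)
    also have "\<dots> = (LINT t|circle_measure. f t * (cnj (f t) - T t)) + (LINT t|circle_measure. f t * T t)"
      by (intro Bochner_Integration.integral_add integrable_mult_Lp_2 assms(1) d T)
    finally have "norm (complex_of_real (N\<^sup>2)) \<le> norm (LINT t|circle_measure. f t * (cnj (f t) - T t))
        + norm (LINT t|circle_measure. f t * T t)"
      by (metis norm_triangle_ineq)
    also have "norm (LINT t|circle_measure. f t * (cnj (f t) - T t)) \<le> N * \<epsilon>"
      using norm_LINT_mult_le_L2_norm[OF assms(1) d] less \<open>0 \<le> N\<close> unfolding N_def T_def
      by (meson less_imp_le mult_left_mono order_trans)
    also have "norm (LINT t|circle_measure. f t * T t) \<le> B * (N + \<epsilon>)"
    proof -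
      have "L2_norm circle_measure (\<lambda>t. norm (T t - 0))
          \<le> L2_norm circle_measure (\<lambda>t. norm (T t - cnj (f t))) + L2_norm circle_measure (\<lambda>t. norm (cnj (f t) - 0))"
        by (intro L2_norm_triangle_diff T cnj) (simp add: Lp_2_iff)
      also have "\<dots> \<le> \<epsilon> + N"
        using less by (simp add: N_def T_def L2_norm_minus_commute[of _ "trig_poly K c"])
      finally have "L2_norm circle_measure (\<lambda>t. norm (T t)) \<le> N + \<epsilon>" by simp
      with assms(3)[OF Kc, of c] \<open>0 \<le> B\<close> show ?thesis
        unfolding T_def by (meson mult_left_mono order_trans)
    qed
    finally have "N\<^sup>2 \<le> B * N + (N + B) * \<epsilon>" by (simp add: algebra_simps norm_power)
    also have "(N + B) * \<epsilon> \<le> e"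
      using that \<open>0 \<le> N\<close> \<open>0 \<le> B\<close> by (simp add: \<epsilon>_def field_simps)
    finally show ?thesis by simp
  qed
  then have "N\<^sup>2 \<le> B * N" by (rule field_le_epsilon)
  then show ?thesis
    using \<open>0 \<le> N\<close> \<open>0 \<le> B\<close> unfolding N_def[symmetric]
    by (cases "N = 0") (auto simp: power2_eq_square)
qed

text \<open>Completeness of the characters; it later yields uniqueness of weak derivatives.\<close>

lemma L2_norm_circle_eq_0:
  assumes "f \<in> Lp 2 circle_measure" "\<And>k. (LINT t|circle_measure. f t * fchar k t) = 0"
  shows "L2_norm circle_measure (\<lambda>t. norm (f t)) = 0"
proof -
  have "L2_norm circle_measure (\<lambda>t. norm (f t)) \<le> 0"
    by (rule L2_norm_circle_dual_bound[OF assms(1)]) (simp_all add: LINT_mult_trig_poly[OF assms(1)] assms(2))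
  then show ?thesis by (simp add: order_antisym)
qed

text \<open>By duality it suffices to pair f with a polynomial; dividing its coefficients by i k
  moves the pairing to d, and |k| \<ge> 1 keeps the norm from growing. The derivative enters through
  Fourier coefficients only, so complex differences with trigonometric polynomials are
  covered.\<close>

lemma Wirtinger:
  assumes "f \<in> Lp 2 circle_measure" "d \<in> Lp 2 circle_measure"
    and "(LINT t|circle_measure. f t) = 0"
    and "\<And>k. \<i> * of_int k * (LINT t|circle_measure. f t * fchar k t) = - (LINT t|circle_measure. d t * fchar k t)"
  shows "L2_norm circle_measure (\<lambda>t. norm (f t)) \<le> L2_norm circle_measure (\<lambda>t. norm (d t))"
proof (rule L2_norm_circle_dual_bound[OF assms(1)])
  fix K :: "int set" and c assume K: "finite K"
  define b where "b k = - c k / (\<i> * of_int k)" for k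
  have fk: "(LINT t|circle_measure. f t * fchar k t) = - (LINT t|circle_measure. d t * fchar k t) / (\<i> * of_int k)"
    if "k \<noteq> 0" for k
    using assms(4)[of k] that by (simp add: field_simps)
  have "(LINT t|circle_measure. f t * trig_poly K c t)
      = (\<Sum>k\<in>K - {0}. c k * (LINT t|circle_measure. f t * fchar k t))"
    unfolding LINT_mult_trig_poly[OF assms(1)]
    using K assms(3) by (intro sum.mono_neutral_right) auto
  also have "\<dots> = (\<Sum>k\<in>K - {0}. b k * (LINT t|circle_measure. d t * fchar k t))"
    by (intro sum.cong) (auto simp: fk b_def)
  also have "\<dots> = (LINT t|circle_measure. d t * trig_poly (K - {0}) b t)"
    by (simp add: LINT_mult_trig_poly[OF assms(2)])
  finally have "norm (LINT t|circle_measure. f t * trig_poly K c t)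
      \<le> L2_norm circle_measure (\<lambda>t. norm (d t)) * L2_norm circle_measure (\<lambda>t. norm (trig_poly (K - {0}) b t))"
    using norm_LINT_mult_le_L2_norm[OF assms(2) Lp_2_trig_poly] by simp
  also have "L2_norm circle_measure (\<lambda>t. norm (trig_poly (K - {0}) b t))
      \<le> L2_norm circle_measure (\<lambda>t. norm (trig_poly K c t))"
  proof (rule power2_le_imp_le)
    have "(\<Sum>k\<in>K - {0}. (norm (b k))\<^sup>2) \<le> (\<Sum>k\<in>K - {0}. (norm (c k))\<^sup>2)"
    proof (intro sum_mono power_mono)
      fix k assume "k \<in> K - {0}"
      then have "1 \<le> \<bar>k\<bar>" by auto
      then have "1 \<le> \<bar>real_of_int k\<bar>" by linarith
      then show "norm (b k) \<le> norm (c k)"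
        by (simp add: b_def norm_divide norm_mult divide_le_eq mult_right_le_one_le mult_le_cancel_left1)
    qed simp
    also have "\<dots> \<le> (\<Sum>k\<in>K. (norm (c k))\<^sup>2)"
      using K by (intro sum_mono2) auto
    finally show "(L2_norm circle_measure (\<lambda>t. norm (trig_poly (K - {0}) b t)))\<^sup>2
        \<le> (L2_norm circle_measure (\<lambda>t. norm (trig_poly K c t)))\<^sup>2"
      using K by (simp add: L2_norm_trig_poly)
  qed simp
  finally show "norm (LINT t|circle_measure. f t * trig_poly K c t)
      \<le> L2_norm circle_measure (\<lambda>t. norm (d t)) * L2_norm circle_measure (\<lambda>t. norm (trig_poly K c t))"
    by (simp add: mult_left_mono)
qed simp

section \<open>Translations and first order resolvents\<close>

lemma LINT_circle_shift:
  fixes f :: "real \<Rightarrow> real"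
  assumes "continuous_on UNIV f" "periodic_2pi f" "t \<in> {0..2 * pi}"
  shows "(LINT s|circle_measure. f (t + s)) = (LINT s|circle_measure. f s)"
proof -
  have cont: "continuous_on A f" "continuous_on A (\<lambda>s. f (t + s))" for A t
    by (auto intro!: continuous_intros continuous_on_compose2[OF assms(1)])
  have int: "f integrable_on {a..b}" for a b
    by (intro integrable_continuous_interval cont)
  have LINT: "(LINT s|circle_measure. g s) = integral {0..2 * pi} g" if "continuous_on UNIV g"
    for g :: "real \<Rightarrow> real"
  proof -
    have "set_integrable lborel {0..2 * pi} g"
      by (intro borel_integrable_atLeastAtMost' continuous_on_subset[OF that]) simp
    from set_borel_integral_eq_integral(2)[OF this] show ?thesis
      by (simp add: LINT_circle borel_measurable_continuous_onI that set_lebesgue_integral_def)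
  qed
  have shift: "integral {a - t..b - t} (\<lambda>s. f (s + t)) = integral {a..b} f" for a b t
    using has_integral_affinity'[of f _ a b 1 t, unfolded cbox_interval, OF integrable_integral[OF int]]
    by (simp add: integral_unique)
  have "integral {0..2 * pi} (\<lambda>s. f (t + s)) = integral {t..t + 2 * pi} f"
    using shift[of t t "t + 2 * pi"] by (simp add: add.commute)
  also have "\<dots> = integral {t..2 * pi} f + integral {2 * pi..t + 2 * pi} f"
    using assms(3) int by (intro Henstock_Kurzweil_Integration.integral_combine[symmetric]) auto
  \<comment> \<open>The piece beyond one period is carried back to [0, t] by periodicity.\<close>
  also have "integral {2 * pi..t + 2 * pi} f = integral {0..t} f"
    using shift[of "2 * pi" "2 * pi" "t + 2 * pi"] assms(2) by (simp add: periodic_2pi_def)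
  also have "integral {t..2 * pi} f + integral {0..t} f = integral {0..2 * pi} f"
    using assms(3) int Henstock_Kurzweil_Integration.integral_combine[of 0 t "2 * pi" f] by auto
  finally show ?thesis
    using cont by (simp add: LINT)
qed

lemma fchar_mod: "fchar k (t + 2 * pi * of_int n) = fchar k t"
proof -
  have "fchar k (t + 2 * pi * of_int n) = fchar k t * cis (2 * pi * of_int (k * n))"
    by (simp add: cis_mult algebra_simps)
  then show ?thesis by (simp add: cis_multiple_2pi)
qed

lemma periodic_trig_poly: "periodic_2pi (\<lambda>t. g (trig_poly K c t))"
  unfolding periodic_2pi_def trig_poly_def using fchar_mod[of _ _ 1] by simp

lemma trig_poly_fundamental_domain:
  obtains r where "r \<in> {0..2 * pi}" "\<And>K c. trig_poly K c t = trig_poly K c r"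
proof -
  define n where "n = \<lfloor>t / (2 * pi)\<rfloor>"
  have "of_int n \<le> t / (2 * pi)" "t / (2 * pi) < of_int n + 1"
    unfolding n_def by linarith+
  then have "t - 2 * pi * of_int n \<in> {0..2 * pi}"
    by (auto simp: field_simps)
  moreover have "trig_poly K c t = trig_poly K c (t - 2 * pi * of_int n)" for K c
    using fchar_mod[of _ t "- n"] by (simp add: trig_poly_def)
  ultimately show thesis using that by blast
qed

text \<open>Periodization of the exponential kernel: for a > 0 it is the sum over n \<ge> 0 of a
  exp(-a (y + 2 pi n)). For a < 0 numerator and denominator are both negative, so the formula is a
  positive kernel for either sign, as the factorization of the second order resolvent
  requires.\<close>

definition circle_kernel :: "real \<Rightarrow> real \<Rightarrow> real" where
  "circle_kernel a y = a * exp (- (a * y)) / (1 - exp (- (2 * pi * a)))"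

lemma continuous_on_circle_kernel: "continuous_on A (circle_kernel a)"
  unfolding circle_kernel_def[abs_def] divide_inverse by (intro continuous_intros)

lemma circle_kernel_nonneg: "0 \<le> circle_kernel a y"
  by (cases "a \<ge> 0") (auto simp: circle_kernel_def zero_le_divide_iff mult_le_0_iff zero_le_mult_iff)

text \<open>The multiplier of the inverse of 1 - a^(-1) d/dt. The denominator of the kernel is
  chosen so that k = 0 gives total mass one.\<close>

lemma LINT_circle_kernel_fchar:
  fixes a :: real
  assumes "a \<noteq> 0"
  shows "(LINT y|circle_measure. complex_of_real (circle_kernel a y) * fchar k y)
    = a / (a - \<i> * of_int k)"
proof -
  define z where "z = \<i> * of_int k - complex_of_real a"
  define D where "D = 1 - exp (- (2 * pi * a))"
  have "z \<noteq> 0" using assms by (simp add: z_def complex_eq_iff)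
  have "D \<noteq> 0" using assms by (simp add: D_def)
  have kernel: "complex_of_real (circle_kernel a y) * fchar k y = complex_of_real a / complex_of_real D * exp (z * complex_of_real y)" for y
  proof -
    have "exp (z * y) = exp (complex_of_real (- (a * y))) * exp (\<i> * (of_int k * y))"
      by (simp add: z_def algebra_simps flip: exp_add)
    also have "\<dots> = complex_of_real (exp (- (a * y))) * fchar k y"
      by (simp only: exp_of_real cis_conv_exp)
    finally show ?thesis by (simp add: circle_kernel_def D_def)
  qed
  define G where "G y = complex_of_real a / complex_of_real D * exp (z * complex_of_real y) / z" for y
  have G: "(G has_vector_derivative complex_of_real a / complex_of_real D * exp (z * complex_of_real x)) (at x within S)" for x S
  proof -
    have "((\<lambda>w. complex_of_real a / complex_of_real D * exp (z * w) / z) has_field_derivative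
        complex_of_real a / complex_of_real D * exp (z * complex_of_real x)) (at (complex_of_real x))"
      using \<open>z \<noteq> 0\<close> \<open>D \<noteq> 0\<close> by (auto intro!: derivative_eq_intros)
    then show ?thesis
      unfolding G_def by (rule has_vector_derivative_at_within[OF has_vector_derivative_real_field])
  qed
  have "(LINT y|lborel. indicator {0..2 * pi} y *\<^sub>R (complex_of_real a / complex_of_real D * exp (z * complex_of_real y)))
      = G (2 * pi) - G 0"
    by (intro integral_FTC_atLeastAtMost G continuous_intros) simp
  also have "\<dots> = complex_of_real a / complex_of_real D * (exp (z * complex_of_real (2 * pi)) - 1) / z"
    by (simp add: G_def diff_divide_distrib right_diff_distrib)
  \<comment> \<open>The oscillating factor has period 2 pi, so only the exponential change over one
    period is left, and it cancels D.\<close>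
  also have "exp (z * complex_of_real (2 * pi)) = 1 - complex_of_real D"
  proof -
    have "z * complex_of_real (2 * pi) = complex_of_real (- (2 * pi * a)) + \<i> * complex_of_real (2 * pi * of_int k)"
      by (simp add: z_def algebra_simps)
    then have "exp (z * complex_of_real (2 * pi)) = complex_of_real (exp (- (2 * pi * a))) * cis (2 * pi * of_int k)"
      by (simp only: exp_add cis_conv_exp exp_of_real)
    also have "\<dots> = 1 - complex_of_real D"
      using cis_multiple_2pi[of "of_int k"] by (simp add: D_def)
    finally show ?thesis .
  qed
  also have "complex_of_real a / complex_of_real D * (1 - complex_of_real D - 1) / z = a / (a - \<i> * of_int k)"
    using \<open>D \<noteq> 0\<close> \<open>z \<noteq> 0\<close> by (simp add: z_def divide_simps) (simp add: algebra_simps)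
  finally show ?thesis
    unfolding kernel by (subst LINT_circle) (auto intro!: borel_measurable_continuous_onI continuous_intros)
qed

lemma LINT_circle_kernel:
  assumes "a \<noteq> 0"
  shows "(LINT y|circle_measure. circle_kernel a y) = 1"
proof -
  have "complex_of_real (LINT y|circle_measure. circle_kernel a y)
      = (LINT y|circle_measure. complex_of_real (circle_kernel a y))"
    by (intro integral_of_real[symmetric] integrable_circle_continuous continuous_on_circle_kernel)
  also have "\<dots> = 1" using LINT_circle_kernel_fchar[OF assms, of 0] assms by simp
  finally show ?thesis by (simp only: of_real_eq_1_iff)
qed

text \<open>The operator \<open>(1 - a\<^sup>-\<^sup>1 \<partial>)\<^sup>-\<^sup>1\<close> is an average of translations.\<close>

lemma trig_poly_resolvent:
  fixes a :: real
  assumes "a \<noteq> 0"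
  shows "trig_poly K (\<lambda>k. a / (a - \<i> * of_int k) * c k) t
    = (LINT y|circle_measure. circle_kernel a y * trig_poly K c (t + y))"
proof -
  have "(LINT y|circle_measure. circle_kernel a y * trig_poly K c (t + y))
      = (LINT y|circle_measure. complex_of_real (circle_kernel a y) * trig_poly K (\<lambda>k. c k * fchar k t) y)"
    by (simp add: trig_poly_def ring_distribs mult_ac flip: cis_mult)
  also have "\<dots> = (\<Sum>k\<in>K. c k * fchar k t * (a / (a - \<i> * of_int k)))"
    using assms
    by (subst LINT_mult_trig_poly)
       (auto intro!: Lp_2_continuous continuous_intros continuous_on_circle_kernel simp: LINT_circle_kernel_fchar)
  finally show ?thesis
    by (simp add: trig_poly_def mult_ac)
qed

lemma norm_trig_poly_resolvent_le:
  fixes a :: real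
  assumes "a \<noteq> 0"
  shows "norm (trig_poly K (\<lambda>k. a / (a - \<i> * of_int k) * c k) t)
    \<le> (LINT y|circle_measure. circle_kernel a y * norm (trig_poly K c (t + y)))"
  unfolding trig_poly_resolvent[OF assms]
  using integral_norm_bound[of circle_measure "\<lambda>y. circle_kernel a y * trig_poly K c (t + y)"]
  by (simp add: norm_mult circle_kernel_nonneg)

lemma continuous_trig_poly_shift: "continuous_on A (\<lambda>y. trig_poly K c (t + y))"
  by (intro continuous_intros continuous_on_compose2[OF continuous_on_trig_poly[of UNIV]]) auto

text \<open>A positive kernel of mass one forms averages, and these cannot exceed a bound on the
  modulus.\<close>

lemma sup_trig_poly_resolvent:
  fixes a B :: real
  assumes "a \<noteq> 0" "\<And>t. norm (trig_poly K c t) \<le> B"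
  shows "norm (trig_poly K (\<lambda>k. a / (a - \<i> * of_int k) * c k) t) \<le> B"
proof -
  have "(LINT y|circle_measure. circle_kernel a y * norm (trig_poly K c (t + y)))
      \<le> (LINT y|circle_measure. circle_kernel a y * B)"
    by (intro integral_mono integrable_circle_continuous mult_left_mono assms(2) circle_kernel_nonneg
        continuous_intros continuous_on_circle_kernel continuous_trig_poly_shift)
  also have "\<dots> = B"
    using LINT_circle_kernel[OF assms(1)] by simp
  finally show ?thesis
    using norm_trig_poly_resolvent_le[OF assms(1)] order_trans by blast
qed

text \<open>Fubini: for fixed y the integral over t is translation invariant, and the kernel
  integrates to one. Continuity of the joint integrand supplies measurability and boundedness on the
  product.\<close>

lemma L1_trig_poly_resolvent:
  fixes a :: real
  assumes "a \<noteq> 0"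
  shows "(LINT t|circle_measure. norm (trig_poly K (\<lambda>k. a / (a - \<i> * of_int k) * c k) t))
    \<le> (LINT t|circle_measure. norm (trig_poly K c t))"
proof -
  interpret pair_sigma_finite circle_measure circle_measure ..
  interpret P: finite_measure "circle_measure \<Otimes>\<^sub>M circle_measure"
    by (intro finite_measure_pair_measure circle.finite_measure_axioms)
  define H where "H = (\<lambda>(t, y). circle_kernel a y * norm (trig_poly K c (t + y)))"
  have H_cont: "continuous_on UNIV H"
    unfolding H_def case_prod_beta
    by (intro continuous_intros continuous_on_compose2[OF continuous_on_circle_kernel[of UNIV]]
        continuous_on_compose2[OF continuous_on_trig_poly[of UNIV]]) auto
  have [measurable]: "fst \<in> circle_measure \<Otimes>\<^sub>M circle_measure \<rightarrow>\<^sub>M borel"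
    "snd \<in> circle_measure \<Otimes>\<^sub>M circle_measure \<rightarrow>\<^sub>M borel"
    using measurable_compose[OF measurable_fst borel_measurable_circle[of "\<lambda>t. t"]]
      measurable_compose[OF measurable_snd borel_measurable_circle[of "\<lambda>t. t"]] by simp_all
  have "H \<in> borel_measurable (circle_measure \<Otimes>\<^sub>M circle_measure)"
    using borel_measurable_continuous_Pair[of fst "circle_measure \<Otimes>\<^sub>M circle_measure" snd "\<lambda>t y. H (t, y)"]
      H_cont by simp
  moreover obtain B where "\<And>x. x \<in> {0..2 * pi} \<times> {0..2 * pi} \<Longrightarrow> norm (H x) \<le> B"
  proof -
    have "compact (H ` ({0..2 * pi} \<times> {0..2 * pi}))"
      by (intro compact_continuous_image continuous_on_subset[OF H_cont] compact_Times) auto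
    from compact_imp_bounded[OF this] that show thesis by (metis bounded_iff imageI)
  qed
  ultimately have H_int: "integrable (circle_measure \<Otimes>\<^sub>M circle_measure) H"
    by (intro P.integrable_const_bound[of _ B]) (auto intro!: AE_I2 simp: space_pair_measure)
  have "(LINT t|circle_measure. norm (trig_poly K (\<lambda>k. a / (a - \<i> * of_int k) * c k) t))
      \<le> (LINT t|circle_measure. LINT y|circle_measure. H (t, y))"
  proof (rule integral_mono)
    show "integrable circle_measure (\<lambda>t. LINT y|circle_measure. H (t, y))"
      using integrable_fst'[OF H_int] .
    show "norm (trig_poly K (\<lambda>k. a / (a - \<i> * of_int k) * c k) t) \<le> (LINT y|circle_measure. H (t, y))" for t
      unfolding H_def prod.case by (rule norm_trig_poly_resolvent_le[OF assms])
  qed (intro integrable_circle_continuous continuous_intros)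
  also have "\<dots> = (LINT y|circle_measure. LINT t|circle_measure. H (t, y))"
    using Fubini_integral[of "\<lambda>t y. H (t, y)"] H_int by simp
  also have "\<dots> = (LINT y|circle_measure. circle_kernel a y * (LINT t|circle_measure. norm (trig_poly K c t)))"
  proof (rule Bochner_Integration.integral_cong[OF refl])
    fix y assume "y \<in> space circle_measure"
    then have "(LINT t|circle_measure. norm (trig_poly K c (y + t))) = (LINT t|circle_measure. norm (trig_poly K c t))"
      by (intro LINT_circle_shift continuous_intros periodic_trig_poly) auto
    then show "(LINT t|circle_measure. H (t, y)) = circle_kernel a y * (LINT t|circle_measure. norm (trig_poly K c t))"
      by (simp add: H_def add.commute)
  qed
  also have "\<dots> = (LINT t|circle_measure. norm (trig_poly K c t))"
    using LINT_circle_kernel[OF assms] by simp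
  finally show ?thesis .
qed

text \<open>Inverting \<open>1 - \<partial>\<close> by its bounded kernel bounds the supremum by the \<open>L\<^sup>1\<close> norms of \<open>h\<close> and \<open>h'\<close>.\<close>

lemma sup_trig_poly_le:
  "norm (trig_poly K c t) \<le> 1 / (1 - exp (- (2 * pi))) * ((LINT s|circle_measure. norm (trig_poly K c s))
     + (LINT s|circle_measure. norm (trig_poly K (\<lambda>k. \<i> * of_int k * c k) s)))"
proof -
  \<comment> \<open>Translation invariance is available for offsets within one period only.\<close>
  obtain r where r: "r \<in> {0..2 * pi}" "\<And>K c. trig_poly K c t = trig_poly K c r"
    using trig_poly_fundamental_domain[of t] by blast
  define d where "d k = (1 - \<i> * of_int k) * c k" for k
  \<comment> \<open>The maximum over [0, 2 pi] of the kernel with a = 1, attained at y = 0.\<close>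
  define C where "C = 1 / (1 - exp (- (2 * pi)))"
  have "C \<ge> 0" by (simp add: C_def)
  have "1 - \<i> * of_int k \<noteq> 0" for k by (simp add: complex_eq_iff)
  then have "c = (\<lambda>k. complex_of_real 1 / (complex_of_real 1 - \<i> * of_int k) * d k)"
    by (auto simp: d_def fun_eq_iff)
  then have "norm (trig_poly K c r) \<le> (LINT y|circle_measure. circle_kernel 1 y * norm (trig_poly K d (r + y)))"
    using norm_trig_poly_resolvent_le[of 1 K d r] by simp
  also have "\<dots> \<le> (LINT y|circle_measure. C * norm (trig_poly K d (r + y)))"
  proof (rule integral_mono)
    show "circle_kernel 1 y * norm (trig_poly K d (r + y)) \<le> C * norm (trig_poly K d (r + y))"
      if "y \<in> space circle_measure" for y
      using that by (intro mult_right_mono) (auto simp: circle_kernel_def C_def divide_le_cancel)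
  qed (intro integrable_circle_continuous continuous_intros continuous_on_circle_kernel continuous_trig_poly_shift)+
  also have "\<dots> = C * (LINT y|circle_measure. norm (trig_poly K d y))"
    using LINT_circle_shift[OF continuous_on_norm[OF continuous_on_trig_poly] periodic_trig_poly r(1)] by simp
  also have "\<dots> \<le> C * (LINT s|circle_measure. norm (trig_poly K c s) + norm (trig_poly K (\<lambda>k. \<i> * of_int k * c k) s))"
  proof (intro mult_left_mono integral_mono)
    have "trig_poly K d s = trig_poly K c s - trig_poly K (\<lambda>k. \<i> * of_int k * c k) s" for s
      by (simp add: trig_poly_def d_def ring_distribs sum_subtractf)
    then show "norm (trig_poly K d s) \<le> norm (trig_poly K c s) + norm (trig_poly K (\<lambda>k. \<i> * of_int k * c k) s)" for s
      by (simp add: norm_triangle_ineq4)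
  qed (auto intro!: integrable_circle_continuous continuous_intros \<open>C \<ge> 0\<close>)
  also have "\<dots> = C * ((LINT s|circle_measure. norm (trig_poly K c s))
     + (LINT s|circle_measure. norm (trig_poly K (\<lambda>k. \<i> * of_int k * c k) s)))"
    by (subst Bochner_Integration.integral_add) (auto intro!: integrable_circle_continuous continuous_intros)
  finally show ?thesis by (simp add: r(2) C_def)
qed

section \<open>Weak derivatives\<close>

lemma nth_derivative_0: "nth_derivative 0 f = f"
  by (simp add: nth_derivative_def)

lemma nth_derivative_Suc: "nth_derivative (Suc n) f = (\<lambda>t. vector_derivative (nth_derivative n f) (at t))"
  by (simp add: nth_derivative_def)

lemma vector_derivative_cos_sin:
  fixes a b k :: real
  shows "vector_derivative (\<lambda>t. a * cos (k * t) + b * sin (k * t)) (at t) = k * b * cos (k * t) + - (k * a) * sin (k * t)"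
  by (rule vector_derivative_at)
     (auto intro!: derivative_eq_intros simp flip: has_real_derivative_iff_has_vector_derivative)

text \<open>With both amplitudes free the family is closed under differentiation, so smoothness is
  an induction on the order.\<close>

lemma cos_sin_in_test_functions:
  fixes a b :: real
  shows "(\<lambda>t. a * cos (real_of_int k * t) + b * sin (real_of_int k * t)) \<in> test_functions"
proof -
  let ?f = "\<lambda>a b t. a * cos (real_of_int k * t) + b * sin (real_of_int k * t)"
  have "\<exists>a' b'. nth_derivative n (?f a b) = ?f a' b'" for n
  proof (induction n)
    case (Suc n)
    then obtain a' b' where "nth_derivative n (?f a b) = ?f a' b'" by blast
    then show ?case unfolding nth_derivative_Suc vector_derivative_cos_sin by (auto simp only: vector_derivative_cos_sin)
  qed (auto simp: nth_derivative_0)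
  moreover have "?f a' b' differentiable at t" for a' b' t
  proof -
    have "(?f a' b' has_real_derivative - (a' * k * sin (k * t)) + b' * k * cos (k * t)) (at t)"
      by (auto intro!: derivative_eq_intros)
    then show ?thesis using real_differentiable_def by blast
  qed
  moreover have "periodic_2pi (?f a b)"
  proof -
    have "real_of_int k * (t + 2 * pi) = real_of_int k * t + 2 * pi * of_int k" for t
      by (simp add: algebra_simps)
    then show ?thesis
      by (simp add: periodic_2pi_def cos_add sin_add sin_int_2pin cos_int_2pin)
  qed
  ultimately show ?thesis by (auto simp: test_functions_def) (metis)
qed

lemma test_function_continuous:
  assumes "\<phi> \<in> test_functions"
  shows "continuous_on UNIV \<phi>" "continuous_on UNIV (nth_derivative 1 \<phi>)"
proof -
  have "continuous_on UNIV (nth_derivative n \<phi>)" for n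
    using assms unfolding test_functions_def
    by (auto intro!: continuous_at_imp_continuous_on differentiable_imp_continuous_within)
  from this[of 0] this[of 1] show "continuous_on UNIV \<phi>" "continuous_on UNIV (nth_derivative 1 \<phi>)"
    by (simp_all add: nth_derivative_0)
qed

lemma Lp_2_of_real:
  assumes "f \<in> Lp 2 circle_measure"
  shows "(\<lambda>t. complex_of_real (f t)) \<in> Lp 2 circle_measure"
  using assms by (auto simp: Lp_2_iff)

lemma LINT_of_real_mult_fchar:
  assumes "f \<in> Lp 2 circle_measure"
  shows "(LINT t|circle_measure. complex_of_real (f t) * fchar k t)
    = Complex (LINT t|circle_measure. f t * cos (real_of_int k * t)) (LINT t|circle_measure. f t * sin (real_of_int k * t))"
proof -
  have "integrable circle_measure (\<lambda>t. complex_of_real (f t) * fchar k t)"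
    by (intro integrable_mult_Lp_2 Lp_2_of_real assms Lp_2_continuous continuous_intros)
  then show ?thesis
    by (simp add: complex_eq_iff flip: integral_Re integral_Im)
qed

text \<open>Weak derivatives are tested with real functions only, so cosine and sine are inserted
  separately and recombined into the character.\<close>

lemma is_weak_deriv_fchar:
  assumes "is_weak_deriv f d" "f \<in> Lp 2 circle_measure" "d \<in> Lp 2 circle_measure"
  shows "\<i> * of_int k * (LINT t|circle_measure. complex_of_real (f t) * fchar k t)
    = - (LINT t|circle_measure. complex_of_real (d t) * fchar k t)"
proof -
  let ?\<phi> = "\<lambda>a b t. a * cos (real_of_int k * t) + b * sin (real_of_int k * t)"
  have *: "(LINT t|circle_measure. f t * (k * b * cos (real_of_int k * t) + - (k * a) * sin (real_of_int k * t)))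
      = - (LINT t|circle_measure. d t * ?\<phi> a b t)" for a b :: real
  proof -
    have "nth_derivative 1 (?\<phi> a b) t = k * b * cos (real_of_int k * t) + - (k * a) * sin (real_of_int k * t)" for t
      unfolding One_nat_def nth_derivative_Suc nth_derivative_0 by (rule vector_derivative_cos_sin)
    with assms(1) cos_sin_in_test_functions[of a k b] show ?thesis
      unfolding is_weak_deriv_def by (metis (no_types, lifting) Bochner_Integration.integral_cong)
  qed
  have "(LINT t|circle_measure. f t * (- (real_of_int k) * sin (real_of_int k * t)))
      = - (real_of_int k) * (LINT t|circle_measure. f t * sin (real_of_int k * t))"
    "(LINT t|circle_measure. f t * (real_of_int k * cos (real_of_int k * t)))
      = real_of_int k * (LINT t|circle_measure. f t * cos (real_of_int k * t))"
    by (simp_all add: mult.left_commute)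
  with *[of 0 1] *[of 1 0] show ?thesis
    using assms(2,3) by (simp add: LINT_of_real_mult_fchar complex_eq_iff)
qed

lemma is_weak_deriv_diff:
  assumes "is_weak_deriv f f'" "is_weak_deriv g g'" "f \<in> Lp 2 circle_measure" "g \<in> Lp 2 circle_measure"
    "f' \<in> Lp 2 circle_measure" "g' \<in> Lp 2 circle_measure"
  shows "is_weak_deriv (\<lambda>t. f t - g t) (\<lambda>t. f' t - g' t)"
  unfolding is_weak_deriv_def
proof
  fix \<phi> :: "real \<Rightarrow> real" assume \<phi>: "\<phi> \<in> test_functions"
  from test_function_continuous[OF \<phi>, THEN Lp_2_continuous]
  have "integrable circle_measure (\<lambda>t. h t * \<phi> t)" "integrable circle_measure (\<lambda>t. h t * nth_derivative 1 \<phi> t)"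
    if "h \<in> Lp 2 circle_measure" for h
    by (auto intro: integrable_mult_Lp_2 that)
  with assms \<phi> show "(LINT t|circle_measure. (f t - g t) * nth_derivative 1 \<phi> t)
      = - (LINT t|circle_measure. (f' t - g' t) * \<phi> t)"
    unfolding is_weak_deriv_def left_diff_distrib by simp
qed

section \<open>The space H^1 and its seminorm\<close>

lemma H1_D:
  assumes "f \<in> H1"
  shows "continuous_on UNIV f" "periodic_2pi f" "f \<in> Lp 2 circle_measure"
    "weak_deriv f \<in> Lp 2 circle_measure" "is_weak_deriv f (weak_deriv f)"
proof -
  from assms show "continuous_on UNIV f" "periodic_2pi f" by (auto simp: H1_def)
  then show "f \<in> Lp 2 circle_measure" by (intro Lp_2_continuous)
  from assms have "\<exists>g. g \<in> Lp 2 circle_measure \<and> is_weak_deriv f g" by (auto simp: H1_def)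
  from someI_ex[OF this] show "weak_deriv f \<in> Lp 2 circle_measure" "is_weak_deriv f (weak_deriv f)"
    unfolding weak_deriv_def by blast+
qed

lemma H1_diff:
  assumes "f \<in> H1" "g \<in> H1"
  shows "(\<lambda>t. f t - g t) \<in> H1"
    and "is_weak_deriv (\<lambda>t. f t - g t) (\<lambda>t. weak_deriv f t - weak_deriv g t)"
    and "(\<lambda>t. weak_deriv f t - weak_deriv g t) \<in> Lp 2 circle_measure"
proof -
  note f = H1_D[OF assms(1)] and g = H1_D[OF assms(2)]
  show d: "is_weak_deriv (\<lambda>t. f t - g t) (\<lambda>t. weak_deriv f t - weak_deriv g t)"
    by (intro is_weak_deriv_diff f g)
  show L: "(\<lambda>t. weak_deriv f t - weak_deriv g t) \<in> Lp 2 circle_measure"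
    by (intro Lp_2_diff f g)
  show "(\<lambda>t. f t - g t) \<in> H1"
    using d L f g by (auto simp: H1_def periodic_2pi_def intro: continuous_on_diff)
qed

text \<open>\<open>weak_deriv\<close> is an arbitrary choice. Two weak derivatives have the same
  Fourier coefficients, so their difference has norm 0 and any of them computes the
  seminorm.\<close>

lemma H1_seminorm_eq:
  assumes "f \<in> H1" "d \<in> Lp 2 circle_measure" "is_weak_deriv f d"
  shows "H1_seminorm f = L2_norm circle_measure d"
proof -
  note f = H1_D[OF assms(1)]
  have diff: "(\<lambda>t. complex_of_real (weak_deriv f t) - complex_of_real (d t)) \<in> Lp 2 circle_measure"
    by (intro Lp_2_diff Lp_2_of_real f assms)
  have "(LINT t|circle_measure. (complex_of_real (weak_deriv f t) - complex_of_real (d t)) * fchar k t) = 0" for k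
  proof -
    have "integrable circle_measure (\<lambda>t. complex_of_real (h t) * fchar k t)" if "h \<in> Lp 2 circle_measure" for h
      by (intro integrable_mult_Lp_2 Lp_2_of_real that Lp_2_continuous continuous_intros)
    then show ?thesis
      using is_weak_deriv_fchar[OF f(5) f(3) f(4), of k] is_weak_deriv_fchar[OF assms(3) f(3) assms(2), of k]
        f(4) assms(2)
      by (simp add: left_diff_distrib)
  qed
  from L2_norm_circle_eq_0[OF diff this]
  have 0: "L2_norm circle_measure (\<lambda>t. norm (weak_deriv f t - d t)) = 0"
    by (simp flip: of_real_diff)
  have z: "(\<lambda>t. 0::real) \<in> Lp 2 circle_measure" by (simp add: Lp_2_iff)
  show ?thesis
    using L2_norm_triangle_diff[OF f(4) assms(2) z] L2_norm_triangle_diff[OF assms(2) f(4) z] 0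
    by (simp add: H1_seminorm_def L2_norm_minus_commute[of _ d] abs_minus_commute)
qed

text \<open>Expansion of a square about g, which will be \<open>\<gamma>\<^sub>0\<close>; the cross
  term is the pairing that the source estimate controls.\<close>

lemma H1_seminorm_expand:
  assumes "f \<in> H1" "g \<in> H1"
  shows "(H1_seminorm f)\<^sup>2 = (H1_seminorm g)\<^sup>2 + (H1_seminorm (\<lambda>t. f t - g t))\<^sup>2
    + 2 * (LINT t|circle_measure. weak_deriv g t * (weak_deriv f t - weak_deriv g t))"
proof -
  note f = H1_D[OF assms(1)] and g = H1_D[OF assms(2)] and d = H1_diff[OF assms]
  have "(LINT t|circle_measure. (weak_deriv f t)\<^sup>2)
      = (LINT t|circle_measure. (weak_deriv g t)\<^sup>2 + (weak_deriv f t - weak_deriv g t)\<^sup>2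
          + 2 * (weak_deriv g t * (weak_deriv f t - weak_deriv g t)))"
    by (intro Bochner_Integration.integral_cong refl) (simp add: power2_eq_square algebra_simps)
  also have "\<dots> = (LINT t|circle_measure. (weak_deriv g t)\<^sup>2) + (LINT t|circle_measure. (weak_deriv f t - weak_deriv g t)\<^sup>2)
          + 2 * (LINT t|circle_measure. weak_deriv g t * (weak_deriv f t - weak_deriv g t))"
    using g(4) d(3) integrable_mult_Lp_2[OF g(4) d(3)] by (simp add: Lp_2_iff)
  finally show ?thesis
    by (simp add: H1_seminorm_eq[OF d(1,3,2)] L2_norm_power2) (simp add: H1_seminorm_def L2_norm_power2)
qed

section \<open>Approximation in H^1\<close>

lemma LINT_trig_poly_mult_fchar:
  fixes c :: "int \<Rightarrow> complex"
  assumes "finite K"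
  shows "(LINT t|circle_measure. trig_poly K c t * fchar k t) = (if - k \<in> K then 2 * pi * c (- k) else 0)"
proof -
  have "(LINT t|circle_measure. trig_poly K c t * fchar k t) = (LINT t|circle_measure. fchar k t * trig_poly K c t)"
    by (simp add: mult.commute)
  also have "\<dots> = (\<Sum>l\<in>K. c l * (LINT t|circle_measure. fchar k t * fchar l t))"
    by (intro LINT_mult_trig_poly Lp_2_continuous continuous_intros)
  also have "\<dots> = (\<Sum>l\<in>K. c l * (LINT t|circle_measure. fchar (k + l) t))"
    by (simp add: cis_mult ring_distribs)
  also have "\<dots> = (\<Sum>l\<in>K. if l = - k then 2 * pi * c l else 0)"
    unfolding LINT_fchar by (intro sum.cong) (auto simp: add_eq_0_iff)
  also have "\<dots> = (if - k \<in> K then 2 * pi * c (- k) else 0)"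
    using assms by (simp add: sum.delta)
  finally show ?thesis .
qed

abbreviation trig_deriv_coeff :: "(int \<Rightarrow> complex) \<Rightarrow> int \<Rightarrow> complex" where
  "trig_deriv_coeff c \<equiv> \<lambda>k. \<i> * of_int k * c k"

text \<open>Only d has to be approximated: its approximant loses the constant term and is integrated
  termwise, the constant coefficient of the result is set to the mean of f, and Wirtinger's
  inequality bounds the error for f by that for d.\<close>

lemma H1_trig_poly_dense:
  assumes "f \<in> Lp 2 circle_measure" "d \<in> Lp 2 circle_measure" "is_weak_deriv f d" "\<epsilon> > 0"
  obtains K c where "finite K"
    "L2_norm circle_measure (\<lambda>t. norm (complex_of_real (f t) - trig_poly K c t)) < \<epsilon>"
    "L2_norm circle_measure (\<lambda>t. norm (complex_of_real (d t) - trig_poly K (trig_deriv_coeff c) t)) < \<epsilon>"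
proof -
  have f: "(\<lambda>t. complex_of_real (f t)) \<in> Lp 2 circle_measure" and d: "(\<lambda>t. complex_of_real (d t)) \<in> Lp 2 circle_measure"
    using assms(1,2) by (simp_all add: Lp_2_of_real)
  have weak: "\<i> * of_int k * (LINT t|circle_measure. complex_of_real (f t) * fchar k t)
    = - (LINT t|circle_measure. complex_of_real (d t) * fchar k t)" for k
    using is_weak_deriv_fchar[OF assms(3,1,2)] .
  have int: "integrable circle_measure (\<lambda>t. h t * fchar k t)" if "h \<in> Lp 2 circle_measure" for h k
    by (intro integrable_mult_Lp_2 that Lp_2_continuous continuous_intros)
  from assms(4) have "\<epsilon> / 2 > 0" by simp
  from trig_poly_dense[OF d this] obtain L b where L: "finite L"
    "L2_norm circle_measure (\<lambda>t. norm (complex_of_real (d t) - trig_poly L b t)) < \<epsilon> / 2" by blast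
  \<comment> \<open>The constant term of the approximant, which is no derivative. Since d has mean
    zero, its size is bounded by the approximation error, whence the two halves of
    \<epsilon>.\<close>
  define \<beta> where "\<beta> = (if 0 \<in> L then b 0 else 0)"
  define K where "K = insert 0 L"
  define c where "c k = (if k = 0 then (LINT t|circle_measure. complex_of_real (f t)) / (2 * pi) else b k / (\<i> * of_int k))" for k
  have "finite K" using L by (simp add: K_def)
  have T': "trig_poly K (trig_deriv_coeff c) t = trig_poly L b t - \<beta>" for t
  proof -
    have "trig_poly K (trig_deriv_coeff c) t = (\<Sum>k\<in>L - {0}. b k * fchar k t)"
      unfolding trig_poly_def K_def using L(1)
      by (intro sum.mono_neutral_cong_right) (auto simp: c_def)
    also have "\<dots> = trig_poly L b t - \<beta>"
      using L(1) by (simp add: trig_poly_def \<beta>_def sum_diff1)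
    finally show ?thesis .
  qed
  have e: "(\<lambda>t. complex_of_real (d t) - trig_poly L b t) \<in> Lp 2 circle_measure"
    by (intro Lp_2_diff d Lp_2_trig_poly)
  have "2 * pi * norm \<beta> \<le> sqrt (2 * pi) * L2_norm circle_measure (\<lambda>t. norm (complex_of_real (d t) - trig_poly L b t))"
  proof -
    have "(LINT t|circle_measure. complex_of_real (d t) - trig_poly L b t) = - (2 * pi * \<beta>)"
      using weak[of 0] LINT_trig_poly_mult_fchar[OF L(1), of b 0] int[OF d, of 0] int[OF Lp_2_trig_poly[of L b], of 0]
      by (simp add: \<beta>_def split: if_splits)
    then have "2 * pi * norm \<beta> = norm (LINT t|circle_measure. complex_of_real (d t) - trig_poly L b t)"
      by (simp add: norm_mult)
    also have "\<dots> \<le> (LINT t|circle_measure. norm (complex_of_real (d t) - trig_poly L b t))"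
      by (rule integral_norm_bound)
    also note LINT_circle_le_L2_norm[OF e]
    finally show ?thesis .
  qed
  then have "sqrt (2 * pi) * (sqrt (2 * pi) * norm \<beta>) \<le> sqrt (2 * pi) * L2_norm circle_measure (\<lambda>t. norm (complex_of_real (d t) - trig_poly L b t))"
    by (simp flip: mult.assoc)
  then have "sqrt (2 * pi) * norm \<beta> \<le> L2_norm circle_measure (\<lambda>t. norm (complex_of_real (d t) - trig_poly L b t))"
    by (rule mult_left_le_imp_le) simp
  moreover have "L2_norm circle_measure (\<lambda>t. norm \<beta>) = sqrt (2 * pi) * norm \<beta>"
    by (simp add: L2_norm_def real_sqrt_mult)
  moreover have "L2_norm circle_measure (\<lambda>t. norm (complex_of_real (d t) - trig_poly L b t + \<beta>))
      \<le> L2_norm circle_measure (\<lambda>t. norm (complex_of_real (d t) - trig_poly L b t)) + L2_norm circle_measure (\<lambda>t. norm \<beta>)"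
    by (intro L2_norm_triangle e Lp_2_continuous continuous_intros)
  ultimately have d_less: "L2_norm circle_measure (\<lambda>t. norm (complex_of_real (d t) - trig_poly K (trig_deriv_coeff c) t)) < \<epsilon>"
    using L(2) unfolding T' by (simp add: algebra_simps)
  have "L2_norm circle_measure (\<lambda>t. norm (complex_of_real (f t) - trig_poly K c t))
      \<le> L2_norm circle_measure (\<lambda>t. norm (complex_of_real (d t) - trig_poly K (trig_deriv_coeff c) t))"
  proof (rule Wirtinger)
    show "(\<lambda>t. complex_of_real (f t) - trig_poly K c t) \<in> Lp 2 circle_measure"
      "(\<lambda>t. complex_of_real (d t) - trig_poly K (trig_deriv_coeff c) t) \<in> Lp 2 circle_measure"
      by (intro Lp_2_diff f d Lp_2_trig_poly)+
    show "(LINT t|circle_measure. complex_of_real (f t) - trig_poly K c t) = 0"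
      using LINT_trig_poly_mult_fchar[OF \<open>finite K\<close>, of c 0] int[OF f, of 0] int[OF Lp_2_trig_poly[of K c], of 0]
      by (simp add: K_def c_def)
    show "\<i> * of_int k * (LINT t|circle_measure. (complex_of_real (f t) - trig_poly K c t) * fchar k t)
        = - (LINT t|circle_measure. (complex_of_real (d t) - trig_poly K (trig_deriv_coeff c) t) * fchar k t)" for k
      using weak[of k] by (simp add: left_diff_distrib int f d Lp_2_trig_poly LINT_trig_poly_mult_fchar[OF \<open>finite K\<close>]
          right_diff_distrib)
  qed
  with d_less \<open>finite K\<close> show thesis using that by (meson order_le_less_trans)
qed

section \<open>Pairings and fractional powers\<close>

text \<open>A nonpositive \<open>q'\<close> becomes 0 under \<open>ennreal\<close>, with infinite
  reciprocal; the equation itself thus forces \<open>q'\<close> to be positive.\<close>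

lemma conjugate_exponent_cases:
  fixes q :: ennreal and q' :: real
  assumes "2 \<le> q" "1 / q + 1 / ennreal q' = 1"
  obtains (infinite) "q = \<infinity>" "q' = 1" | (finite) r where "2 \<le> r" "q = ennreal r" "0 < q'" "1 / r + 1 / q' = 1"
proof -
  have "0 < q'"
    using assms(2) by (rule contrapos_pp) (simp add: ennreal_neg divide_ennreal_def)
  have *: "1 / ennreal q' = ennreal (1 / q')"
    using \<open>0 < q'\<close> divide_ennreal[of 1 q'] by simp
  show thesis
  proof (cases q)
    case (real r)
    have "2 \<le> r"
      using assms(1) real by (metis ennreal_le_iff ennreal_numeral)
    then have "1 / q = ennreal (1 / r)"
      using real divide_ennreal[of 1 r] by simp
    then have "ennreal (1 / r + 1 / q') = ennreal 1"
      using assms(2) * \<open>2 \<le> r\<close> \<open>0 < q'\<close> by (simp flip: ennreal_plus)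
    then have "1 / r + 1 / q' = 1"
      using \<open>2 \<le> r\<close> \<open>0 < q'\<close> by (subst (asm) ennreal_inj) auto
    with \<open>2 \<le> r\<close> real \<open>0 < q'\<close> show thesis by (intro finite)
  next
    case top
    then have "ennreal (1 / q') = ennreal 1"
      using assms(2) * by simp
    then have "1 / q' = 1"
      using \<open>0 < q'\<close> by (subst (asm) ennreal_inj) auto
    then have "q' = 1" by (simp add: divide_eq_1_iff)
    with top show thesis by (intro infinite) simp_all
  qed
qed

lemma (in finite_measure) Lp_imp_Lp_2:
  assumes "g \<in> Lp q M" "2 \<le> q"
  shows "g \<in> Lp 2 M"
proof (cases q)
  case (real r)
  have "2 \<le> r" using assms(2) real by (metis ennreal_le_iff ennreal_numeral)
  have g [measurable]: "g \<in> borel_measurable M" and int: "integrable M (\<lambda>x. norm (g x) powr r)"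
    using assms(1) real by (auto simp: Lp_def)
  have "integrable M (\<lambda>x. (norm (g x))\<^sup>2)"
  proof (rule Bochner_Integration.integrable_bound)
    show "integrable M (\<lambda>x. 1 + norm (g x) powr r)" using int by simp
    have "a\<^sup>2 \<le> 1 + a powr r" if "0 \<le> a" for a :: real
    proof (cases "a \<le> 1")
      case True
      then have "a\<^sup>2 \<le> 1" using that by (simp add: power_le_one)
      then show ?thesis by (simp add: add_increasing2)
    next
      case False
      then have "a powr 2 \<le> a powr r" using \<open>2 \<le> r\<close> by (intro powr_mono) auto
      with False show ?thesis by simp
    qed
    then show "AE x in M. norm ((norm (g x))\<^sup>2) \<le> norm (1 + norm (g x) powr r)"
      by (auto simp: abs_of_nonneg add_nonneg_nonneg)
  qed simp
  with g show ?thesis by (simp add: Lp_2_iff)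
next
  case top
  with assms(1) obtain C where g [measurable]: "g \<in> borel_measurable M" and C: "AE x in M. norm (g x) \<le> C"
    by (auto simp: Lp_def)
  have "integrable M (\<lambda>x. (norm (g x))\<^sup>2)"
    using C by (intro integrable_const_bound[of _ "C\<^sup>2"]) (auto elim!: eventually_mono intro!: power_mono)
  with g show ?thesis by (simp add: Lp_2_iff)
qed

text \<open>The split is at the level \<open>\<delta> powr (1 / q' - 1)\<close> of \<open>|g|\<close>.\<close>

lemma (in finite_measure) Lp_pairing_bound:
  fixes g :: "'a \<Rightarrow> 'b::{real_normed_div_algebra, banach, second_countable_topology}"
  assumes "g \<in> Lp q M" "2 \<le> q" "1 / q + 1 / ennreal q' = 1"
  obtains C where "0 \<le> C"
    "\<And>\<delta> f B. 0 < \<delta> \<Longrightarrow> f \<in> borel_measurable M \<Longrightarrow> (\<And>x. x \<in> space M \<Longrightarrow> norm (f x) \<le> B) \<Longrightarrow> 0 \<le> B \<Longrightarrow>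
       norm (LINT x|M. g x * f x) \<le> C * (\<delta> powr (1 / q') * B + \<delta> powr (1 / q' - 1) * (LINT x|M. norm (f x)))"
proof -
  have L2: "g \<in> Lp 2 M" using assms(1,2) by (rule Lp_imp_Lp_2)
  then have [measurable]: "g \<in> borel_measurable M" by (simp add: Lp_2_iff)
  show thesis using assms(2,3)
  proof (cases rule: conjugate_exponent_cases)
    case infinite
    then obtain C where C: "AE x in M. norm (g x) \<le> C"
      using assms(1) by (auto simp: Lp_def)
    show thesis
    proof (rule that[of "max C 0"])
      fix \<delta> B :: real and f :: "'a \<Rightarrow> 'b"
      assume f: "0 < \<delta>" "f \<in> borel_measurable M" "\<And>x. x \<in> space M \<Longrightarrow> norm (f x) \<le> B" "0 \<le> B"
      note [measurable] = f(2)
      have "integrable M f" using f(3) by (intro integrable_const_bound[of _ B] AE_I2) auto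
      have "f \<in> Lp 2 M" using f(2,3) by (rule Lp_2_bounded)
      have "norm (LINT x|M. g x * f x) \<le> (LINT x|M. max C 0 * norm (f x))"
      proof (rule order_trans[OF integral_norm_bound integral_mono_AE])
        show "integrable M (\<lambda>x. norm (g x * f x))" by (intro integrable_norm integrable_mult_Lp_2 L2 \<open>f \<in> Lp 2 M\<close>)
        show "AE x in M. norm (g x * f x) \<le> max C 0 * norm (f x)"
          using C by eventually_elim (auto simp: norm_mult intro!: mult_right_mono)
      qed (use \<open>integrable M f\<close> in auto)
      \<comment> \<open>For \<open>q' = 1\<close> the two powers of \<delta> are \<delta> and 1, so
        the L^1 term alone already dominates.\<close>
      also have "\<dots> \<le> max C 0 * (\<delta> * B + (LINT x|M. norm (f x)))"
        using f(1,4) by (simp add: mult_left_mono)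
      finally show "norm (LINT x|M. g x * f x)
          \<le> max C 0 * (\<delta> powr (1 / q') * B + \<delta> powr (1 / q' - 1) * (LINT x|M. norm (f x)))"
        using f(1) infinite by simp
    qed simp
  next
    case (finite r)
    then have int: "integrable M (\<lambda>x. norm (g x) powr r)" using assms(1) by (auto simp: Lp_def)
    define G where "G = (LINT x|M. norm (g x) powr r)"
    have "0 \<le> G" unfolding G_def by simp
    show thesis
    proof (rule that[of "G + 1"])
      fix \<delta> B :: real and f :: "'a \<Rightarrow> 'b"
      assume f: "0 < \<delta>" "f \<in> borel_measurable M" "\<And>x. x \<in> space M \<Longrightarrow> norm (f x) \<le> B" "0 \<le> B"
      note [measurable] = f(2)
      have int_f: "integrable M f" using f(3) by (intro integrable_const_bound[of _ B] AE_I2) auto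
      have "f \<in> Lp 2 M" using f(2,3) by (rule Lp_2_bounded)
      define R where "R = \<delta> powr (1 / q' - 1)"
      have "R > 0" using f(1) by (simp add: R_def)
      \<comment> \<open>By conjugacy r - 1 = r / q', so the level R satisfies R^(1 - r) =
        \<delta>^(1/q').\<close>
      have "(1 / q' - 1) * (1 - r) = 1 / q'"
      proof -
        have "1 / q' - 1 = - (1 / r)" using finite(4) by simp
        then have "(1 / q' - 1) * (1 - r) = 1 - 1 / r"
          using finite(1) by (simp only:) (simp add: field_simps)
        then show ?thesis using finite(4) by simp
      qed
      then have R: "R powr (1 - r) = \<delta> powr (1 / q')"
        by (simp add: R_def powr_powr)
      have "norm (LINT x|M. g x * f x) \<le> (LINT x|M. R * norm (f x) + norm (g x) powr r * (\<delta> powr (1 / q') * B))"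
      proof (rule order_trans[OF integral_norm_bound integral_mono])
        show "integrable M (\<lambda>x. norm (g x * f x))" by (intro integrable_norm integrable_mult_Lp_2 L2 \<open>f \<in> Lp 2 M\<close>)
        show "integrable M (\<lambda>x. R * norm (f x) + norm (g x) powr r * (\<delta> powr (1 / q') * B))"
          using int int_f by simp
        fix x assume x: "x \<in> space M"
          show "norm (g x * f x) \<le> R * norm (f x) + norm (g x) powr r * (\<delta> powr (1 / q') * B)"
          proof (cases "norm (g x) \<le> R")
            case True
            then have "norm (g x) * norm (f x) \<le> R * norm (f x)" by (rule mult_right_mono) simp
            moreover have "0 \<le> norm (g x) powr r * (\<delta> powr (1 / q') * B)" using f(4) by simp
            ultimately show ?thesis by (simp add: norm_mult)
          next
            case False
            \<comment> \<open>Above the level, the negative exponent 1 - r lets R replace |g| in the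
              second factor.\<close>
            have "norm (g x) = norm (g x) powr r * norm (g x) powr (1 - r)"
              using False \<open>R > 0\<close> by (simp flip: powr_add)
            also have "\<dots> \<le> norm (g x) powr r * R powr (1 - r)"
              using False \<open>R > 0\<close> finite(1) by (intro mult_left_mono powr_mono2') auto
            finally have "norm (g x) * norm (f x) \<le> norm (g x) powr r * R powr (1 - r) * B"
              using f(3)[OF x] by (intro mult_mono) auto
            moreover have "0 \<le> R * norm (f x)" using \<open>R > 0\<close> by simp
            ultimately show ?thesis by (simp add: norm_mult R mult.assoc)
          qed
      qed
      also have "\<dots> = R * (LINT x|M. norm (f x)) + G * (\<delta> powr (1 / q') * B)"
        using int int_f by (simp add: G_def)
      also have "\<dots> \<le> (G + 1) * (R * (LINT x|M. norm (f x))) + (G + 1) * (\<delta> powr (1 / q') * B)"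
        using \<open>0 \<le> G\<close> \<open>R > 0\<close> f(4) by (intro add_mono) (auto simp: distrib_right)
      finally show "norm (LINT x|M. g x * f x)
          \<le> (G + 1) * (\<delta> powr (1 / q') * B + \<delta> powr (1 / q' - 1) * (LINT x|M. norm (f x)))"
        by (simp add: R_def distrib_left add.commute)
    qed (use \<open>0 \<le> G\<close> in simp)
  qed
qed

section \<open>Fractional powers from resolvents\<close>

lemma has_bochner_integral_powr_from_0:
  fixes \<theta> M :: real
  assumes "\<theta> < 1" "0 < M"
  shows "has_bochner_integral lborel (\<lambda>\<mu>. indicator {0..M} \<mu> * \<mu> powr (- \<theta>)) (M powr (1 - \<theta>) / (1 - \<theta>))"
proof (rule has_bochner_integral_nn_integral)
  have "((\<lambda>\<mu>. \<mu> powr (- \<theta>)) has_integral (M powr (1 - \<theta>) / (1 - \<theta>))) {0..M}"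
    using has_integral_powr_from_0[of "- \<theta>" M] assms by simp
  then show "(\<integral>\<^sup>+ \<mu>. ennreal (indicator {0..M} \<mu> * \<mu> powr (- \<theta>)) \<partial>lborel)
      = ennreal (M powr (1 - \<theta>) / (1 - \<theta>))"
    by (intro nn_integral_has_integral_lebesgue) auto
qed (use assms in auto)

lemma has_bochner_integral_powr_to_inf:
  fixes \<theta> M :: real
  assumes "1 < \<theta>" "0 < M"
  shows "has_bochner_integral lborel (\<lambda>\<mu>. indicator {M..} \<mu> * \<mu> powr (- \<theta>)) (M powr (1 - \<theta>) / (\<theta> - 1))"
proof (rule has_bochner_integral_nn_integral)
  have eq: "- (M powr (- \<theta> + 1)) / (- \<theta> + 1) = M powr (1 - \<theta>) / (\<theta> - 1)"
    using minus_divide_divide[of "M powr (1 - \<theta>)" "\<theta> - 1"] by simp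
  have "((\<lambda>\<mu>. \<mu> powr (- \<theta>)) has_integral (M powr (1 - \<theta>) / (\<theta> - 1))) {M..}"
    using has_integral_powr_to_inf[of "- \<theta>" M] assms unfolding eq by simp
  then show "(\<integral>\<^sup>+ \<mu>. ennreal (indicator {M..} \<mu> * \<mu> powr (- \<theta>)) \<partial>lborel)
      = ennreal (M powr (1 - \<theta>) / (\<theta> - 1))"
    by (intro nn_integral_has_integral_lebesgue) auto
qed (use assms in auto)

text \<open>The integrals \<open>\<integral>\<^sub>0\<^sup>\<infinity> \<mu>\<^sup>-\<^sup>\<theta> / (\<mu> + A) d\<mu> = c A\<^sup>-\<^sup>\<theta>\<close> represent fractional powers by resolvents;
  the value of \<open>c\<close> is immaterial.\<close>

definition resolvent_integrand :: "real \<Rightarrow> real \<Rightarrow> real \<Rightarrow> real" where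
  "resolvent_integrand \<theta> A \<mu> = indicator {0<..} \<mu> * (\<mu> powr (- \<theta>) / (\<mu> + A))"

definition resolvent_const :: "real \<Rightarrow> real" where
  "resolvent_const \<theta> = (LINT \<mu>|lborel. resolvent_integrand \<theta> 1 \<mu>)"

lemma borel_measurable_resolvent_integrand [measurable]: "resolvent_integrand \<theta> A \<in> borel_measurable borel"
  unfolding resolvent_integrand_def[abs_def] by measurable

text \<open>\<theta> < 1 gives integrability at 0, and \<theta> > 0 gives it at infinity.\<close>

lemma integrable_resolvent_integrand_1:
  assumes "0 < \<theta>" "\<theta> < 1"
  shows "integrable lborel (resolvent_integrand \<theta> 1)"
proof (rule Bochner_Integration.integrable_bound)
  show "integrable lborel (\<lambda>\<mu>. indicator {0..1} \<mu> * \<mu> powr (- \<theta>) + indicator {1..} \<mu> * \<mu> powr (- (\<theta> + 1)))"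
    using has_bochner_integral_powr_from_0[of \<theta> 1] has_bochner_integral_powr_to_inf[of "\<theta> + 1" 1] assms
    by (intro Bochner_Integration.integrable_add) (auto intro: integrable.intros)
  show "AE \<mu> in lborel. norm (resolvent_integrand \<theta> 1 \<mu>)
      \<le> norm (indicator {0..1} \<mu> * \<mu> powr (- \<theta>) + indicator {1..} \<mu> * \<mu> powr (- (\<theta> + 1)))"
  proof (rule AE_I2)
    fix \<mu> :: real
    consider "\<mu> \<le> 0" | "0 < \<mu>" "\<mu> \<le> 1" | "1 < \<mu>" by linarith
    then show "norm (resolvent_integrand \<theta> 1 \<mu>)
      \<le> norm (indicator {0..1} \<mu> * \<mu> powr (- \<theta>) + indicator {1..} \<mu> * \<mu> powr (- (\<theta> + 1)))"
    proof cases
      case 2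
      have "\<mu> powr (- \<theta>) / (\<mu> + 1) \<le> \<mu> powr (- \<theta>)"
        using 2 by (simp add: divide_le_eq mult_le_cancel_left1)
      also have "\<dots> \<le> indicator {0..1} \<mu> * \<mu> powr (- \<theta>) + indicator {1..} \<mu> * \<mu> powr (- (\<theta> + 1))"
        using 2 by (simp add: indicator_def)
      finally show ?thesis using 2 by (simp add: resolvent_integrand_def)
    next
      case 3
      have "\<mu> powr (- \<theta>) / (\<mu> + 1) \<le> \<mu> powr (- \<theta>) / \<mu>"
        using 3 by (intro divide_left_mono) auto
      also have "\<dots> = \<mu> powr (- (\<theta> + 1))"
        using 3 by (simp add: powr_diff flip: powr_minus_divide)
      finally show ?thesis using 3 by (simp add: resolvent_integrand_def)
    qed (simp add: resolvent_integrand_def)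
  qed
qed measurable

text \<open>Rescaling the variable by A reduces the integral to A = 1; together with the Jacobian A
  this leaves the factor A^(-\<theta>).\<close>

lemma resolvent_integrand_scale:
  assumes "0 < A"
  shows "resolvent_integrand \<theta> A (A * \<mu>) = A powr (- \<theta> - 1) * resolvent_integrand \<theta> 1 \<mu>"
proof (cases "\<mu> > 0")
  case True
  have "A * \<mu> + A = A * (\<mu> + 1)" by (simp add: algebra_simps)
  with True assms show ?thesis
    by (simp add: resolvent_integrand_def powr_mult powr_diff)
qed (use assms in \<open>auto simp: resolvent_integrand_def zero_less_mult_iff\<close>)

lemma integrable_resolvent_integrand:
  assumes "0 < \<theta>" "\<theta> < 1" "0 < A"
  shows "integrable lborel (resolvent_integrand \<theta> A)"
  using lborel_integrable_real_affine_iff[of A "resolvent_integrand \<theta> A" 0]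
    integrable_resolvent_integrand_1[OF assms(1,2)] assms(3)
  by (simp add: resolvent_integrand_scale)

lemma LINT_resolvent_integrand:
  assumes "0 < A"
  shows "(LINT \<mu>|lborel. resolvent_integrand \<theta> A \<mu>) = resolvent_const \<theta> * A powr (- \<theta>)"
proof -
  have "A * A powr (- \<theta> - 1) = A powr (- \<theta>)"
    using assms by (simp add: powr_diff)
  then show ?thesis
    using lborel_integral_real_affine[of A "resolvent_integrand \<theta> A" 0] assms
    by (simp add: resolvent_integrand_scale resolvent_const_def)
qed

text \<open>Positivity permits division by the constant. On (0, 1] the denominator \<mu> + 1 is at
  most 2, which leaves half of an explicit power integral as a lower bound.\<close>

lemma resolvent_const_pos:
  assumes "0 < \<theta>" "\<theta> < 1"
  shows "0 < resolvent_const \<theta>"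
proof -
  note h = has_bochner_integral_powr_from_0[of \<theta> 1, OF assms(2)]
  have "0 < 1 / 2 * (1 powr (1 - \<theta>) / (1 - \<theta>))" using assms by simp
  also have "\<dots> = (LINT \<mu>|lborel. 1 / 2 * (indicator {0..1} \<mu> * \<mu> powr (- \<theta>)))"
    using h by (simp add: has_bochner_integral_integral_eq)
  also have "\<dots> \<le> (LINT \<mu>|lborel. resolvent_integrand \<theta> 1 \<mu>)"
  proof (rule integral_mono)
    show "1 / 2 * (indicator {0..1} \<mu> * \<mu> powr (- \<theta>)) \<le> resolvent_integrand \<theta> 1 \<mu>" for \<mu>
    proof (cases "0 < \<mu> \<and> \<mu> \<le> 1")
      case True
      then have "\<mu> powr (- \<theta>) / 2 \<le> \<mu> powr (- \<theta>) / (\<mu> + 1)"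
        by (intro divide_left_mono) auto
      with True show ?thesis by (simp add: resolvent_integrand_def)
    qed (auto simp: resolvent_integrand_def indicator_def)
    show "integrable lborel (\<lambda>\<mu>. 1 / 2 * (indicator {0..1} \<mu> * \<mu> powr (- \<theta>)))"
      using h by (auto intro: integrable.intros)
  qed (rule integrable_resolvent_integrand_1[OF assms])
  finally show ?thesis by (simp add: resolvent_const_def)
qed

text \<open>Splitting the representation at \<open>\<mu> = M\<close>.\<close>

lemma sum_powr_resolvent_bound:
  fixes A :: "'i \<Rightarrow> real" and b :: "'i \<Rightarrow> complex"
  assumes "1 / 2 < \<theta>" "\<theta> < 1" "0 < M" "finite I" "\<And>i. i \<in> I \<Longrightarrow> 0 < A i"
    and "\<And>\<mu>. 0 < \<mu> \<Longrightarrow> norm (\<Sum>i\<in>I. b i / complex_of_real (\<mu> + A i)) \<le> D1"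
    and "\<And>\<mu>. 0 < \<mu> \<Longrightarrow> norm (\<Sum>i\<in>I. b i / complex_of_real (\<mu> + A i)) \<le> D2 * \<mu> powr (- 1 / 2)"
  shows "norm (\<Sum>i\<in>I. b i * complex_of_real (A i powr (- \<theta>)))
    \<le> (D1 * (M powr (1 - \<theta>) / (1 - \<theta>)) + D2 * (M powr (1 / 2 - \<theta>) / (\<theta> - 1 / 2))) / resolvent_const \<theta>"
proof -
  have "0 < \<theta>" using assms(1) by simp
  note int = integrable_resolvent_integrand[OF \<open>0 < \<theta>\<close> assms(2) assms(5)]
  have "0 < resolvent_const \<theta>" by (rule resolvent_const_pos[OF \<open>0 < \<theta>\<close> assms(2)])
  have D: "0 \<le> D1" "0 \<le> D2"
    using order_trans[OF norm_ge_zero assms(6)[of 1]] order_trans[OF norm_ge_zero assms(7)[of 1]] by simp_all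
  define \<Phi> where "\<Phi> \<mu> = (\<Sum>i\<in>I. b i * complex_of_real (resolvent_integrand \<theta> (A i) \<mu>))" for \<mu>
  \<comment> \<open>Majorants for the two ranges: \<theta> < 1 makes the first integrable at 0, and
    the gain \<mu>^(-1/2) raises the decay of the second to \<theta> + 1/2 > 1 at infinity.\<close>
  define w1 where "w1 \<mu> = indicator {0..M} \<mu> * \<mu> powr (- \<theta>)" for \<mu>
  define w2 where "w2 \<mu> = indicator {M..} \<mu> * \<mu> powr (- (\<theta> + 1 / 2))" for \<mu>
  have w: "has_bochner_integral lborel w1 (M powr (1 - \<theta>) / (1 - \<theta>))"
    "has_bochner_integral lborel w2 (M powr (1 / 2 - \<theta>) / (\<theta> - 1 / 2))"
    using has_bochner_integral_powr_from_0[OF assms(2,3)]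
      has_bochner_integral_powr_to_inf[of "\<theta> + 1 / 2" M] assms(1,3)
    by (simp_all add: w1_def[abs_def] w2_def[abs_def])
  have "(\<Sum>i\<in>I. b i * complex_of_real (A i powr (- \<theta>))) * complex_of_real (resolvent_const \<theta>)
      = (\<Sum>i\<in>I. b i * complex_of_real (LINT \<mu>|lborel. resolvent_integrand \<theta> (A i) \<mu>))"
    unfolding sum_distrib_right
    using assms(5) by (intro sum.cong) (simp_all add: LINT_resolvent_integrand mult_ac)
  also have "\<dots> = (\<Sum>i\<in>I. LINT \<mu>|lborel. b i * complex_of_real (resolvent_integrand \<theta> (A i) \<mu>))"
    using int by simp
  also have "\<dots> = (LINT \<mu>|lborel. \<Phi> \<mu>)"
    unfolding \<Phi>_def using int by (intro Bochner_Integration.integral_sum[symmetric]) auto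
  finally have "norm (\<Sum>i\<in>I. b i * complex_of_real (A i powr (- \<theta>))) * resolvent_const \<theta>
      = norm (LINT \<mu>|lborel. \<Phi> \<mu>)"
    using \<open>0 < resolvent_const \<theta>\<close> by (metis abs_of_pos norm_mult norm_of_real real_norm_def)
  also have "\<dots> \<le> (LINT \<mu>|lborel. D1 * w1 \<mu> + D2 * w2 \<mu>)"
  proof (rule order_trans[OF integral_norm_bound integral_mono])
    show "integrable lborel (\<lambda>\<mu>. norm (\<Phi> \<mu>))"
      unfolding \<Phi>_def using int by (intro integrable_norm) auto
    show "integrable lborel (\<lambda>\<mu>. D1 * w1 \<mu> + D2 * w2 \<mu>)"
      using w by (simp add: has_bochner_integral_iff)
    fix \<mu> :: real
      show "norm (\<Phi> \<mu>) \<le> D1 * w1 \<mu> + D2 * w2 \<mu>"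
      proof (cases "0 < \<mu>")
        case True
        have "\<Phi> \<mu> = complex_of_real (\<mu> powr (- \<theta>)) * (\<Sum>i\<in>I. b i / complex_of_real (\<mu> + A i))"
          using True by (simp add: \<Phi>_def resolvent_integrand_def sum_distrib_left mult_ac)
        then have \<Phi>: "norm (\<Phi> \<mu>) = \<mu> powr (- \<theta>) * norm (\<Sum>i\<in>I. b i / complex_of_real (\<mu> + A i))"
          by (simp add: norm_mult)
        show ?thesis
        proof (cases "\<mu> \<le> M")
          case le: True
          have "norm (\<Phi> \<mu>) \<le> \<mu> powr (- \<theta>) * D1"
            unfolding \<Phi> by (intro mult_left_mono assms(6) True) simp
          also have "\<dots> \<le> D1 * w1 \<mu> + D2 * w2 \<mu>"
            using le True D by (simp add: w1_def w2_def)
          finally show ?thesis .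
        next
          case False
          have "norm (\<Phi> \<mu>) \<le> \<mu> powr (- \<theta>) * (D2 * \<mu> powr (- 1 / 2))"
            unfolding \<Phi> by (intro mult_left_mono assms(7) True) simp
          also have "\<dots> = D2 * \<mu> powr (- (\<theta> + 1 / 2))"
            using True by (simp flip: powr_add)
          finally show ?thesis
            using False by (simp add: w1_def w2_def)
        qed
      qed (use assms(3) in \<open>simp add: \<Phi>_def resolvent_integrand_def w1_def w2_def indicator_def\<close>)
  qed
  also have "\<dots> = D1 * (M powr (1 - \<theta>) / (1 - \<theta>)) + D2 * (M powr (1 / 2 - \<theta>) / (\<theta> - 1 / 2))"
    using w by (simp add: has_bochner_integral_iff)
  finally show ?thesis
    using \<open>0 < resolvent_const \<theta>\<close> by (simp add: le_divide_eq)
qed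

section \<open>The fractional pairing bound\<close>

text \<open>The symbol is 1 - \<rho>^2 / (\<rho>^2 + k^2), and \<rho>^2 + k^2 = -(\<rho> - i
  k)(-\<rho> - i k): the second order resolvent is the product of the first order ones with
  parameters \<rho> and -\<rho>.\<close>

lemma resolvent_multiplier:
  assumes "0 \<le> \<mu>"
  defines "\<rho> \<equiv> sqrt (\<mu> + 1)"
  shows "of_int k ^ 2 / complex_of_real (\<mu> + (1 + (real_of_int k)\<^sup>2)) * c
    = c - complex_of_real \<rho> / (complex_of_real \<rho> - \<i> * of_int k)
        * (complex_of_real (- \<rho>) / (complex_of_real (- \<rho>) - \<i> * of_int k) * c)"
proof -
  define x where "x = complex_of_real (\<mu> + (1 + (real_of_int k)\<^sup>2))"
  have "\<rho> > 0" and l2: "\<rho>\<^sup>2 = \<mu> + 1" using assms(1) by (simp_all add: \<rho>_def)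
  have nz: "complex_of_real \<rho> - \<i> * of_int k \<noteq> 0" "complex_of_real (- \<rho>) - \<i> * of_int k \<noteq> 0" "x \<noteq> 0"
  proof -
    have "0 < \<mu> + (1 + (real_of_int k)\<^sup>2)" using assms(1) by (simp add: add_nonneg_pos add_pos_nonneg)
    then show "x \<noteq> 0" unfolding x_def of_real_eq_0_iff by simp
  qed (use \<open>\<rho> > 0\<close> in \<open>simp_all add: complex_eq_iff\<close>)
  have prod: "(complex_of_real \<rho> - \<i> * of_int k) * (complex_of_real (- \<rho>) - \<i> * of_int k) = - x"
  proof -
    have "x = complex_of_real \<rho> ^ 2 + of_int k ^ 2"
      unfolding of_real_power[symmetric] l2 by (simp add: x_def)
    then show ?thesis by (simp add: algebra_simps power2_eq_square)
  qed
  have "complex_of_real \<rho> / (complex_of_real \<rho> - \<i> * of_int k)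
        * (complex_of_real (- \<rho>) / (complex_of_real (- \<rho>) - \<i> * of_int k) * c)
      = (complex_of_real \<rho> * complex_of_real (- \<rho>)) / (- x) * c"
    unfolding prod[symmetric] by simp
  also have "\<dots> = complex_of_real (\<mu> + 1) / x * c"
    by (simp add: l2[symmetric] power2_eq_square)
  also have "c - \<dots> = (x - complex_of_real (\<mu> + 1)) / x * c"
    using nz by (simp add: diff_divide_distrib left_diff_distrib)
  also have "x - complex_of_real (\<mu> + 1) = of_int k ^ 2"
    by (simp add: x_def)
  finally show ?thesis by (simp add: x_def)
qed

text \<open>With x = k^2 the comparison of coefficients amounts to \<mu> x \<le> (\<mu> + 1 + x)^2;
  Parseval transfers it to the norms.\<close>

lemma L2_norm_resolvent_le:
  assumes "0 < \<mu>" "finite K"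
  shows "L2_norm circle_measure (\<lambda>t. norm (trig_poly K (\<lambda>k. of_int k ^ 2 / complex_of_real (\<mu> + (1 + (real_of_int k)\<^sup>2)) * c k) t))
    \<le> \<mu> powr (- 1 / 2) * L2_norm circle_measure (\<lambda>t. norm (trig_poly K (trig_deriv_coeff c) t))"
proof (rule power2_le_imp_le)
  have "(norm (of_int k ^ 2 / complex_of_real (\<mu> + (1 + (real_of_int k)\<^sup>2)) * c k))\<^sup>2 \<le> 1 / \<mu> * (norm (trig_deriv_coeff c k))\<^sup>2" for k
  proof -
    define x where "x = (real_of_int k)\<^sup>2"
    have "0 \<le> x" by (simp add: x_def)
    have "\<mu> * x\<^sup>2 \<le> x * (\<mu> + (1 + x))\<^sup>2"
    proof -
      have "x * (\<mu> * x) \<le> x * (\<mu> + (1 + x))\<^sup>2"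
      proof (rule mult_left_mono[OF _ \<open>0 \<le> x\<close>])
        have "\<mu> * x \<le> (\<mu> + (1 + x)) * (\<mu> + (1 + x))"
          using \<open>0 \<le> x\<close> assms(1) by (intro mult_mono) auto
        then show "\<mu> * x \<le> (\<mu> + (1 + x))\<^sup>2" by (simp add: power2_eq_square)
      qed
      then show ?thesis by (simp add: power2_eq_square mult_ac)
    qed
    then have "x\<^sup>2 / (\<mu> + (1 + x))\<^sup>2 \<le> x / \<mu>"
      using assms(1) \<open>0 \<le> x\<close> by (subst frac_le_eq) (auto simp: divide_le_0_iff mult_ac add_pos_nonneg)
    then have "x\<^sup>2 / (\<mu> + (1 + x))\<^sup>2 * (norm (c k))\<^sup>2 \<le> x / \<mu> * (norm (c k))\<^sup>2"
      by (rule mult_right_mono) simp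
    moreover have "norm (of_int k ^ 2 / complex_of_real (\<mu> + (1 + (real_of_int k)\<^sup>2))) = x / (\<mu> + (1 + x))"
      using \<open>0 \<le> x\<close> assms(1) unfolding norm_divide norm_of_real x_def by (simp add: norm_power)
    then have "(norm (of_int k ^ 2 / complex_of_real (\<mu> + (1 + (real_of_int k)\<^sup>2)) * c k))\<^sup>2
        = x\<^sup>2 / (\<mu> + (1 + x))\<^sup>2 * (norm (c k))\<^sup>2"
      by (simp only: norm_mult power_mult_distrib power_divide)
    moreover have "(norm (trig_deriv_coeff c k))\<^sup>2 = x * (norm (c k))\<^sup>2"
      by (simp add: norm_mult power_mult_distrib x_def)
    ultimately show ?thesis by simp
  qed
  then have "2 * pi * (\<Sum>k\<in>K. (norm (of_int k ^ 2 / complex_of_real (\<mu> + (1 + (real_of_int k)\<^sup>2)) * c k))\<^sup>2)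
      \<le> 2 * pi * (\<Sum>k\<in>K. 1 / \<mu> * (norm (trig_deriv_coeff c k))\<^sup>2)"
    by (intro mult_left_mono sum_mono) auto
  moreover have "(\<mu> powr (- 1 / 2))\<^sup>2 = 1 / \<mu>"
  proof -
    have "(\<mu> powr (- 1 / 2))\<^sup>2 = \<mu> powr (- 1 / 2 + - 1 / 2)"
      by (simp only: power2_eq_square powr_add)
    also have "\<dots> = 1 / \<mu>" using assms(1) by (simp add: powr_minus_divide)
    finally show ?thesis .
  qed
  ultimately show "(L2_norm circle_measure (\<lambda>t. norm (trig_poly K (\<lambda>k. of_int k ^ 2 / complex_of_real (\<mu> + (1 + (real_of_int k)\<^sup>2)) * c k) t)))\<^sup>2
     \<le> (\<mu> powr (- 1 / 2) * L2_norm circle_measure (\<lambda>t. norm (trig_poly K (trig_deriv_coeff c) t)))\<^sup>2"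
    by (simp only: power_mult_distrib L2_norm_trig_poly[OF assms(2)] sum_distrib_left[symmetric] mult.left_commute)
qed simp

lemma trig_poly_diff: "trig_poly K (\<lambda>k. c k - d k) t = trig_poly K c t - trig_poly K d t"
  by (simp add: trig_poly_def left_diff_distrib sum_subtractf)

text \<open>z is the polynomial minus two successive averages of it. Each average contracts both
  norms, whence the factor 2. The case \<mu> = 0 is included for the sake of s = 2.\<close>

lemma resolvent_diff_bounds:
  fixes \<mu> B :: real
  assumes "0 \<le> \<mu>" "\<And>t. norm (trig_poly K c t) \<le> B"
  defines "z \<equiv> trig_poly K (\<lambda>k. of_int k ^ 2 / complex_of_real (\<mu> + (1 + (real_of_int k)\<^sup>2)) * c k)"
  shows "norm (z t) \<le> 2 * B"
    and "(LINT t|circle_measure. norm (z t)) \<le> 2 * (LINT t|circle_measure. norm (trig_poly K c t))"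
proof -
  define \<rho> where "\<rho> = sqrt (\<mu> + 1)"
  have l: "\<rho> \<noteq> 0" "- \<rho> \<noteq> 0" using assms(1) by (simp_all add: \<rho>_def)
  define d where "d k = complex_of_real (- \<rho>) / (complex_of_real (- \<rho>) - \<i> * of_int k) * c k" for k
  define w where "w = trig_poly K (\<lambda>k. complex_of_real \<rho> / (complex_of_real \<rho> - \<i> * of_int k) * d k)"
  have z: "z t = trig_poly K c t - w t" for t
    unfolding z_def w_def d_def resolvent_multiplier[OF assms(1)] \<rho>_def[symmetric] trig_poly_diff ..
  have "norm (w t) \<le> B"
    unfolding w_def d_def by (intro sup_trig_poly_resolvent l assms(2))
  then show "norm (z t) \<le> 2 * B"
    using norm_triangle_ineq4[of "trig_poly K c t" "w t"] assms(2)[of t] by (simp add: z)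
  have "(LINT t|circle_measure. norm (w t)) \<le> (LINT t|circle_measure. norm (trig_poly K d t))"
    unfolding w_def by (rule L1_trig_poly_resolvent[OF l(1)])
  also have "\<dots> \<le> (LINT t|circle_measure. norm (trig_poly K c t))"
    unfolding d_def by (rule L1_trig_poly_resolvent[OF l(2)])
  finally have w: "(LINT t|circle_measure. norm (w t)) \<le> (LINT t|circle_measure. norm (trig_poly K c t))" .
  have "(LINT t|circle_measure. norm (z t)) \<le> (LINT t|circle_measure. norm (trig_poly K c t) + norm (w t))"
  proof (rule integral_mono)
    show "integrable circle_measure (\<lambda>t. norm (z t))"
      unfolding z_def by (intro integrable_circle_continuous continuous_intros)
    show "integrable circle_measure (\<lambda>t. norm (trig_poly K c t) + norm (w t))"
      unfolding w_def by (intro integrable_circle_continuous continuous_intros)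
  qed (simp add: z norm_triangle_ineq4)
  also have "\<dots> = (LINT t|circle_measure. norm (trig_poly K c t)) + (LINT t|circle_measure. norm (w t))"
    unfolding w_def by (intro Bochner_Integration.integral_add integrable_circle_continuous continuous_intros)
  finally show "(LINT t|circle_measure. norm (z t)) \<le> 2 * (LINT t|circle_measure. norm (trig_poly K c t))"
    using w by simp
qed

text \<open>In its use the sum is the pairing of the derivatives of \<open>\<gamma>\<^sub>0\<close>
  and h: two derivatives contribute k^2, and the negative power converts the coefficients of g into
  those of \<open>\<gamma>\<^sub>0\<close>. With that power replaced by the resolvent at \<mu>, the
  sum is the pairing of g with z; small \<mu> are treated by the L^q bound, large \<mu> by
  Cauchy-Schwarz with g in L^2.\<close>

lemma fractional_pairing_bound:
  fixes g :: "real \<Rightarrow> complex" and s q' :: real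
  assumes g: "g \<in> Lp q circle_measure" "2 \<le> q" "1 / q + 1 / ennreal q' = 1" and s: "1 < s" "s \<le> 2"
  defines "\<kappa> \<equiv> (s - 1) / q'"
  obtains C where "0 \<le> C"
    "\<And>K c \<delta>. finite K \<Longrightarrow> 0 < \<delta> \<Longrightarrow> \<delta> \<le> 1 \<Longrightarrow>
       norm (\<Sum>k\<in>K. of_int k ^ 2 * c k * (LINT t|circle_measure. g t * fchar k t)
           * complex_of_real ((1 + (real_of_int k)\<^sup>2) powr (- (s / 2))))
       \<le> C * (\<delta> powr \<kappa> * L2_norm circle_measure (\<lambda>t. norm (trig_poly K (trig_deriv_coeff c) t))
            + \<delta> powr (\<kappa> - 1) * (LINT t|circle_measure. norm (trig_poly K c t)))"
proof -
  obtain C1 where C1: "0 \<le> C1"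
    "\<And>\<delta> f B. 0 < \<delta> \<Longrightarrow> f \<in> borel_measurable circle_measure \<Longrightarrow> (\<And>x. x \<in> space circle_measure \<Longrightarrow> norm (f x) \<le> B) \<Longrightarrow> 0 \<le> B \<Longrightarrow>
       norm (LINT x|circle_measure. g x * f x) \<le> C1 * (\<delta> powr (1 / q') * B + \<delta> powr (1 / q' - 1) * (LINT x|circle_measure. norm (f x)))"
    by (rule circle.Lp_pairing_bound[OF g]) (rule that; blast)
  have g2: "g \<in> Lp 2 circle_measure" by (rule circle.Lp_imp_Lp_2[OF g(1,2)])
  define p where "p = 1 / q'"
  define R where "R = 1 / (1 - exp (- (2 * pi)))"
  define C2 where "C2 = R + R * sqrt (2 * pi) + 1"
  define N where "N = L2_norm circle_measure (\<lambda>t. norm (g t))"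
  define \<theta> where "\<theta> = s / 2"
  have "0 \<le> R" by (simp add: R_def)
  then have "0 \<le> C2" by (simp add: C2_def)
  have \<kappa>: "\<kappa> = p * (s - 1)" by (simp add: \<kappa>_def p_def)
  define C where "C = (if s = 2 then 2 * C1 * C2
    else (2 * C1 * C2 / (1 - \<theta>) + N / (\<theta> - 1 / 2)) / resolvent_const \<theta>)"
  show thesis
  proof (rule that[of C])
    have "0 \<le> C" if "s \<noteq> 2"
      using that s C1(1) \<open>0 \<le> C2\<close> resolvent_const_pos[of \<theta>]
      by (auto simp: C_def \<theta>_def N_def intro!: divide_nonneg_pos add_nonneg_nonneg mult_nonneg_nonneg)
    then show "0 \<le> C" using C1(1) \<open>0 \<le> C2\<close> by (cases "s = 2") (auto simp: C_def)
    fix K :: "int set" and c :: "int \<Rightarrow> complex" and \<delta> :: real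
    assume K: "finite K" and \<delta>: "0 < \<delta>" "\<delta> \<le> 1"
    define X where "X = L2_norm circle_measure (\<lambda>t. norm (trig_poly K (trig_deriv_coeff c) t))"
    define Y where "Y = (LINT t|circle_measure. norm (trig_poly K c t))"
    define B where "B = R * (Y + sqrt (2 * pi) * X)"
    have "0 \<le> X" "0 \<le> Y" by (simp_all add: X_def Y_def)
    have sup: "norm (trig_poly K c t) \<le> B" for t
    proof -
      have "norm (trig_poly K c t) \<le> R * (Y + (LINT s|circle_measure. norm (trig_poly K (trig_deriv_coeff c) s)))"
        unfolding R_def Y_def by (rule sup_trig_poly_le)
      also have "\<dots> \<le> B"
        unfolding B_def X_def by (intro mult_left_mono add_left_mono LINT_circle_le_L2_norm Lp_2_trig_poly \<open>0 \<le> R\<close>)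
      finally show ?thesis .
    qed
    then have "0 \<le> B" using norm_ge_zero order_trans by blast
    \<comment> \<open>The supremum bound B brings in an extra term \<delta>^\<kappa> Y, harmless
      because \<delta>^\<kappa> \<le> \<delta>^(\<kappa> - 1) for \<delta> \<le> 1.\<close>
    have BY: "\<delta> powr \<kappa> * B + \<delta> powr (\<kappa> - 1) * Y \<le> C2 * (\<delta> powr \<kappa> * X + \<delta> powr (\<kappa> - 1) * Y)"
    proof -
      have "\<delta> powr \<kappa> \<le> \<delta> powr (\<kappa> - 1)" using \<delta> by (intro powr_mono') auto
      then have "R * (\<delta> powr \<kappa> * Y) \<le> R * (\<delta> powr (\<kappa> - 1) * Y)"
        using \<open>0 \<le> R\<close> \<open>0 \<le> Y\<close> by (intro mult_left_mono mult_right_mono)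
      moreover have "0 \<le> (R + 1) * (\<delta> powr \<kappa> * X)" "0 \<le> R * sqrt (2 * pi) * (\<delta> powr (\<kappa> - 1) * Y)"
        using \<open>0 \<le> R\<close> \<open>0 \<le> X\<close> \<open>0 \<le> Y\<close> by simp_all
      moreover have "C2 * (\<delta> powr \<kappa> * X + \<delta> powr (\<kappa> - 1) * Y) - (\<delta> powr \<kappa> * B + \<delta> powr (\<kappa> - 1) * Y)
          = (R + 1) * (\<delta> powr \<kappa> * X) + R * sqrt (2 * pi) * (\<delta> powr (\<kappa> - 1) * Y)
            + (R * (\<delta> powr (\<kappa> - 1) * Y) - R * (\<delta> powr \<kappa> * Y))"
        by (simp add: C2_def B_def algebra_simps)
      ultimately show ?thesis by linarith
    qed
    define b where "b k = of_int k ^ 2 * c k * (LINT t|circle_measure. g t * fchar k t)" for k :: int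
    define z where "z \<mu> = trig_poly K (\<lambda>k. of_int k ^ 2 / complex_of_real (\<mu> + (1 + (real_of_int k)\<^sup>2)) * c k)" for \<mu>
    have \<Phi>: "(\<Sum>k\<in>K. b k / complex_of_real (\<mu> + (1 + (real_of_int k)\<^sup>2))) = (LINT t|circle_measure. g t * z \<mu> t)" for \<mu>
      unfolding z_def LINT_mult_trig_poly[OF g2] b_def by (intro sum.cong) (simp_all add: mult_ac)
    have D1: "norm (\<Sum>k\<in>K. b k / complex_of_real (\<mu> + (1 + (real_of_int k)\<^sup>2))) \<le> 2 * C1 * (\<delta> powr p * B + \<delta> powr (p - 1) * Y)"
      if "0 \<le> \<mu>" for \<mu>
    proof -
      have "norm (LINT t|circle_measure. g t * z \<mu> t)
          \<le> C1 * (\<delta> powr p * (2 * B) + \<delta> powr (p - 1) * (LINT t|circle_measure. norm (z \<mu> t)))"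
        unfolding p_def using \<open>0 \<le> B\<close> resolvent_diff_bounds(1)[OF that sup]
        by (intro C1(2) \<delta> borel_measurable_circle borel_measurable_continuous_onI)
           (auto simp: z_def intro!: continuous_intros)
      also have "\<dots> \<le> C1 * (\<delta> powr p * (2 * B) + \<delta> powr (p - 1) * (2 * Y))"
        using resolvent_diff_bounds(2)[OF that sup] C1(1) unfolding z_def Y_def
        by (intro mult_left_mono add_left_mono) auto
      finally show ?thesis unfolding \<Phi> by (simp add: algebra_simps)
    qed
    have "norm (\<Sum>k\<in>K. b k * complex_of_real ((1 + (real_of_int k)\<^sup>2) powr (- (s / 2))))
        \<le> C * (\<delta> powr \<kappa> * X + \<delta> powr (\<kappa> - 1) * Y)"
    proof (cases "s = 2")
      \<comment> \<open>For s = 2 the weight is the resolvent at \<mu> = 0, and \<kappa> = p, so the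
        bound D1 suffices without any integral.\<close>
      case True
      have "(\<Sum>k\<in>K. b k * complex_of_real ((1 + (real_of_int k)\<^sup>2) powr (- (s / 2))))
          = (\<Sum>k\<in>K. b k / complex_of_real (0 + (1 + (real_of_int k)\<^sup>2)))"
        using True by (intro sum.cong refl) (simp add: powr_minus_divide add_nonneg_nonneg del: of_real_add)
      then have "norm (\<Sum>k\<in>K. b k * complex_of_real ((1 + (real_of_int k)\<^sup>2) powr (- (s / 2))))
          \<le> 2 * C1 * (\<delta> powr p * B + \<delta> powr (p - 1) * Y)"
        using D1[of 0] by simp
      also have "\<dots> = 2 * C1 * (\<delta> powr \<kappa> * B + \<delta> powr (\<kappa> - 1) * Y)"
        using True by (simp add: \<kappa>)
      also have "\<dots> \<le> 2 * C1 * (C2 * (\<delta> powr \<kappa> * X + \<delta> powr (\<kappa> - 1) * Y))"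
        using C1(1) by (intro mult_left_mono BY) auto
      finally show ?thesis using True by (simp add: C_def mult.assoc)
    next
      case False
      then have \<theta>: "1 / 2 < \<theta>" "\<theta> < 1" using s by (auto simp: \<theta>_def)
      define M where "M = \<delta> powr (- 2 * p)"
      have "0 < M" using \<delta> by (simp add: M_def)
      have M1: "M powr (1 - \<theta>) = \<delta> powr (- p * (2 - s))" and M2: "M powr (1 / 2 - \<theta>) = \<delta> powr \<kappa>"
        by (simp_all add: M_def powr_powr \<theta>_def \<kappa> algebra_simps)
      have D2: "norm (\<Sum>k\<in>K. b k / complex_of_real (\<mu> + (1 + (real_of_int k)\<^sup>2))) \<le> (N * X) * \<mu> powr (- 1 / 2)"
        if "0 < \<mu>" for \<mu>
      proof -
        have "norm (LINT t|circle_measure. g t * z \<mu> t) \<le> N * L2_norm circle_measure (\<lambda>t. norm (z \<mu> t))"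
          unfolding N_def by (rule norm_LINT_mult_le_L2_norm[OF g2]) (simp add: z_def Lp_2_trig_poly)
        also have "\<dots> \<le> N * (\<mu> powr (- 1 / 2) * X)"
          unfolding z_def X_def by (intro mult_left_mono L2_norm_resolvent_le that K) (simp add: N_def)
        finally show ?thesis unfolding \<Phi> by (simp add: mult_ac)
      qed
      define Z where "Z = \<delta> powr \<kappa> * X + \<delta> powr (\<kappa> - 1) * Y"
      have low: "2 * C1 * (\<delta> powr p * B + \<delta> powr (p - 1) * Y) * (M powr (1 - \<theta>) / (1 - \<theta>))
          \<le> 2 * C1 * C2 / (1 - \<theta>) * Z"
      proof -
        have *: "\<delta> powr p * M powr (1 - \<theta>) = \<delta> powr \<kappa>" "\<delta> powr (p - 1) * M powr (1 - \<theta>) = \<delta> powr (\<kappa> - 1)"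
          unfolding M1 powr_add[symmetric] by (simp_all add: \<kappa> algebra_simps)
        have "2 * C1 * (\<delta> powr p * B + \<delta> powr (p - 1) * Y) * (M powr (1 - \<theta>) / (1 - \<theta>))
            = 2 * C1 * ((\<delta> powr p * M powr (1 - \<theta>)) * B + (\<delta> powr (p - 1) * M powr (1 - \<theta>)) * Y) / (1 - \<theta>)"
          by (simp add: algebra_simps add_divide_distrib)
        also have "\<dots> \<le> 2 * C1 * (C2 * Z) / (1 - \<theta>)"
          unfolding * Z_def using C1(1) \<theta> by (intro divide_right_mono mult_left_mono BY) auto
        finally show ?thesis by (simp add: mult.assoc)
      qed
      have high: "N * X * (M powr (1 / 2 - \<theta>) / (\<theta> - 1 / 2)) \<le> N / (\<theta> - 1 / 2) * Z"
      proof -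
        have "N * X * (M powr (1 / 2 - \<theta>) / (\<theta> - 1 / 2)) = N / (\<theta> - 1 / 2) * (\<delta> powr \<kappa> * X)"
          unfolding M2 by simp
        also have "\<dots> \<le> N / (\<theta> - 1 / 2) * Z"
          unfolding Z_def using \<theta> \<open>0 \<le> Y\<close> by (intro mult_left_mono) (auto simp: N_def)
        finally show ?thesis .
      qed
      have "norm (\<Sum>k\<in>K. b k * complex_of_real ((1 + (real_of_int k)\<^sup>2) powr (- \<theta>)))
          \<le> (2 * C1 * (\<delta> powr p * B + \<delta> powr (p - 1) * Y) * (M powr (1 - \<theta>) / (1 - \<theta>))
              + N * X * (M powr (1 / 2 - \<theta>) / (\<theta> - 1 / 2))) / resolvent_const \<theta>"
        using D1 D2 by (intro sum_powr_resolvent_bound \<theta> \<open>0 < M\<close> K) (auto simp: add_pos_nonneg)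
      also have "\<dots> \<le> (2 * C1 * C2 / (1 - \<theta>) * Z + N / (\<theta> - 1 / 2) * Z) / resolvent_const \<theta>"
        using resolvent_const_pos[of \<theta>] \<theta> by (intro divide_right_mono add_mono low high) simp
      also have "\<dots> = C * Z"
        using False by (simp add: C_def distrib_right)
      finally show ?thesis unfolding Z_def \<theta>_def .
    qed
    then show "norm (\<Sum>k\<in>K. of_int k ^ 2 * c k * (LINT t|circle_measure. g t * fchar k t)
           * complex_of_real ((1 + (real_of_int k)\<^sup>2) powr (- (s / 2))))
       \<le> C * (\<delta> powr \<kappa> * L2_norm circle_measure (\<lambda>t. norm (trig_poly K (trig_deriv_coeff c) t))
            + \<delta> powr (\<kappa> - 1) * (LINT t|circle_measure. norm (trig_poly K c t)))"
      by (simp add: b_def X_def Y_def)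
  qed
qed

section \<open>The variational source condition\<close>

text \<open>For a trigonometric polynomial the pairing is the finite sum of the fractional bound.
  Density in H^1 extends the estimate, since for fixed \<delta> both sides are continuous in the L^2
  norms of f and d.\<close>

lemma source_estimate:
  fixes s q' :: real
  assumes "\<gamma> \<in> H1" "distribution_of (\<lambda>t. complex_of_real (\<gamma> t)) \<in> fractional_sobolev s q"
    and "1 < s" "s \<le> 2" "2 \<le> q" "1 / q + 1 / ennreal q' = 1"
  defines "\<kappa> \<equiv> (s - 1) / q'"
  obtains C where "0 \<le> C"
    "\<And>f d \<delta>. f \<in> Lp 2 circle_measure \<Longrightarrow> d \<in> Lp 2 circle_measure \<Longrightarrow> is_weak_deriv f d \<Longrightarrow> 0 < \<delta> \<Longrightarrow> \<delta> \<le> 1 \<Longrightarrow>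
      \<bar>LINT t|circle_measure. weak_deriv \<gamma> t * d t\<bar>
      \<le> C * (\<delta> powr \<kappa> * L2_norm circle_measure d + \<delta> powr (\<kappa> - 1) * (LINT t|circle_measure. \<bar>f t\<bar>))"
proof -
  note \<gamma> = H1_D[OF assms(1)]
  from assms(2) obtain g where g: "g \<in> Lp q circle_measure"
    and coeff: "\<And>k. fourier_coeff (distribution_of g) k
      = complex_of_real ((1 + (real_of_int k)\<^sup>2) powr (s / 2)) * fourier_coeff (distribution_of (\<lambda>t. complex_of_real (\<gamma> t))) k"
    by (auto simp: fractional_sobolev_def)
  obtain C where C: "0 \<le> C"
    "\<And>K c \<delta>. finite K \<Longrightarrow> 0 < \<delta> \<Longrightarrow> \<delta> \<le> 1 \<Longrightarrow>
       norm (\<Sum>k\<in>K. of_int k ^ 2 * c k * (LINT t|circle_measure. g t * fchar k t)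
           * complex_of_real ((1 + (real_of_int k)\<^sup>2) powr (- (s / 2))))
       \<le> C * (\<delta> powr \<kappa> * L2_norm circle_measure (\<lambda>t. norm (trig_poly K (trig_deriv_coeff c) t))
            + \<delta> powr (\<kappa> - 1) * (LINT t|circle_measure. norm (trig_poly K c t)))"
    unfolding \<kappa>_def by (rule fractional_pairing_bound[OF g assms(5,6,3,4)]) (rule that[unfolded \<kappa>_def]; blast)
  define \<gamma>' where "\<gamma>' = (\<lambda>t. complex_of_real (weak_deriv \<gamma> t))"
  have \<gamma>': "\<gamma>' \<in> Lp 2 circle_measure" unfolding \<gamma>'_def by (intro Lp_2_of_real \<gamma>)
  have coeff': "(LINT t|circle_measure. complex_of_real (\<gamma> t) * fchar k t)
      = (LINT t|circle_measure. g t * fchar k t) * complex_of_real ((1 + (real_of_int k)\<^sup>2) powr (- (s / 2)))" for k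
  proof -
    have "(1 + (real_of_int k)\<^sup>2) powr (s / 2) \<noteq> 0"
      using add_pos_nonneg[OF zero_less_one zero_le_power2[of "real_of_int k"]] by simp
    then show ?thesis
      \<comment> \<open>\<open>fourier_coeff\<close> integrates against the conjugate character, so
        the integral against \<open>fchar k\<close> belongs to the coefficient at -k; the weight is
        even in k.\<close>
      using coeff[of "- k"]
      by (simp add: fourier_coeff_def distribution_of_def powr_minus_divide field_simps)
  qed
  have trig: "norm (LINT t|circle_measure. \<gamma>' t * trig_poly K (trig_deriv_coeff c) t)
       \<le> C * (\<delta> powr \<kappa> * L2_norm circle_measure (\<lambda>t. norm (trig_poly K (trig_deriv_coeff c) t))
            + \<delta> powr (\<kappa> - 1) * (LINT t|circle_measure. norm (trig_poly K c t)))"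
    if "finite K" "0 < \<delta>" "\<delta> \<le> 1" for K c \<delta>
  proof -
    have "(LINT t|circle_measure. \<gamma>' t * trig_poly K (trig_deriv_coeff c) t)
        = (\<Sum>k\<in>K. of_int k ^ 2 * c k * (LINT t|circle_measure. g t * fchar k t)
           * complex_of_real ((1 + (real_of_int k)\<^sup>2) powr (- (s / 2))))"
      unfolding LINT_mult_trig_poly[OF \<gamma>']
    proof (rule sum.cong[OF refl])
      fix k
      have "(LINT t|circle_measure. \<gamma>' t * fchar k t) = - (\<i> * of_int k * (LINT t|circle_measure. complex_of_real (\<gamma> t) * fchar k t))"
        unfolding \<gamma>'_def is_weak_deriv_fchar[OF \<gamma>(5,3,4)] by simp
      then show "trig_deriv_coeff c k * (LINT t|circle_measure. \<gamma>' t * fchar k t)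
          = of_int k ^ 2 * c k * (LINT t|circle_measure. g t * fchar k t)
           * complex_of_real ((1 + (real_of_int k)\<^sup>2) powr (- (s / 2)))"
        \<comment> \<open>The sign of i^2 cancels the one from integration by parts, leaving
          k^2.\<close>
        unfolding coeff' power2_eq_square using i_squared by algebra
    qed
    with C(2)[OF that, of c] show ?thesis by simp
  qed
  show thesis
  proof (rule that[OF C(1)])
    fix f d :: "real \<Rightarrow> real" and \<delta> :: real
    assume f: "f \<in> Lp 2 circle_measure" and d: "d \<in> Lp 2 circle_measure" and fd: "is_weak_deriv f d"
      and \<delta>: "0 < \<delta>" "\<delta> \<le> 1"
    define N where "N = L2_norm circle_measure (\<lambda>t. norm (\<gamma>' t))"
    \<comment> \<open>The total factor with which an \<epsilon>-error in f and d enters the final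
      bound.\<close>
    define E where "E = N + C * (\<delta> powr \<kappa> + \<delta> powr (\<kappa> - 1) * sqrt (2 * pi))"
    have "0 \<le> N" by (simp add: N_def)
    then have "0 \<le> E" using C(1) by (simp add: E_def)
    have f': "(\<lambda>t. complex_of_real (f t)) \<in> Lp 2 circle_measure" and d': "(\<lambda>t. complex_of_real (d t)) \<in> Lp 2 circle_measure"
      using f d by (simp_all add: Lp_2_of_real)
    show "\<bar>LINT t|circle_measure. weak_deriv \<gamma> t * d t\<bar>
      \<le> C * (\<delta> powr \<kappa> * L2_norm circle_measure d + \<delta> powr (\<kappa> - 1) * (LINT t|circle_measure. \<bar>f t\<bar>))"
    proof (rule field_le_epsilon)
      fix e :: real assume "0 < e"
      define \<epsilon> where "\<epsilon> = e / (E + 1)"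
      have "0 < \<epsilon>" using \<open>0 < e\<close> \<open>0 \<le> E\<close> by (simp add: \<epsilon>_def)
      obtain K c where K: "finite K"
        "L2_norm circle_measure (\<lambda>t. norm (complex_of_real (f t) - trig_poly K c t)) < \<epsilon>"
        "L2_norm circle_measure (\<lambda>t. norm (complex_of_real (d t) - trig_poly K (trig_deriv_coeff c) t)) < \<epsilon>"
        by (rule H1_trig_poly_dense[OF f d fd \<open>0 < \<epsilon>\<close>]) (rule that)
      define T where "T = trig_poly K c"
      define T' where "T' = trig_poly K (trig_deriv_coeff c)"
      have T: "T \<in> Lp 2 circle_measure" "T' \<in> Lp 2 circle_measure"
        by (simp_all add: T_def T'_def Lp_2_trig_poly)
      note fT = Lp_2_diff[OF f' T(1)] and dT = Lp_2_diff[OF d' T(2)]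
      have T'_le: "L2_norm circle_measure (\<lambda>t. norm (T' t)) \<le> L2_norm circle_measure d + \<epsilon>"
      proof -
        have "(\<lambda>t. 0 :: complex) \<in> Lp 2 circle_measure" by (simp add: Lp_2_iff)
        from L2_norm_triangle_diff[OF T(2) d' this] K(3) show ?thesis
          unfolding T'_def[symmetric] by (simp add: L2_norm_minus_commute[of _ T'])
      qed
      have T_le: "(LINT t|circle_measure. norm (T t)) \<le> (LINT t|circle_measure. \<bar>f t\<bar>) + sqrt (2 * pi) * \<epsilon>"
      proof -
        have root: "0 \<le> sqrt (2 * pi)" by simp
        have int: "integrable circle_measure T" "integrable circle_measure (\<lambda>t. complex_of_real (f t) - T t)"
          "integrable circle_measure f"
          by (intro integrable_circle_Lp_2 T fT f)+
        have "(LINT t|circle_measure. norm (T t)) \<le> (LINT t|circle_measure. \<bar>f t\<bar> + norm (complex_of_real (f t) - T t))"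
        proof (rule integral_mono)
          show "integrable circle_measure (\<lambda>t. \<bar>f t\<bar> + norm (complex_of_real (f t) - T t))"
            using int by simp
          show "norm (T t) \<le> \<bar>f t\<bar> + norm (complex_of_real (f t) - T t)" for t
            using norm_triangle_ineq4[of "complex_of_real (f t)" "complex_of_real (f t) - T t"] by simp
        qed (use int in simp)
        also have "\<dots> = (LINT t|circle_measure. \<bar>f t\<bar>) + (LINT t|circle_measure. norm (complex_of_real (f t) - T t))"
          using int by (intro Bochner_Integration.integral_add) auto
        also have "(LINT t|circle_measure. norm (complex_of_real (f t) - T t)) \<le> sqrt (2 * pi) * \<epsilon>"
          using LINT_circle_le_L2_norm[OF fT] mult_left_mono[OF less_imp_le[OF K(2)] root]
          unfolding T_def by linarith
        finally show ?thesis by simp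
      qed
      have "\<bar>LINT t|circle_measure. weak_deriv \<gamma> t * d t\<bar> = norm (complex_of_real (LINT t|circle_measure. weak_deriv \<gamma> t * d t))"
        by simp
      also have "complex_of_real (LINT t|circle_measure. weak_deriv \<gamma> t * d t)
          = (LINT t|circle_measure. complex_of_real (weak_deriv \<gamma> t * d t))"
        by (intro integral_of_real[symmetric] integrable_mult_Lp_2 \<gamma> d)
      also have "\<dots> = (LINT t|circle_measure. \<gamma>' t * (complex_of_real (d t) - T' t) + \<gamma>' t * T' t)"
        by (simp add: \<gamma>'_def algebra_simps)
      also have "\<dots> = (LINT t|circle_measure. \<gamma>' t * (complex_of_real (d t) - T' t)) + (LINT t|circle_measure. \<gamma>' t * T' t)"
        by (intro Bochner_Integration.integral_add integrable_mult_Lp_2 \<gamma>' dT T)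
      also have "norm \<dots> \<le> N * \<epsilon> + C * (\<delta> powr \<kappa> * (L2_norm circle_measure d + \<epsilon>)
          + \<delta> powr (\<kappa> - 1) * ((LINT t|circle_measure. \<bar>f t\<bar>) + sqrt (2 * pi) * \<epsilon>))"
      proof (intro order_trans[OF norm_triangle_ineq] add_mono)
        show "norm (LINT t|circle_measure. \<gamma>' t * (complex_of_real (d t) - T' t)) \<le> N * \<epsilon>"
          using norm_LINT_mult_le_L2_norm[OF \<gamma>' dT] mult_left_mono[OF less_imp_le[OF K(3)] \<open>0 \<le> N\<close>]
          unfolding N_def T'_def by linarith
        show "norm (LINT t|circle_measure. \<gamma>' t * T' t) \<le> C * (\<delta> powr \<kappa> * (L2_norm circle_measure d + \<epsilon>)
          + \<delta> powr (\<kappa> - 1) * ((LINT t|circle_measure. \<bar>f t\<bar>) + sqrt (2 * pi) * \<epsilon>))"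
          using trig[OF K(1) \<delta>, of c] T'_le T_le unfolding T'_def[symmetric] T_def[symmetric]
          by (elim order_trans) (intro mult_left_mono add_mono C(1); simp)
      qed
      also have "\<dots> = C * (\<delta> powr \<kappa> * L2_norm circle_measure d + \<delta> powr (\<kappa> - 1) * (LINT t|circle_measure. \<bar>f t\<bar>)) + E * \<epsilon>"
        by (simp add: E_def algebra_simps)
      also have "E * \<epsilon> \<le> e"
        using \<open>0 < e\<close> \<open>0 \<le> E\<close> by (simp add: \<epsilon>_def field_simps)
      finally show "\<bar>LINT t|circle_measure. weak_deriv \<gamma> t * d t\<bar>
        \<le> C * (\<delta> powr \<kappa> * L2_norm circle_measure d + \<delta> powr (\<kappa> - 1) * (LINT t|circle_measure. \<bar>f t\<bar>)) + e"
        by simp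
    qed
  qed
qed

section \<open>Hypographs and the data misfit\<close>

lemma borel_measurable_F:
  assumes "continuous_on UNIV \<gamma>"
  shows "F \<gamma> \<in> borel_measurable cylinder_measure"
proof -
  have "closed (hyp \<gamma>)"
    unfolding hyp_def case_prod_beta
    by (intro closed_Collect_conj closed_Collect_le continuous_intros continuous_on_compose2[OF assms]) auto
  then have [measurable]: "hyp \<gamma> \<in> sets borel" by simp
  have "(\<lambda>z. (fst z, snd z)) \<in> cylinder_measure \<rightarrow>\<^sub>M borel \<Otimes>\<^sub>M borel"
    unfolding cylinder_measure_def circle_measure_def
    by (intro measurable_Pair measurable_compose[OF measurable_fst] measurable_compose[OF measurable_snd]
        measurable_restrict_space1) simp_all
  then have [measurable]: "(\<lambda>z. z) \<in> cylinder_measure \<rightarrow>\<^sub>M borel" by (simp add: borel_prod)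
  have "(\<lambda>z. indicator (hyp \<gamma>) z :: real) \<in> borel_measurable cylinder_measure" by measurable
  then show ?thesis by (simp add: F_def)
qed

text \<open>Tonelli, slice by slice in t. \<open>has_bochner_integral\<close> delivers integrability
  along with the value; a bare \<open>LINT\<close> equation would not exclude the default value 0 of
  a nonintegrable function.\<close>

lemma has_bochner_integral_cylinder:
  assumes [measurable]: "f \<in> borel_measurable cylinder_measure"
    and "\<And>z. 0 \<le> f z" "integrable circle_measure h" "\<And>t. 0 \<le> h t"
    and "\<And>t. t \<in> {0..<2 * pi} \<Longrightarrow> (\<integral>\<^sup>+x. ennreal (f (t, x)) * indicator {0..} x \<partial>lborel) = ennreal (h t)"
  shows "has_bochner_integral cylinder_measure f (LINT t|circle_measure. h t)"
proof (rule has_bochner_integral_nn_integral)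
  interpret half: sigma_finite_measure "restrict_space lborel {0::real..}"
    by (intro sigma_finite_measure_restrict_space lborel.sigma_finite_measure_axioms) simp
  have f: "(\<lambda>z. ennreal (f z)) \<in> borel_measurable (circle_measure \<Otimes>\<^sub>M restrict_space lborel {0..})"
    unfolding cylinder_measure_def[symmetric] by measurable
  have "(\<integral>\<^sup>+z. ennreal (f z) \<partial>cylinder_measure)
      = (\<integral>\<^sup>+t. \<integral>\<^sup>+x. ennreal (f (t, x)) \<partial>restrict_space lborel {0..} \<partial>circle_measure)"
    unfolding cylinder_measure_def by (rule half.nn_integral_fst[symmetric, OF f])
  also have "\<dots> = (\<integral>\<^sup>+t. ennreal (h t) \<partial>circle_measure)"
    using assms(5) by (intro nn_integral_cong) (simp add: nn_integral_restrict_space)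
  also have "\<dots> = ennreal (LINT t|circle_measure. h t)"
    using assms(3,4) by (intro nn_integral_eq_integral) auto
  finally show "(\<integral>\<^sup>+z. ennreal (f z) \<partial>cylinder_measure) = ennreal (LINT t|circle_measure. h t)" .
qed (use assms in auto)

lemma F_Lp_2:
  assumes "continuous_on UNIV \<gamma>" "\<And>t. 0 \<le> \<gamma> t"
  shows "F \<gamma> \<in> Lp 2 cylinder_measure"
proof -
  note [measurable] = borel_measurable_F[OF assms(1)]
  have "has_bochner_integral cylinder_measure (\<lambda>z. (F \<gamma> z)\<^sup>2) (LINT t|circle_measure. \<gamma> t)"
  proof (rule has_bochner_integral_cylinder)
    fix t :: real
    have "(\<integral>\<^sup>+x. ennreal ((F \<gamma> (t, x))\<^sup>2) * indicator {0..} x \<partial>lborel) = (\<integral>\<^sup>+x. indicator {0..\<gamma> t} x \<partial>lborel)"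
      by (intro nn_integral_cong) (auto simp: F_def hyp_def indicator_def)
    also have "\<dots> = ennreal (\<gamma> t)"
      using assms(2)[of t] by simp
    finally show "(\<integral>\<^sup>+x. ennreal ((F \<gamma> (t, x))\<^sup>2) * indicator {0..} x \<partial>lborel) = ennreal (\<gamma> t)" .
  qed (use assms integrable_circle_continuous in auto)
  then show ?thesis by (auto simp: Lp_2_iff has_bochner_integral_iff)
qed

text \<open>On each slice the squared difference is the indicator of the interval between the two
  heights, open at its lower end; its length is the distance of the heights, so a squared L^2 norm
  becomes an L^1 norm.\<close>

lemma L2_norm_F_diff:
  assumes "continuous_on UNIV \<gamma>" "\<And>t. 0 \<le> \<gamma> t" "continuous_on UNIV \<eta>" "\<And>t. 0 \<le> \<eta> t"
  shows "(L2_norm cylinder_measure (\<lambda>z. F \<gamma> z - F \<eta> z))\<^sup>2 = (LINT t|circle_measure. \<bar>\<gamma> t - \<eta> t\<bar>)"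
proof -
  note [measurable] = borel_measurable_F[OF assms(1)] borel_measurable_F[OF assms(3)]
  have "has_bochner_integral cylinder_measure (\<lambda>z. (F \<gamma> z - F \<eta> z)\<^sup>2) (LINT t|circle_measure. \<bar>\<gamma> t - \<eta> t\<bar>)"
  proof (rule has_bochner_integral_cylinder)
    fix t :: real
    have "(\<integral>\<^sup>+x. ennreal ((F \<gamma> (t, x) - F \<eta> (t, x))\<^sup>2) * indicator {0..} x \<partial>lborel)
        = (\<integral>\<^sup>+x. indicator {min (\<gamma> t) (\<eta> t)<..max (\<gamma> t) (\<eta> t)} x \<partial>lborel)"
      using assms(2,4)[of t]
      by (intro nn_integral_cong) (auto simp: F_def hyp_def indicator_def min_def max_def)
    also have "\<dots> = ennreal \<bar>\<gamma> t - \<eta> t\<bar>"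
      by (simp add: min_def max_def)
    finally show "(\<integral>\<^sup>+x. ennreal ((F \<gamma> (t, x) - F \<eta> (t, x))\<^sup>2) * indicator {0..} x \<partial>lborel) = ennreal \<bar>\<gamma> t - \<eta> t\<bar>" .
  next
    show "integrable circle_measure (\<lambda>t. \<bar>\<gamma> t - \<eta> t\<bar>)"
      using assms by (intro integrable_circle_continuous continuous_intros)
  qed auto
  then show ?thesis by (simp add: L2_norm_power2 has_bochner_integral_iff)
qed

section \<open>Minimizers and the source condition\<close>

lemma H1_plus_D:
  assumes "\<gamma> \<in> H1_plus"
  shows "\<gamma> \<in> H1" "continuous_on UNIV \<gamma>" "\<And>t. 0 \<le> \<gamma> t" "F \<gamma> \<in> Lp 2 cylinder_measure"
  using assms F_Lp_2[of \<gamma>] by (auto simp: H1_plus_def dest: H1_D(1))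

text \<open>Minimality compares the functional with its value at \<open>\<gamma>\<^sub>0\<close>;
  the triangle inequality, squared as \<tau>^2 \<le> 2 S^2 + 2 e^2, then exchanges the misfit to
  noisy data for the one to exact data. The half misfit left on the right is what later absorption
  consumes.\<close>

lemma tikhonov_minimizer_bound:
  assumes "\<gamma>\<^sub>0 \<in> H1_plus" "v \<in> Lp 2 cylinder_measure"
    and "L2_norm cylinder_measure (\<lambda>z. v z - F \<gamma>\<^sub>0 z) \<le> \<delta>" "tikhonov_minimizer \<alpha> v \<gamma>"
  shows "\<gamma> \<in> H1_plus"
    and "\<alpha> * ((H1_seminorm \<gamma>)\<^sup>2 - (H1_seminorm \<gamma>\<^sub>0)\<^sup>2)
      \<le> 2 * \<delta>\<^sup>2 - (L2_norm cylinder_measure (\<lambda>z. F \<gamma> z - F \<gamma>\<^sub>0 z))\<^sup>2 / 2"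
proof -
  show \<gamma>: "\<gamma> \<in> H1_plus"
    using assms(4) by (auto simp: tikhonov_minimizer_def is_arg_min_def)
  have min: "tikhonov \<alpha> v \<gamma> \<le> tikhonov \<alpha> v \<gamma>\<^sub>0"
    using assms(1,4) by (auto simp: tikhonov_minimizer_def is_arg_min_def not_less)
  note H = H1_plus_D(4)[OF \<gamma>] H1_plus_D(4)[OF assms(1)]
  define S where "S = L2_norm cylinder_measure (\<lambda>z. F \<gamma> z - v z)"
  define e where "e = L2_norm cylinder_measure (\<lambda>z. v z - F \<gamma>\<^sub>0 z)"
  define \<tau> where "\<tau> = L2_norm cylinder_measure (\<lambda>z. F \<gamma> z - F \<gamma>\<^sub>0 z)"
  have nonneg: "0 \<le> S" "0 \<le> e" "0 \<le> \<tau>" by (simp_all add: S_def e_def \<tau>_def)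
  have "\<tau> \<le> S + e"
    using L2_norm_triangle_diff[OF H(1) assms(2) H(2)] by (simp add: S_def e_def \<tau>_def)
  then have "\<tau>\<^sup>2 \<le> (S + e)\<^sup>2" using nonneg by (intro power_mono)
  also have "\<dots> \<le> 2 * S\<^sup>2 + 2 * e\<^sup>2"
    using sum_squares_bound[of S e] by (simp add: power2_sum)
  finally have "\<tau>\<^sup>2 \<le> 2 * S\<^sup>2 + 2 * e\<^sup>2" .
  moreover have "L2_norm cylinder_measure (\<lambda>z. F \<gamma>\<^sub>0 z - v z) = e"
    using L2_norm_minus_commute[of cylinder_measure v "F \<gamma>\<^sub>0"] by (simp add: e_def)
  then have "S\<^sup>2 + \<alpha> * (H1_seminorm \<gamma>)\<^sup>2 \<le> e\<^sup>2 + \<alpha> * (H1_seminorm \<gamma>\<^sub>0)\<^sup>2"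
    using min by (simp add: tikhonov_def S_def)
  moreover have "e\<^sup>2 \<le> \<delta>\<^sup>2"
    using assms(3) nonneg by (intro power_mono) (auto simp: e_def)
  ultimately show "\<alpha> * ((H1_seminorm \<gamma>)\<^sup>2 - (H1_seminorm \<gamma>\<^sub>0)\<^sup>2)
      \<le> 2 * \<delta>\<^sup>2 - (L2_norm cylinder_measure (\<lambda>z. F \<gamma> z - F \<gamma>\<^sub>0 z))\<^sup>2 / 2"
    unfolding \<tau>_def[symmetric] by (simp add: right_diff_distrib)
qed

text \<open>Polarization about \<open>\<gamma>\<^sub>0\<close>: the source estimate bounds the cross
  term, its L^1 norm being the squared data misfit. The scale \<delta> stays free, so this is a
  family of inequalities with one common constant.\<close>

lemma variational_source_condition:
  fixes s q' :: real
  assumes "\<gamma>\<^sub>0 \<in> H1_plus" "distribution_of (\<lambda>t. complex_of_real (\<gamma>\<^sub>0 t)) \<in> fractional_sobolev s q"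
    and "1 < s" "s \<le> 2" "2 \<le> q" "1 / q + 1 / ennreal q' = 1"
  defines "\<kappa> \<equiv> (s - 1) / q'"
  obtains C where "0 \<le> C"
    "\<And>\<gamma> \<delta>. \<gamma> \<in> H1_plus \<Longrightarrow> 0 < \<delta> \<Longrightarrow> \<delta> \<le> 1 \<Longrightarrow>
      (H1_seminorm (\<lambda>t. \<gamma> t - \<gamma>\<^sub>0 t))\<^sup>2 \<le> (H1_seminorm \<gamma>)\<^sup>2 - (H1_seminorm \<gamma>\<^sub>0)\<^sup>2
        + C * (\<delta> powr \<kappa> * H1_seminorm (\<lambda>t. \<gamma> t - \<gamma>\<^sub>0 t)
             + \<delta> powr (\<kappa> - 1) * (L2_norm cylinder_measure (\<lambda>z. F \<gamma> z - F \<gamma>\<^sub>0 z))\<^sup>2)"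
proof -
  note \<gamma>\<^sub>0 = H1_plus_D[OF assms(1)]
  obtain C where C: "0 \<le> C"
    "\<And>f d \<delta>. f \<in> Lp 2 circle_measure \<Longrightarrow> d \<in> Lp 2 circle_measure \<Longrightarrow> is_weak_deriv f d \<Longrightarrow> 0 < \<delta> \<Longrightarrow> \<delta> \<le> 1 \<Longrightarrow>
      \<bar>LINT t|circle_measure. weak_deriv \<gamma>\<^sub>0 t * d t\<bar>
      \<le> C * (\<delta> powr \<kappa> * L2_norm circle_measure d + \<delta> powr (\<kappa> - 1) * (LINT t|circle_measure. \<bar>f t\<bar>))"
    unfolding \<kappa>_def by (rule source_estimate[OF \<gamma>\<^sub>0(1) assms(2-6)]) (rule that[unfolded \<kappa>_def]; blast)
  show thesis
  proof (rule that[of "2 * C"])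
    fix \<gamma> and \<delta> :: real assume \<gamma>: "\<gamma> \<in> H1_plus" and \<delta>: "0 < \<delta>" "\<delta> \<le> 1"
    note \<gamma>' = H1_plus_D[OF \<gamma>]
    note diff = H1_diff[OF \<gamma>'(1) \<gamma>\<^sub>0(1)]
    have "\<bar>LINT t|circle_measure. weak_deriv \<gamma>\<^sub>0 t * (weak_deriv \<gamma> t - weak_deriv \<gamma>\<^sub>0 t)\<bar>
      \<le> C * (\<delta> powr \<kappa> * H1_seminorm (\<lambda>t. \<gamma> t - \<gamma>\<^sub>0 t)
             + \<delta> powr (\<kappa> - 1) * (L2_norm cylinder_measure (\<lambda>z. F \<gamma> z - F \<gamma>\<^sub>0 z))\<^sup>2)"
      using C(2)[OF H1_D(3)[OF diff(1)] diff(3,2) \<delta>]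
      unfolding H1_seminorm_eq[OF diff(1,3,2)] L2_norm_F_diff[OF \<gamma>'(2,3) \<gamma>\<^sub>0(2,3)] .
    then show "(H1_seminorm (\<lambda>t. \<gamma> t - \<gamma>\<^sub>0 t))\<^sup>2 \<le> (H1_seminorm \<gamma>)\<^sup>2 - (H1_seminorm \<gamma>\<^sub>0)\<^sup>2
        + 2 * C * (\<delta> powr \<kappa> * H1_seminorm (\<lambda>t. \<gamma> t - \<gamma>\<^sub>0 t)
             + \<delta> powr (\<kappa> - 1) * (L2_norm cylinder_measure (\<lambda>z. F \<gamma> z - F \<gamma>\<^sub>0 z))\<^sup>2)"
      using H1_seminorm_expand[OF \<gamma>'(1) \<gamma>\<^sub>0(1)] by linarith
  qed (use C(1) in simp)
qed

section \<open>Convergence rates\<close>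

theorem corollary4p5:
  fixes \<gamma>\<^sub>0 :: "real \<Rightarrow> real" and u :: "real \<times> real \<Rightarrow> real"
    and s q_star :: real and q :: ennreal
  assumes "\<gamma>\<^sub>0 \<in> H1_plus"
    and "u = F \<gamma>\<^sub>0"
    and "distribution_of (\<lambda>t. complex_of_real (\<gamma>\<^sub>0 t)) \<in> fractional_sobolev s q"
    and "1 < s" and "s \<le> 2" and "2 \<le> q" and "q \<le> \<infinity>"
    and "1 / q + 1 / ennreal q_star = 1"
  shows "(q < \<infinity> \<or> s < 2 \<longrightarrow>
      (\<forall>\<alpha> :: real \<Rightarrow> real.
        (\<exists>a b. 0 < a \<and> a \<le> b \<and>
          (\<forall>\<^sub>F \<delta> in at_right 0.
             a * \<delta> powr (2 * ((q_star - s + 1) / q_star)) \<le> \<alpha> \<delta> \<and>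
             \<alpha> \<delta> \<le> b * \<delta> powr (2 * ((q_star - s + 1) / q_star)))) \<longrightarrow>
        (\<exists>C. \<forall>\<^sub>F \<delta> in at_right 0. \<forall>v\<in>Lp 2 cylinder_measure. \<forall>\<gamma>.
           L2_norm cylinder_measure (\<lambda>z. v z - u z) \<le> \<delta> \<longrightarrow>
           tikhonov_minimizer (\<alpha> \<delta>) v \<gamma> \<longrightarrow>
           H1_seminorm (\<lambda>t. \<gamma> t - \<gamma>\<^sub>0 t) \<le> C * \<delta> powr ((s - 1) / q_star))))
    \<and> (q = \<infinity> \<and> s = 2 \<longrightarrow>
      (let source_condition = (\<lambda>c\<^sub>1 c\<^sub>2. \<forall>\<gamma>\<in>H1_plus.
             c\<^sub>1 * (H1_seminorm (\<lambda>t. \<gamma> t - \<gamma>\<^sub>0 t))\<^sup>2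
               \<le> (H1_seminorm \<gamma>)\<^sup>2 - (H1_seminorm \<gamma>\<^sub>0)\<^sup>2
                 + c\<^sub>2 * (L2_norm cylinder_measure (\<lambda>z. F \<gamma> z - F \<gamma>\<^sub>0 z))\<^sup>2)
       in (\<exists>c\<^sub>1>0. \<exists>c\<^sub>2>0. source_condition c\<^sub>1 c\<^sub>2) \<and>
          (\<forall>c\<^sub>1>0. \<forall>c\<^sub>2>0. source_condition c\<^sub>1 c\<^sub>2 \<longrightarrow>
            (\<forall>\<alpha>::real. 0 < \<alpha> \<and> \<alpha> \<le> 1 / (2 * c\<^sub>2) \<longrightarrow>
              (\<exists>C. \<forall>\<^sub>F \<delta> in at_right 0. \<forall>v\<in>Lp 2 cylinder_measure. \<forall>\<gamma>.
                 L2_norm cylinder_measure (\<lambda>z. v z - u z) \<le> \<delta> \<longrightarrow>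
                 tikhonov_minimizer \<alpha> v \<gamma> \<longrightarrow>
                 H1_seminorm (\<lambda>t. \<gamma> t - \<gamma>\<^sub>0 t) \<le> C * \<delta>)))))"
proof (intro conjI impI)
  let ?X = "\<lambda>\<gamma>. H1_seminorm (\<lambda>t. \<gamma> t - \<gamma>\<^sub>0 t)"
  let ?Y = "\<lambda>\<gamma>. (L2_norm cylinder_measure (\<lambda>z. F \<gamma> z - F \<gamma>\<^sub>0 z))\<^sup>2"
  define \<kappa> where "\<kappa> = (s - 1) / q_star"
  obtain C where C: "0 \<le> C"
    "\<And>\<gamma> \<delta>. \<gamma> \<in> H1_plus \<Longrightarrow> 0 < \<delta> \<Longrightarrow> \<delta> \<le> 1 \<Longrightarrow>
      (?X \<gamma>)\<^sup>2 \<le> (H1_seminorm \<gamma>)\<^sup>2 - (H1_seminorm \<gamma>\<^sub>0)\<^sup>2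
        + C * (\<delta> powr \<kappa> * ?X \<gamma> + \<delta> powr (\<kappa> - 1) * ?Y \<gamma>)"
    unfolding \<kappa>_def
    by (rule variational_source_condition[OF assms(1,3,4,5,6,8)]) (rule that[unfolded \<kappa>_def]; blast)
  have X_nonneg: "0 \<le> ?X \<gamma>" for \<gamma> by (simp add: H1_seminorm_def)
  {
    assume rate: "q < \<infinity> \<or> s < 2"
    have "0 < q_star" and "\<kappa> < 1"
    proof -
      \<comment> \<open>If q is finite then \<open>q_star\<close> > 1 \<ge> s - 1; if q is infinite
        then \<open>q_star\<close> = 1 and the assumption leaves s < 2.\<close>
      have "0 < q_star \<and> s - 1 < q_star"
        using assms(6,8)
      proof (cases rule: conjugate_exponent_cases)
        case infinite
        with rate show ?thesis by simp
      next
        case (finite r)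
        have "1 / q_star < 1" using finite(1,4) by (smt (verit) zero_less_divide_1_iff)
        with finite(3) have "1 < q_star" by (simp add: divide_less_eq)
        with assms(5) show ?thesis by simp
      qed
      then show "0 < q_star" "\<kappa> < 1" by (simp_all add: \<kappa>_def divide_less_eq)
    qed
    have exponent: "2 * ((q_star - s + 1) / q_star) = 2 - 2 * \<kappa>"
      using \<open>0 < q_star\<close> by (simp add: \<kappa>_def field_simps)
    show "\<forall>\<alpha> :: real \<Rightarrow> real.
        (\<exists>a b. 0 < a \<and> a \<le> b \<and>
          (\<forall>\<^sub>F \<delta> in at_right 0.
             a * \<delta> powr (2 * ((q_star - s + 1) / q_star)) \<le> \<alpha> \<delta> \<and>
             \<alpha> \<delta> \<le> b * \<delta> powr (2 * ((q_star - s + 1) / q_star)))) \<longrightarrow>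
        (\<exists>C. \<forall>\<^sub>F \<delta> in at_right 0. \<forall>v\<in>Lp 2 cylinder_measure. \<forall>\<gamma>.
           L2_norm cylinder_measure (\<lambda>z. v z - u z) \<le> \<delta> \<longrightarrow>
           tikhonov_minimizer (\<alpha> \<delta>) v \<gamma> \<longrightarrow>
           H1_seminorm (\<lambda>t. \<gamma> t - \<gamma>\<^sub>0 t) \<le> C * \<delta> powr ((s - 1) / q_star))"
      unfolding exponent \<kappa>_def[symmetric] assms(2)
    proof (intro allI impI, elim exE conjE)
      fix \<alpha> :: "real \<Rightarrow> real" and a b
      assume ab: "0 < a" "a \<le> b"
        and ev: "\<forall>\<^sub>F \<delta> in at_right 0. a * \<delta> powr (2 - 2 * \<kappa>) \<le> \<alpha> \<delta> \<and> \<alpha> \<delta> \<le> b * \<delta> powr (2 - 2 * \<kappa>)"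
      \<comment> \<open>The larger root of x^2 = C x + 2 / a, the quadratic that X /
        \<delta>^\<kappa> will satisfy as an inequality.\<close>
      define D where "D = C / 2 + sqrt (2 / a + (C / 2)\<^sup>2)"
      \<comment> \<open>The upper bound b \<delta>^(2 - 2 \<kappa>) for \<alpha> times C
        \<delta>^(\<kappa> - 1) has the positive exponent 1 - \<kappa>; once twice this product is
        below 1, the half misfit absorbs the misfit term.\<close>
      have "((\<lambda>\<delta>. 2 * b * C * \<delta> powr (1 - \<kappa>)) \<longlongrightarrow> 2 * b * C * 0 powr (1 - \<kappa>)) (at_right 0)"
        using \<open>\<kappa> < 1\<close>
        by (intro tendsto_mult tendsto_const tendsto_powr' tendsto_ident_at) (auto simp: eventually_at_filter)
      then have small: "\<forall>\<^sub>F \<delta> in at_right 0. 2 * b * C * \<delta> powr (1 - \<kappa>) < 1"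
        by (rule order_tendstoD) simp
      have "\<forall>\<^sub>F \<delta> in at_right (0::real). \<delta> < 1"
        by (intro order_tendstoD(2)[OF tendsto_ident_at]) simp
      with ev small eventually_at_right_less[of 0]
      have "\<forall>\<^sub>F \<delta> in at_right 0. \<forall>v\<in>Lp 2 cylinder_measure. \<forall>\<gamma>.
           L2_norm cylinder_measure (\<lambda>z. v z - F \<gamma>\<^sub>0 z) \<le> \<delta> \<longrightarrow>
           tikhonov_minimizer (\<alpha> \<delta>) v \<gamma> \<longrightarrow> ?X \<gamma> \<le> D * \<delta> powr \<kappa>"
      proof eventually_elim
        case (elim \<delta>)
        show ?case
        proof (intro ballI allI impI)
          fix v \<gamma>
          assume v: "v \<in> Lp 2 cylinder_measure" "L2_norm cylinder_measure (\<lambda>z. v z - F \<gamma>\<^sub>0 z) \<le> \<delta>"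
            and min: "tikhonov_minimizer (\<alpha> \<delta>) v \<gamma>"
          note \<gamma> = tikhonov_minimizer_bound[OF assms(1) v min]
          define X where "X = ?X \<gamma>"
          define Y where "Y = ?Y \<gamma>"
          define y where "y = \<delta> powr \<kappa>"
          have "0 < \<delta>" "0 \<le> X" "0 \<le> Y" "0 < y" using elim X_nonneg by (auto simp: X_def Y_def y_def)
          have \<alpha>: "0 < \<alpha> \<delta>"
            using elim(1) mult_pos_pos[OF ab(1), of "\<delta> powr (2 - 2 * \<kappa>)"] \<open>0 < \<delta>\<close> by auto
          have "\<alpha> \<delta> * X\<^sup>2 \<le> \<alpha> \<delta> * ((H1_seminorm \<gamma>)\<^sup>2 - (H1_seminorm \<gamma>\<^sub>0)\<^sup>2
              + C * (y * X + \<delta> powr (\<kappa> - 1) * Y))"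
            using C(2)[OF \<gamma>(1), of \<delta>] elim \<alpha> by (intro mult_left_mono) (auto simp: X_def Y_def y_def)
          also have "\<dots> \<le> 2 * \<delta>\<^sup>2 - Y / 2 + \<alpha> \<delta> * C * y * X + \<alpha> \<delta> * (C * \<delta> powr (\<kappa> - 1) * Y)"
            using \<gamma>(2) by (simp add: Y_def algebra_simps)
          also have "\<alpha> \<delta> * (C * \<delta> powr (\<kappa> - 1) * Y) \<le> b * \<delta> powr (2 - 2 * \<kappa>) * (C * \<delta> powr (\<kappa> - 1) * Y)"
            using elim(1) C(1) \<open>0 \<le> Y\<close> by (intro mult_right_mono) auto
          also have "\<dots> = (2 * b * C * \<delta> powr (1 - \<kappa>)) * (Y / 2)"
          proof -
            have "\<delta> powr (2 - 2 * \<kappa>) * \<delta> powr (\<kappa> - 1) = \<delta> powr (1 - \<kappa>)"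
              by (simp flip: powr_add)
            then have "b * \<delta> powr (2 - 2 * \<kappa>) * (C * \<delta> powr (\<kappa> - 1) * Y) = b * C * \<delta> powr (1 - \<kappa>) * Y"
              by (metis (no_types, opaque_lifting) mult.assoc mult.left_commute)
            then show ?thesis by simp
          qed
          also have "\<dots> \<le> Y / 2"
            using mult_right_mono[OF less_imp_le[OF elim(2)], of "Y / 2"] \<open>0 \<le> Y\<close> by simp
          finally have "\<alpha> \<delta> * X\<^sup>2 \<le> 2 * \<delta>\<^sup>2 + \<alpha> \<delta> * (C * y * X)" by (simp add: mult.assoc)
          \<comment> \<open>\<delta>^2 is split as \<delta>^(2 - 2 \<kappa>) y^2 so that the lower
            bound on \<alpha> applies and \<alpha> can be divided out.\<close>
          also have "2 * \<delta>\<^sup>2 = 2 / a * (a * \<delta> powr (2 - 2 * \<kappa>)) * y\<^sup>2"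
          proof -
            have "\<delta> powr (2 - 2 * \<kappa>) * y\<^sup>2 = \<delta> powr 2"
              by (simp add: y_def power2_eq_square flip: powr_add)
            then show ?thesis using ab(1) \<open>0 < \<delta>\<close> by (simp add: mult.assoc)
          qed
          also have "2 / a * (a * \<delta> powr (2 - 2 * \<kappa>)) * y\<^sup>2 \<le> 2 / a * \<alpha> \<delta> * y\<^sup>2"
            using elim(1) ab(1) by (intro mult_right_mono mult_left_mono) auto
          finally have "\<alpha> \<delta> * X\<^sup>2 \<le> \<alpha> \<delta> * (2 / a * y\<^sup>2 + C * y * X)"
            by (simp add: algebra_simps)
          then have "X\<^sup>2 \<le> 2 / a * y\<^sup>2 + C * y * X"
            using \<alpha> by simp
          then have "(X - C / 2 * y)\<^sup>2 \<le> (2 / a + (C / 2)\<^sup>2) * y\<^sup>2"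
            by (simp add: power2_eq_square algebra_simps)
          then have "\<bar>X - C / 2 * y\<bar> \<le> sqrt ((2 / a + (C / 2)\<^sup>2) * y\<^sup>2)"
            using real_sqrt_le_mono real_sqrt_abs by metis
          also have "\<dots> = sqrt (2 / a + (C / 2)\<^sup>2) * y"
            using \<open>0 < y\<close> by (simp add: real_sqrt_mult)
          finally have "X \<le> D * y" by (simp add: D_def algebra_simps)
          then show "?X \<gamma> \<le> D * \<delta> powr \<kappa>" by (simp add: X_def y_def)
        qed
      qed
      then show "\<exists>C. \<forall>\<^sub>F \<delta> in at_right 0. \<forall>v\<in>Lp 2 cylinder_measure. \<forall>\<gamma>.
           L2_norm cylinder_measure (\<lambda>z. v z - F \<gamma>\<^sub>0 z) \<le> \<delta> \<longrightarrow>
           tikhonov_minimizer (\<alpha> \<delta>) v \<gamma> \<longrightarrow> ?X \<gamma> \<le> C * \<delta> powr \<kappa>"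
        by blast
    qed
  next
    assume rate: "q = \<infinity> \<and> s = 2"
    have "q_star = 1"
      using assms(6,8) by (cases rule: conjugate_exponent_cases) (use rate in auto)
    with rate have \<kappa>: "\<kappa> = 1" by (simp add: \<kappa>_def)
    \<comment> \<open>For \<kappa> = 1 only the term with \<delta> X depends on \<delta>, and it can
      be sent to 0. The constant is raised to C + 1 because C may be 0 while
      \<open>c\<^sub>2\<close> has to be positive.\<close>
    have source: "(?X \<gamma>)\<^sup>2 \<le> (H1_seminorm \<gamma>)\<^sup>2 - (H1_seminorm \<gamma>\<^sub>0)\<^sup>2 + (C + 1) * ?Y \<gamma>" if \<gamma>: "\<gamma> \<in> H1_plus" for \<gamma>
    proof -
      have "(?X \<gamma>)\<^sup>2 \<le> (H1_seminorm \<gamma>)\<^sup>2 - (H1_seminorm \<gamma>\<^sub>0)\<^sup>2 + C * ?Y \<gamma> + e" if "0 < e" for e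
      proof -
        \<comment> \<open>Small enough for C \<delta> X \<le> e; the summand 1 keeps the denominator
          positive.\<close>
        define \<delta> where "\<delta> = min 1 (e / (C * ?X \<gamma> + 1))"
        have pos: "0 < C * ?X \<gamma> + 1" using C(1) X_nonneg[of \<gamma>] by (simp add: add_nonneg_pos)
        then have \<delta>: "0 < \<delta>" "\<delta> \<le> 1" using that by (auto simp: \<delta>_def)
        have "\<delta> * (C * ?X \<gamma> + 1) \<le> e"
          using pos by (simp add: \<delta>_def flip: pos_le_divide_eq)
        then have "C * (\<delta> * ?X \<gamma>) \<le> e"
          using \<delta>(1) by (simp add: algebra_simps)
        then show ?thesis
          using C(2)[OF \<gamma> \<delta>] \<delta>(1) by (simp add: \<kappa> distrib_left)
      qed
      then have "(?X \<gamma>)\<^sup>2 \<le> (H1_seminorm \<gamma>)\<^sup>2 - (H1_seminorm \<gamma>\<^sub>0)\<^sup>2 + C * ?Y \<gamma>"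
        by (rule field_le_epsilon)
      then show ?thesis
        using zero_le_power2[of "L2_norm cylinder_measure (\<lambda>z. F \<gamma> z - F \<gamma>\<^sub>0 z)"]
        unfolding distrib_right by linarith
    qed
    have ex: "\<exists>c\<^sub>1>0. \<exists>c\<^sub>2>0. \<forall>\<gamma>\<in>H1_plus. c\<^sub>1 * (?X \<gamma>)\<^sup>2
        \<le> (H1_seminorm \<gamma>)\<^sup>2 - (H1_seminorm \<gamma>\<^sub>0)\<^sup>2 + c\<^sub>2 * ?Y \<gamma>"
    proof (rule exI[of _ 1], intro conjI)
      show "\<exists>c\<^sub>2>0. \<forall>\<gamma>\<in>H1_plus. 1 * (?X \<gamma>)\<^sup>2
        \<le> (H1_seminorm \<gamma>)\<^sup>2 - (H1_seminorm \<gamma>\<^sub>0)\<^sup>2 + c\<^sub>2 * ?Y \<gamma>"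
        using C(1) source by (intro exI[of _ "C + 1"]) auto
    qed simp
    have conv: "\<exists>D. \<forall>\<^sub>F \<delta> in at_right 0. \<forall>v\<in>Lp 2 cylinder_measure. \<forall>\<gamma>.
                 L2_norm cylinder_measure (\<lambda>z. v z - u z) \<le> \<delta> \<longrightarrow>
                 tikhonov_minimizer \<alpha> v \<gamma> \<longrightarrow> ?X \<gamma> \<le> D * \<delta>"
      if c: "0 < c\<^sub>1" "0 < c\<^sub>2" and source: "\<forall>\<gamma>\<in>H1_plus. c\<^sub>1 * (?X \<gamma>)\<^sup>2
        \<le> (H1_seminorm \<gamma>)\<^sup>2 - (H1_seminorm \<gamma>\<^sub>0)\<^sup>2 + c\<^sub>2 * ?Y \<gamma>"
      and \<alpha>: "0 < \<alpha>" "\<alpha> \<le> 1 / (2 * c\<^sub>2)" for c\<^sub>1 c\<^sub>2 \<alpha> :: real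
    proof (intro exI[of _ "sqrt (2 / (\<alpha> * c\<^sub>1))"] eventually_mono[OF eventually_at_right_less[of 0]] ballI allI impI)
      fix \<delta> :: real and v \<gamma>
      assume "0 < \<delta>" and v: "v \<in> Lp 2 cylinder_measure" "L2_norm cylinder_measure (\<lambda>z. v z - u z) \<le> \<delta>"
        and min: "tikhonov_minimizer \<alpha> v \<gamma>"
      note \<gamma> = tikhonov_minimizer_bound[OF assms(1) v(1) v(2)[unfolded assms(2)] min]
      have "\<alpha> * (c\<^sub>1 * (?X \<gamma>)\<^sup>2) \<le> \<alpha> * ((H1_seminorm \<gamma>)\<^sup>2 - (H1_seminorm \<gamma>\<^sub>0)\<^sup>2 + c\<^sub>2 * ?Y \<gamma>)"
        using source \<gamma>(1) \<alpha>(1) by (intro mult_left_mono) auto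
      also have "\<dots> \<le> 2 * \<delta>\<^sup>2 - ?Y \<gamma> / 2 + \<alpha> * c\<^sub>2 * ?Y \<gamma>"
        using \<gamma>(2) by (simp add: algebra_simps)
      \<comment> \<open>The bound on \<alpha> says that \<open>\<alpha> * c\<^sub>2\<close> is at
        most 1/2, exactly the half misfit that minimality left over.\<close>
      also have "\<alpha> * c\<^sub>2 * ?Y \<gamma> \<le> 1 / 2 * ?Y \<gamma>"
        using \<alpha>(2) c(2) by (intro mult_right_mono) (simp_all add: field_simps)
      finally have "(?X \<gamma>)\<^sup>2 \<le> 2 / (\<alpha> * c\<^sub>1) * \<delta>\<^sup>2"
        using \<alpha>(1) c(1) by (simp add: field_simps)
      then have "sqrt ((?X \<gamma>)\<^sup>2) \<le> sqrt (2 / (\<alpha> * c\<^sub>1) * \<delta>\<^sup>2)" by (rule real_sqrt_le_mono)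
      then show "?X \<gamma> \<le> sqrt (2 / (\<alpha> * c\<^sub>1)) * \<delta>"
        using X_nonneg[of \<gamma>] \<open>0 < \<delta>\<close> by (simp only: real_sqrt_mult real_sqrt_abs abs_of_nonneg abs_of_pos)
    qed
    show "let source_condition = (\<lambda>c\<^sub>1 c\<^sub>2. \<forall>\<gamma>\<in>H1_plus.
             c\<^sub>1 * (H1_seminorm (\<lambda>t. \<gamma> t - \<gamma>\<^sub>0 t))\<^sup>2
               \<le> (H1_seminorm \<gamma>)\<^sup>2 - (H1_seminorm \<gamma>\<^sub>0)\<^sup>2
                 + c\<^sub>2 * (L2_norm cylinder_measure (\<lambda>z. F \<gamma> z - F \<gamma>\<^sub>0 z))\<^sup>2)
       in (\<exists>c\<^sub>1>0. \<exists>c\<^sub>2>0. source_condition c\<^sub>1 c\<^sub>2) \<and>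
          (\<forall>c\<^sub>1>0. \<forall>c\<^sub>2>0. source_condition c\<^sub>1 c\<^sub>2 \<longrightarrow>
            (\<forall>\<alpha>::real. 0 < \<alpha> \<and> \<alpha> \<le> 1 / (2 * c\<^sub>2) \<longrightarrow>
              (\<exists>C. \<forall>\<^sub>F \<delta> in at_right 0. \<forall>v\<in>Lp 2 cylinder_measure. \<forall>\<gamma>.
                 L2_norm cylinder_measure (\<lambda>z. v z - u z) \<le> \<delta> \<longrightarrow>
                 tikhonov_minimizer \<alpha> v \<gamma> \<longrightarrow>
                 H1_seminorm (\<lambda>t. \<gamma> t - \<gamma>\<^sub>0 t) \<le> C * \<delta>)))"
      unfolding Let_def
    proof (intro conjI allI impI)
      show "\<exists>c\<^sub>1>0. \<exists>c\<^sub>2>0. \<forall>\<gamma>\<in>H1_plus. c\<^sub>1 * (?X \<gamma>)\<^sup>2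
        \<le> (H1_seminorm \<gamma>)\<^sup>2 - (H1_seminorm \<gamma>\<^sub>0)\<^sup>2 + c\<^sub>2 * ?Y \<gamma>" by (fact ex)
    qed (elim conjE, rule conv)
  }
qed

end
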